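(* Let $\sigma$ be the spectral function of the boundary value problem $Lf=\lambda f$, $f_2(0)=Hf_1(0)$, and let $\sigma_0(\lambda)=\frac{1}{2\pi}B_1^{-1}\lambda$ be the corresponding spectral function for $Q=0$. Put $\Sigma:=\sigma-\sigma_0$. 1. Let $L$ be of class $(T_B)$ and let $I+R=(I+K)^{-1}$, with kernel $R(x,t)$, be the inverse of the transformation operator $I+K$, so that $e_0(x,\lambda)=Y(x,\lambda)+\int_0^xR(x,t)Y(t,\lambda)\,dt$. Define the $2n\times 2n$ matrix function $$F(x,t):=\begin{cases}R(x,t)+\int_0^tR(x,s)R(t,s)^*\,ds,& x>t>0,\\[2pt] R(t,x)^*+\int_0^xR(x,s)R(t,s)^*\,ds,& 0<x<t.\end{cases}$$ Then for all $f,g\in L^2_{\rm comp}(\mathbb{R}_+,\mathbb{C}^{2n})$ $$\int_{\mathbb{R}}F_0(\lambda)^*\,d\Sigma(\lambda)\,G_0(\lambda)=\int_0^\infty\int_0^\infty f(x)^*F(x,t)g(t)\,dx\,dt,\qquad(\ast)$$ where $F_0,G_0$ denote the $\mathcal{F}_{H,0}$-transforms of $f,g$. 2. Again assuming $L$ to be of class $(T_B)$, put $\tilde e_0(x,\lambda):=\int_0^xe_0(t,\lambda)\,dt$. Then the function $$\tilde F(x,t):=\int_{\mathbb{R}}\tilde e_0(x,\lambda)\,d\Sigma(\lambda)\,\tilde e_0(t,\lambda)^*\qquad(\ast\ast)$$ exists and has a continuous mixed second derivative which coincides with $F(x,t)$, i.e. $\frac{\partial^2}{\partial x\partial t}\tilde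 F(x,t)=F(x,t)$. 3. Conversely, given any increasing $n\times n$ matrix function $\sigma$, put $\Sigma:=\sigma-\sigma_0$. If the integral $(\ast\ast)$ exists and has a continuous mixed second derivative $F_1(x,t):=\frac{\partial^2}{\partial x\partial t}\tilde F(x,t)$, then $(\ast)$ holds for all $f,g\in L^2_{\rm comp}(\mathbb{R}_+,\mathbb{C}^{2n})$ with $F_1$ instead of $F$.
   Context: Let $n\ge 1$, $\mathbb{R}_+=[0,\infty)$. Let $B=\mathrm{diag}(B_1,-B_2)$ with $B_1,B_2\in \mathrm{M}(n,\mathbb{C})$ self-adjoint positive definite, let $H\in \mathrm{M}(n,\mathbb{C})$ satisfy $B_1=H^*B_2H$, and let $Q:\mathbb{R}_+\to \mathrm{M}(2n,\mathbb{C})$ be continuous with self-adjoint values. Put $L:=B\frac1i\frac{d}{dx}+Q(x)$, let $Y(x,\lambda)$ be the $2n\times n$ matrix solution of $LY=\lambda Y$, $Y(0,\lambda)=\binom{I}{H}$, and let $e_0(x,\lambda):=e^{i\lambda B^{-1}x}\binom{I}{H}$ be the corresponding solution for $Q=0$. For $f\in L^2_{\rm comp}(\mathbb{R}_+,\mathbb{C}^{2n})$ ($L^2$ with compact support in $[0,\infty)$) put $(\mathcal{F}_{H,Q}f)(\lambda):=\int_0^\infty Y(x,\lambda)^*f(x)\,dx$ and $(\mathcal{F}_{H,0}f)(\lambda):=\int_0^\infty e_0(x,\lambda)^*f(x)\,dx$. $L$ is of class $(T_B)$ if there is a continuous function $K:\{(x,t)\mid 0\le t\le x\}\to \mathrm{M}(2n,\mathbb{C})$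 with $Y(x,\lambda)=e_0(x,\lambda)+\int_0^xK(x,t)e_0(t,\lambda)\,dt$ for all $x\ge0$, $\lambda\in\mathbb{C}$. Such $K$ is unique; $K$ also denotes the Volterra operator $(Kf)(x)=\int_0^xK(x,t)f(t)\,dt$, and $I+K$ is called the transformation operator. $R:=(I+K)^{-1}-I$ is again a Volterra operator with continuous kernel $R(x,t)$, $t\le x$. An $n\times n$ matrix function $\sigma$ on $\mathbb{R}$ is increasing if its values are self-adjoint and $\sigma(\lambda)-\sigma(\mu)\ge0$ for $\mu<\lambda$; all such functions are taken right-continuous with value $0$ at $0$. $L^2_\sigma(\mathbb{R})$ is the Hilbert space completion of $C_0(\mathbb{R},\mathbb{C}^n)$ with respect to $(f,g)_{L^2_\sigma}=\int f^*d\sigma\, g:=\sum_{i,j}\int\overline{f_i}g_j\,d\sigma_{ij}$. The spectral function of the boundary value problem is the unique such $\sigma$ for which $\mathcal{F}_{H,Q}$ extends to an isometry $L^2(\mathbb{R}_+,\mathbb{C}^{2n})\to L^2_\sigma(\mathbb{R})$. Writing $d\sigma=\Phi\,d(\operatorname{tr}\sigma)$ with a nonnegative matrix density $\Phi$, $\int U\,d\sigma\,V^*$ means $\int U\Phi V^*\,d(\operatorname{tr}\sigma)$, and integrals against $d\Sigma$ are differences of those against $d\sigma$ and $d\sigma_0$.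
   Formalization: F jumps across x=t by R(x,x)-R(x,x)*, in general nonzero, so "continuous mixed second derivative" is read as: ∂F̃/∂t exists and is continuous for x,t≥0, its x-derivative is F (F₁ in 3) for x≠t, and this is continuous on each side up to the diagonal; part 3 includes everywhere-continuous F₁. *)

theory Defs
  imports "HOL-Analysis.Analysis"
begin

text \<open>
  \<open>M(n,\<complex>)\<close> is \<^typ>\<open>complex^'n^'n\<close>; vectors and matrices of size \<open>2n\<close> are indexed by the sum type
  \<^typ>\<open>'n + 'n\<close>. The half line is \<^term>\<open>{0..} :: real set\<close>; functions on it are total functions whose values
  at negative arguments are never used.
\<close>

subsection \<open>Complex matrices\<close>

definition mat_adj :: "complex^'a^'b \<Rightarrow> complex^'b^'a" where
  "mat_adj A = (\<chi> i j. cnj (A $ j $ i))"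

definition cinner :: "complex^'a \<Rightarrow> complex^'a \<Rightarrow> complex" where
  "cinner u v = (\<Sum>i\<in>UNIV. cnj (u $ i) * v $ i)"

text \<open>In both definitions the quadratic form is real, as \<open>A\<close> is self-adjoint.\<close>

definition pos_semidef :: "complex^'a^'a \<Rightarrow> bool" where
  "pos_semidef A \<longleftrightarrow> mat_adj A = A \<and> (\<forall>v. 0 \<le> Re (cinner v (A *v v)))"

definition pos_def :: "complex^'a^'a \<Rightarrow> bool" where
  "pos_def A \<longleftrightarrow> mat_adj A = A \<and> (\<forall>v. v \<noteq> 0 \<longrightarrow> 0 < Re (cinner v (A *v v)))"

definition mat_scale :: "complex \<Rightarrow> complex^'a^'b \<Rightarrow> complex^'a^'b" where
  "mat_scale c A = (\<chi> i j. c * A $ i $ j)"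

text \<open>The product \<open>(*)\<close> of the type \<open>vec\<close> is componentwise, so \<open>(^)\<close> and \<^const>\<open>exp\<close> are not the matrix
  power and exponential.\<close>

primrec mat_pow :: "complex^'a^'a \<Rightarrow> nat \<Rightarrow> complex^'a^'a" where
  "mat_pow A 0 = mat 1"
| "mat_pow A (Suc k) = A ** mat_pow A k"

definition mat_exp :: "complex^'a^'a \<Rightarrow> complex^'a^'a" where
  "mat_exp A = (\<Sum>k. (1 / fact k) *\<^sub>R mat_pow A k)"

definition block_diag :: "complex^'n^'n \<Rightarrow> complex^'n^'n \<Rightarrow> complex^('n + 'n)^('n + 'n)" where
  "block_diag A D = (\<chi> i j. case i of
      Inl a \<Rightarrow> (case j of Inl b \<Rightarrow> A $ a $ b | Inr b \<Rightarrow> 0)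
    | Inr a \<Rightarrow> (case j of Inl b \<Rightarrow> 0 | Inr b \<Rightarrow> D $ a $ b))"

definition stack :: "complex^'n^'n \<Rightarrow> complex^'n^'n \<Rightarrow> complex^'n^('n + 'n)" where
  "stack A C = (\<chi> i j. case i of Inl a \<Rightarrow> A $ a $ j | Inr a \<Rightarrow> C $ a $ j)"

subsection \<open>The first order system\<close>

definition B_mat :: "complex^'n^'n \<Rightarrow> complex^'n^'n \<Rightarrow> complex^('n + 'n)^('n + 'n)" where
  "B_mat B1 B2 = block_diag B1 (- B2)"

text \<open>\<open>Y\<close> solves \<open>B (1/\<i>) Y' + Q Y = \<lambda> Y\<close> on the half line with \<open>Y(0,\<lambda>) = (I; H)\<close>, for every \<open>\<lambda>\<close>.\<close>

definition solution ::
  "complex^'n^'n \<Rightarrow> complex^'n^'n \<Rightarrow> complex^'n^'n \<Rightarrow> (real \<Rightarrow> complex^('n + 'n)^('n + 'n))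
    \<Rightarrow> (real \<Rightarrow> complex \<Rightarrow> complex^'n^('n + 'n)) \<Rightarrow> bool" where
  "solution B1 B2 H Q Y \<longleftrightarrow> (\<forall>l. Y 0 l = stack (mat 1) H \<and>
     (\<forall>x\<ge>0. \<exists>D. ((\<lambda>x. Y x l) has_vector_derivative D) (at x within {0..}) \<and>
        B_mat B1 B2 ** mat_scale (1 / \<i>) D + Q x ** Y x l = mat_scale l (Y x l)))"

definition e0 ::
  "complex^'n^'n \<Rightarrow> complex^'n^'n \<Rightarrow> complex^'n^'n \<Rightarrow> real \<Rightarrow> complex \<Rightarrow> complex^'n^('n + 'n)" where
  "e0 B1 B2 H x l =
     mat_exp (mat_scale (\<i> * l * of_real x) (matrix_inv (B_mat B1 B2))) ** stack (mat 1) H"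

definition e0_tilde ::
  "complex^'n^'n \<Rightarrow> complex^'n^'n \<Rightarrow> complex^'n^'n \<Rightarrow> real \<Rightarrow> complex \<Rightarrow> complex^'n^('n + 'n)" where
  "e0_tilde B1 B2 H x l = (LINT t:{0..x}|lborel. e0 B1 B2 H t l)"

definition L2_comp :: "(real \<Rightarrow> complex^'a) \<Rightarrow> bool" where
  "L2_comp f \<longleftrightarrow> set_borel_measurable lborel {0..} f \<and>
     set_integrable lborel {0..} (\<lambda>x. (norm (f x))\<^sup>2) \<and> (\<exists>a. \<forall>x>a. f x = 0)"

definition L2_loc :: "(real \<Rightarrow> complex^'a) \<Rightarrow> bool" where
  "L2_loc f \<longleftrightarrow> set_borel_measurable lborel {0..} f \<and>
     (\<forall>a. set_integrable lborel {0..a} (\<lambda>x. (norm (f x))\<^sup>2))"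

text \<open>\<open>(\<F> f)(\<lambda>)\<close>, the integral of \<open>E(x,\<lambda>)\<^sup>* f(x)\<close> over the half line: \<open>\<F>\<^bsub>H,Q\<^esub>\<close> for \<open>E = Y\<close> and
  \<open>\<F>\<^bsub>H,0\<^esub>\<close> for \<open>E = e\<^sub>0\<close>.\<close>

definition gen_fourier ::
  "(real \<Rightarrow> complex \<Rightarrow> complex^'n^'m) \<Rightarrow> (real \<Rightarrow> complex^'m) \<Rightarrow> real \<Rightarrow> complex^'n" where
  "gen_fourier E f l = (LINT x:{0..}|lborel. mat_adj (E x (of_real l)) *v f x)"

subsection \<open>Transformation operators\<close>

definition triangle :: "(real \<times> real) set" where
  "triangle = {(x, t). 0 \<le> t \<and> t \<le> x}"

text \<open>\<open>L\<close> is of class \<open>(T\<^sub>B)\<close> iff such a \<open>K\<close> exists.\<close>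

definition transformation_kernel ::
  "(real \<Rightarrow> complex \<Rightarrow> complex^'n^'m) \<Rightarrow> (real \<Rightarrow> complex \<Rightarrow> complex^'n^'m)
    \<Rightarrow> (real \<Rightarrow> real \<Rightarrow> complex^'m^'m) \<Rightarrow> bool" where
  "transformation_kernel E Y K \<longleftrightarrow> continuous_on triangle (\<lambda>(x, t). K x t) \<and>
     (\<forall>x\<ge>0. \<forall>l. Y x l = E x l + (LINT t:{0..x}|lborel. K x t ** E t l))"

definition volterra ::
  "(real \<Rightarrow> real \<Rightarrow> complex^'m^'m) \<Rightarrow> (real \<Rightarrow> complex^'m) \<Rightarrow> real \<Rightarrow> complex^'m" where
  "volterra K f x = (LINT t:{0..x}|lborel. K x t *v f t)"

text \<open>\<open>I + R\<close> is the two-sided inverse of \<open>I + K\<close> on locally square integrable functions.\<close>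

definition resolvent_kernel ::
  "(real \<Rightarrow> real \<Rightarrow> complex^'m^'m) \<Rightarrow> (real \<Rightarrow> real \<Rightarrow> complex^'m^'m) \<Rightarrow> bool" where
  "resolvent_kernel K R \<longleftrightarrow> continuous_on triangle (\<lambda>(x, t). R x t) \<and>
     (\<forall>f. L2_loc f \<longrightarrow> (\<forall>x\<ge>0.
        (let g = (\<lambda>x. f x + volterra K f x) in g x + volterra R g x = f x) \<and>
        (let g = (\<lambda>x. f x + volterra R f x) in g x + volterra K g x = f x)))"

text \<open>The mathematical \<open>F\<close> is not defined on the diagonal, a null set; the value chosen here for
  \<open>x = t\<close> is irrelevant.\<close>

definition F_kernel ::
  "(real \<Rightarrow> real \<Rightarrow> complex^'m^'m) \<Rightarrow> real \<Rightarrow> real \<Rightarrow> complex^'m^'m" where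
  "F_kernel R x t =
     (if t < x then R x t + (LINT s:{0..t}|lborel. R x s ** mat_adj (R t s))
      else mat_adj (R t x) + (LINT s:{0..x}|lborel. R x s ** mat_adj (R t s)))"

subsection \<open>Increasing matrix functions and their integrals\<close>

definition increasing_matrix :: "(real \<Rightarrow> complex^'n^'n) \<Rightarrow> bool" where
  "increasing_matrix \<sigma> \<longleftrightarrow> (\<forall>l. mat_adj (\<sigma> l) = \<sigma> l) \<and> (\<forall>m l. m < l \<longrightarrow> pos_semidef (\<sigma> l - \<sigma> m)) \<and>
     (\<forall>l. continuous (at_right l) \<sigma>) \<and> \<sigma> 0 = 0"

definition trace_measure :: "(real \<Rightarrow> complex^'n^'n) \<Rightarrow> real measure" where
  "trace_measure \<sigma> = interval_measure (\<lambda>l. Re (trace (\<sigma> l)))"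

text \<open>\<open>d\<sigma> = \<Phi> d(tr \<sigma>)\<close> with a nonnegative matrix density \<open>\<Phi>\<close>.\<close>

definition matrix_density :: "(real \<Rightarrow> complex^'n^'n) \<Rightarrow> (real \<Rightarrow> complex^'n^'n) \<Rightarrow> bool" where
  "matrix_density \<sigma> \<Phi> \<longleftrightarrow> \<Phi> \<in> borel_measurable borel \<and> (\<forall>l. pos_semidef (\<Phi> l)) \<and>
     (\<forall>a b. a \<le> b \<longrightarrow> set_integrable (trace_measure \<sigma>) {a<..b} \<Phi> \<and>
        (LINT l:{a<..b}|trace_measure \<sigma>. \<Phi> l) = \<sigma> b - \<sigma> a)"

text \<open>The integrals \<open>\<integral> U d\<sigma> V\<^sup>*\<close> (for matrix functions) and \<open>\<integral> f\<^sup>* d\<sigma> g\<close> (for vector functions) exist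
  and have the value \<open>J\<close>. Densities of \<open>\<sigma>\<close> agree almost everywhere, so \<open>J\<close> does not depend on \<open>\<Phi>\<close>.\<close>

definition has_matrix_integral ::
  "(real \<Rightarrow> complex^'n^'n) \<Rightarrow> (real \<Rightarrow> complex^'n^'m) \<Rightarrow> (real \<Rightarrow> complex^'n^'k) \<Rightarrow> complex^'k^'m \<Rightarrow> bool" where
  "has_matrix_integral \<sigma> U V J \<longleftrightarrow> (\<exists>\<Phi>. matrix_density \<sigma> \<Phi> \<and>
     has_bochner_integral (trace_measure \<sigma>) (\<lambda>l. U l ** \<Phi> l ** mat_adj (V l)) J)"

definition has_form_integral ::
  "(real \<Rightarrow> complex^'n^'n) \<Rightarrow> (real \<Rightarrow> complex^'n) \<Rightarrow> (real \<Rightarrow> complex^'n) \<Rightarrow> complex \<Rightarrow> bool" where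
  "has_form_integral \<sigma> f g J \<longleftrightarrow> (\<exists>\<Phi>. matrix_density \<sigma> \<Phi> \<and>
     has_bochner_integral (trace_measure \<sigma>) (\<lambda>l. cinner (f l) (\<Phi> l *v g l)) J)"

text \<open>Integrals against \<open>d\<Sigma>\<close>, \<open>\<Sigma> = \<sigma> - \<sigma>\<^sub>0\<close>, are differences of convergent integrals.\<close>

definition has_matrix_integral_diff ::
  "(real \<Rightarrow> complex^'n^'n) \<Rightarrow> (real \<Rightarrow> complex^'n^'n)
    \<Rightarrow> (real \<Rightarrow> complex^'n^'m) \<Rightarrow> (real \<Rightarrow> complex^'n^'k) \<Rightarrow> complex^'k^'m \<Rightarrow> bool" where
  "has_matrix_integral_diff \<sigma> \<sigma>0 U V J \<longleftrightarrow>
     (\<exists>J1 J0. has_matrix_integral \<sigma> U V J1 \<and> has_matrix_integral \<sigma>0 U V J0 \<and> J = J1 - J0)"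

definition has_form_integral_diff ::
  "(real \<Rightarrow> complex^'n^'n) \<Rightarrow> (real \<Rightarrow> complex^'n^'n)
    \<Rightarrow> (real \<Rightarrow> complex^'n) \<Rightarrow> (real \<Rightarrow> complex^'n) \<Rightarrow> complex \<Rightarrow> bool" where
  "has_form_integral_diff \<sigma> \<sigma>0 f g J \<longleftrightarrow>
     (\<exists>J1 J0. has_form_integral \<sigma> f g J1 \<and> has_form_integral \<sigma>0 f g J0 \<and> J = J1 - J0)"

subsection \<open>Spectral functions\<close>

text \<open>\<open>L\<^sup>2\<^sub>\<sigma>\<close> is the completion of the continuous functions with compact support: a function \<open>g\<close> represents
  an element of it iff it is a limit of such functions in the seminorm given by \<open>\<integral> g\<^sup>* d\<sigma> g\<close>.\<close>

definition in_L2_sigma :: "(real \<Rightarrow> complex^'n^'n) \<Rightarrow> (real \<Rightarrow> complex^'n) \<Rightarrow> bool" where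
  "in_L2_sigma \<sigma> g \<longleftrightarrow> (\<exists>\<phi> \<epsilon>.
     (\<forall>k::nat. continuous_on UNIV (\<phi> k) \<and> (\<exists>a. \<forall>l. a < \<bar>l\<bar> \<longrightarrow> \<phi> k l = 0) \<and>
        has_form_integral \<sigma> (\<lambda>l. g l - \<phi> k l) (\<lambda>l. g l - \<phi> k l) (\<epsilon> k)) \<and>
     \<epsilon> \<longlonglongrightarrow> 0)"

text \<open>\<^const>\<open>gen_fourier\<close> is linear and the square integrable functions with compact support are dense
  in \<open>L\<^sup>2\<close>; hence it extends to an isometry into \<open>L\<^sup>2\<^sub>\<sigma>\<close> iff it preserves the norm on these functions.\<close>

definition spectral_function ::
  "(real \<Rightarrow> complex \<Rightarrow> complex^'n^'m) \<Rightarrow> (real \<Rightarrow> complex^'n^'n) \<Rightarrow> bool" where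
  "spectral_function Y \<sigma> \<longleftrightarrow> increasing_matrix \<sigma> \<and>
     (\<forall>f. L2_comp f \<longrightarrow> in_L2_sigma \<sigma> (gen_fourier Y f) \<and>
        has_form_integral \<sigma> (gen_fourier Y f) (gen_fourier Y f)
          (of_real (LINT x:{0..}|lborel. (norm (f x))\<^sup>2)))"

definition sigma0 :: "complex^'n^'n \<Rightarrow> real \<Rightarrow> complex^'n^'n" where
  "sigma0 B1 l = (l / (2 * pi)) *\<^sub>R matrix_inv B1"

text \<open>The identity \<open>\<integral> F\<^sub>0\<^sup>* d\<Sigma> G\<^sub>0 = \<integral>\<integral> f(x)\<^sup>* F(x,t) g(t) dx dt\<close>, including existence of the left-hand side.\<close>

definition kernel_identity ::
  "(real \<Rightarrow> complex \<Rightarrow> complex^'n^'m) \<Rightarrow> (real \<Rightarrow> complex^'n^'n) \<Rightarrow> (real \<Rightarrow> complex^'n^'n)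
    \<Rightarrow> (real \<Rightarrow> real \<Rightarrow> complex^'m^'m) \<Rightarrow> bool" where
  "kernel_identity E \<sigma> \<sigma>0 F \<longleftrightarrow> (\<forall>f g. L2_comp f \<longrightarrow> L2_comp g \<longrightarrow>
     has_form_integral_diff \<sigma> \<sigma>0 (gen_fourier E f) (gen_fourier E g)
       (LINT t:{0..}|lborel. (LINT x:{0..}|lborel. cinner (f x) (F x t *v g t))))"

text \<open>The integral \<open>\<integral> U(x,\<lambda>) d\<Sigma>(\<lambda>) U(t,\<lambda>)\<^sup>*\<close> exists for all \<open>x, t \<ge> 0\<close> and equals \<open>G x t\<close>.\<close>

definition kernel_integral ::
  "(real \<Rightarrow> complex \<Rightarrow> complex^'n^'m) \<Rightarrow> (real \<Rightarrow> complex^'n^'n) \<Rightarrow> (real \<Rightarrow> complex^'n^'n)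
    \<Rightarrow> (real \<Rightarrow> real \<Rightarrow> complex^'m^'m) \<Rightarrow> bool" where
  "kernel_integral U \<sigma> \<sigma>0 G \<longleftrightarrow> (\<forall>x\<ge>0. \<forall>t\<ge>0.
     has_matrix_integral_diff \<sigma> \<sigma>0 (\<lambda>l. U x (of_real l)) (\<lambda>l. U t (of_real l)) (G x t))"

text \<open>\<open>\<partial>\<^sup>2G/\<partial>x\<partial>t = F\<close>, continuous in the sense in which \<^const>\<open>F_kernel\<close> is: on either side of the diagonal
  and up to it. The one-sided limits on the diagonal may differ: \<^term>\<open>F_kernel R\<close> jumps there by
  \<^term>\<open>R x x - mat_adj (R x x)\<close>, which is nonzero in general, and its iterated integral then has no mixed
  second derivative at \<open>x = t\<close>. The first derivative, however, exists and is continuous everywhere; without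
  this requirement, \<open>G = min x t\<close> would have mixed derivative \<open>0\<close>. A \<open>G\<close> that vanishes for \<open>x = 0\<close> and
  has a mixed derivative \<open>F\<close> that exists and is continuous on the whole closed quadrant satisfies the
  definition. At the boundary of the quadrant, derivatives are one-sided.\<close>

definition continuous_mixed_derivative ::
  "(real \<Rightarrow> real \<Rightarrow> 'a::real_normed_vector) \<Rightarrow> (real \<Rightarrow> real \<Rightarrow> 'a) \<Rightarrow> bool" where
  "continuous_mixed_derivative G F \<longleftrightarrow>
     (\<exists>G'. continuous_on ({0..} \<times> {0..}) (\<lambda>(x, t). G' x t) \<and>
        (\<forall>x\<ge>0. \<forall>t\<ge>0. ((\<lambda>t. G x t) has_vector_derivative G' x t) (at t within {0..})) \<and>
        (\<forall>x\<ge>0. \<forall>t\<ge>0. x \<noteq> t \<longrightarrow>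
           ((\<lambda>x. G' x t) has_vector_derivative F x t) (at x within {0..}))) \<and>
     (\<exists>Fl. continuous_on {(x, t). 0 \<le> t \<and> t \<le> x} (\<lambda>(x, t). Fl x t) \<and>
        (\<forall>x t. 0 \<le> t \<and> t < x \<longrightarrow> F x t = Fl x t)) \<and>
     (\<exists>Fu. continuous_on {(x, t). 0 \<le> x \<and> x \<le> t} (\<lambda>(x, t). Fu x t) \<and>
        (\<forall>x t. 0 \<le> x \<and> x < t \<longrightarrow> F x t = Fu x t))"

end

theory Submission
  imports Defs "HOL-Probability.Sinc_Integral"
begin

text \<open>
  Let \<open>Et(x)\<close> be the integral of \<open>e\<^sub>0\<close> over \<open>[0, x]\<close>. Then \<open>Et(x)\<^sup>* v\<close> is the free transform of the step
  function with value \<open>v\<close> on \<open>[0, x]\<close>, so for step functions the identity \<open>(\<ast>)\<close> says that the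
  integral of \<open>Et(x) d\<sigma> Et(t)\<^sup>*\<close> exceeds that of \<open>Et(x) d\<sigma>\<^sub>0 Et(t)\<^sup>*\<close> by the double integral of \<open>F\<close> over
  \<open>[0, x] \<times> [0, t]\<close>. The integral against \<open>d\<sigma>\<^sub>0\<close> is \<open>min(x, t) I\<close>: on eigenvectors of \<open>B\<close> it reduces to the
  integral of \<open>(1 - cos(p \<lambda>)) / \<lambda>\<^sup>2\<close>. Hence the form of the transforms in \<open>L\<^sup>2\<^sub>\<sigma>\<close> is, on step functions, the
  bounded form of \<open>I + F\<close>, and \<open>(\<ast>)\<close> extends to \<open>L\<^sup>2\<close> by density and Fatou's lemma. This is part 3,
  and with \<open>F = 0\<close> it is the Plancherel theorem for \<open>\<sigma>\<^sub>0\<close>.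

  In the class \<open>(T\<^sub>B)\<close>, the free transform of \<open>f\<close> is the \<open>Q\<close>-transform of \<open>(I + R)\<^sup>* f\<close>. The isometry
  property of \<open>\<sigma>\<close> thus gives \<open>(I + R)(I + R)\<^sup>* = I + F\<close> as the form on step functions, which is part 2;
  part 1 follows by the same extension.
\<close>

subsection \<open>The complex inner product and adjoints\<close>

text \<open>In part 3, \<open>\<sigma>\<close> is known only through its positivity and the
  convergence of integrals of \<open>Et\<close>, that is, through pairs of step functions.
  Positivity is what carries a bound to limits. The bound itself holds only on a fixed
  \<open>[0, a]\<close>, where \<open>F\<close> is bounded, so each extension is made for functions
  supported in one interval. Each integral in the definitions chooses its own density, whereas
  polarization combines four integrals. Densities are therefore shown to agree almost everywhere,
  and exchanging them requires measurable integrands. \<open>solution\<close> asserts no regularity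
  of \<open>Y\<close> in \<lambda>; the \<open>Y\<close>-transforms that occur are measurable
  because they equal the adjoint of \<open>Et\<close> applied to a vector. \<open>F\<close> may jump
  across the diagonal. It is treated as two kernels, each continuous on a closed wedge. Its
  primitive in one variable is already continuous everywhere, so the passage between
  \<open>F\<close> and its double primitive goes through that function, and the diagonal enters only
  as a single exceptional point on each line.\<close>

lemma cinner_inner: "Re (cinner u v) = inner u v"
  by (simp add: cinner_def inner_vec_def inner_complex_def)

lemma cinner_add_left: "cinner (u + v) w = cinner u w + cinner v w"
  and cinner_add_right: "cinner w (u + v) = cinner w u + cinner w v"
  and cinner_scaleR_left: "cinner (r *\<^sub>R u) w = r *\<^sub>R cinner u w"
  and cinner_scaleR_right: "cinner w (r *\<^sub>R u) = r *\<^sub>R cinner w u"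
  and cinner_scale_left: "cinner (c *s u) w = cnj c * cinner u w"
  and cinner_scale_right: "cinner w (c *s u) = c * cinner w u"
  by (simp_all add: cinner_def algebra_simps sum.distrib sum_distrib_left scaleR_sum_right)

text \<open>Conjugate linearity on the left is still linearity over the reals, which gives access to
  the general rules for limits, continuity and integrals of products. Complex scalars are handled by
  \<open>cinner_scale_left\<close> and \<open>cinner_scale_right\<close>.\<close>

lemma bounded_bilinear_cinner: "bounded_bilinear (cinner :: complex^'a \<Rightarrow> _)"
  unfolding bilinear_conv_bounded_bilinear[symmetric] bilinear_def
  by (auto intro!: linearI simp: cinner_add_left cinner_add_right cinner_scaleR_left cinner_scaleR_right)

interpretation cin: bounded_bilinear "cinner :: complex^'a \<Rightarrow> _"
  by (rule bounded_bilinear_cinner)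

lemma cinner_commute: "cinner v u = cnj (cinner u v)"
  by (simp add: cinner_def mult.commute)

lemma cinner_self: "cinner u u = complex_of_real ((norm u)\<^sup>2)"
proof (rule complex_eqI)
  show "Re (cinner u u) = Re (complex_of_real ((norm u)\<^sup>2))"
    by (simp only: cinner_inner Re_complex_of_real dot_square_norm)
  have "cinner u u = cnj (cinner u u)" by (rule cinner_commute)
  then show "Im (cinner u u) = Im (complex_of_real ((norm u)\<^sup>2))"
    by (metis Im_complex_of_real Reals_cnj_iff complex_is_Real_iff)
qed

lemma scaleR_conv_vector_scale: "r *\<^sub>R (u :: complex^'a) = complex_of_real r *s u"
  unfolding vec_eq_iff by (simp add: scaleR_conv_of_real[where 'a=complex])

lemma norm_vector_scale: "norm (c *s (u :: complex^'a)) = cmod c * norm u"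
  by (simp add: norm_vec_def L2_set_def norm_mult power_mult_distrib sum_distrib_left[symmetric] real_sqrt_mult)

text \<open>Scaling \<open>u\<close> by \<open>cinner u v\<close> makes the product real and equal
  to the squared modulus, so the real Cauchy-Schwarz inequality applies.\<close>

lemma norm_cinner: "cmod (cinner u v) \<le> norm u * norm v"
proof (cases "cinner u v = 0")
  case False
  let ?c = "cinner u v"
  have "complex_of_real ((cmod ?c)\<^sup>2) = cinner (?c *s u) v"
    by (simp only: cinner_scale_left complex_norm_square mult.commute)
  then have "(cmod ?c)\<^sup>2 = inner (?c *s u) v"
    by (metis Re_complex_of_real cinner_inner)
  also have "\<dots> \<le> norm (?c *s u) * norm v" by (rule norm_cauchy_schwarz)
  finally have "cmod ?c * cmod ?c \<le> cmod ?c * (norm u * norm v)"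
    by (simp add: norm_vector_scale power2_eq_square mult.assoc)
  then show ?thesis using False by simp
qed auto

lemma cinner_ext: "(\<And>u. cinner u v = cinner u w) \<Longrightarrow> v = w"
  by (metis cin.diff_right cinner_self eq_iff_diff_eq_0 norm_eq_zero of_real_eq_0_iff power2_eq_square mult_eq_0_iff)

lemma mat_adj_mult_vec: "cinner u (A *v v) = cinner (mat_adj A *v u) v"
  unfolding cinner_def mat_adj_def matrix_vector_mult_def
  by (simp add: sum_distrib_left sum_distrib_right) (subst sum.swap, simp add: mult_ac)

lemma mat_adj_mat_adj [simp]: "mat_adj (mat_adj A) = A"
  by (simp add: mat_adj_def vec_eq_iff)

lemma cinner_mat_adj: "cinner u (mat_adj A *v v) = cinner (A *v u) v"
  by (simp add: mat_adj_mult_vec)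

lemma mat_adj_mult: "mat_adj (A ** B) = mat_adj B ** mat_adj A"
  by (simp add: mat_adj_def matrix_matrix_mult_def vec_eq_iff mult.commute)

lemma mat_adj_mat [simp]: "mat_adj (mat 1) = mat 1"
  by (auto simp: mat_adj_def mat_def vec_eq_iff)

lemma mat_adj_zero [simp]: "mat_adj 0 = 0"
  by (simp add: mat_adj_def vec_eq_iff)

lemma mat_adj_add: "mat_adj (A + B) = mat_adj A + mat_adj B"
  and mat_adj_scaleR: "mat_adj (r *\<^sub>R A) = r *\<^sub>R mat_adj A"
  by (simp_all add: mat_adj_def vec_eq_iff)

lemma bounded_linear_mat_adj: "bounded_linear (mat_adj :: complex^'a^'b \<Rightarrow> _)"
  unfolding linear_conv_bounded_linear[symmetric] by (auto intro!: linearI simp: mat_adj_add mat_adj_scaleR)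

lemma vec_eq_cinner_axis: "(v :: complex^'a) $ i = cinner (axis i 1) v"
  unfolding cinner_def axis_def by (simp add: if_distrib[of cnj] if_distrib[of "\<lambda>x. x * _"] cong: if_cong)

lemma matrix_vector_scaleR: "(A :: complex^'a^'b) *v (r *\<^sub>R v) = r *\<^sub>R (A *v v)"
  "(r *\<^sub>R A) *v v = r *\<^sub>R (A *v v)"
  by (simp_all add: matrix_vector_mult_def vec_eq_iff scaleR_sum_right)

lemma bounded_bilinear_matrix_vector: "bounded_bilinear ((*v) :: complex^'a^'b \<Rightarrow> _)"
  unfolding bilinear_conv_bounded_bilinear[symmetric] bilinear_def
  by (auto intro!: linearI simp: algebra_simps matrix_vector_scaleR)

interpretation mv: bounded_bilinear "(*v) :: complex^'a^'b \<Rightarrow> _"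
  by (rule bounded_bilinear_matrix_vector)

lemma matrix_mult_scaleR: "(A :: complex^'a^'b) ** (r *\<^sub>R B) = r *\<^sub>R (A ** B)"
  "(r *\<^sub>R A) ** B = r *\<^sub>R (A ** B)"
  by (simp_all add: matrix_matrix_mult_def vec_eq_iff scaleR_sum_right)

lemma bounded_bilinear_matrix_matrix:
  "bounded_bilinear ((**) :: complex^'a^'b \<Rightarrow> complex^'c^'a \<Rightarrow> complex^'c^'b)"
  unfolding bilinear_conv_bounded_bilinear[symmetric] bilinear_def
  by (auto intro!: linearI simp: matrix_mult_scaleR matrix_add_ldistrib) (simp add: matrix_matrix_mult_def vec_eq_iff distrib_right sum.distrib)

interpretation mm: bounded_bilinear "(**) :: complex^'a^'b \<Rightarrow> complex^'c^'a \<Rightarrow> complex^'c^'b"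
  by (rule bounded_bilinear_matrix_matrix)

text \<open>Reduces statements about entries to statements about \<open>A *v v\<close>, the form in
  which eigenvectors of \<open>B\<close> can be used.\<close>

lemma matrix_nth_cinner: "(A :: complex^'a^'b) $ i $ j = cinner (axis i 1) (A *v axis j 1)"
  unfolding vec_eq_cinner_axis[symmetric]
  by (simp add: matrix_vector_mult_def axis_def if_distrib[of "\<lambda>x. _ * x"] cong: if_cong)

subsection \<open>Eigenvectors of symmetric maps\<close>

text \<open>A maximiser \<open>v\<close> of the Rayleigh quotient is an eigenvector: otherwise the residual
  \<open>r = f v - (v \<bullet> f v) v\<close> would allow an increase along \<open>v + t r\<close>.\<close>

lemma eigenvectors_exist:
  fixes f :: "'a::euclidean_space \<Rightarrow> 'a"
  assumes "linear f" and sym: "\<And>u v. inner u (f v) = inner (f u) v"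
    and W: "subspace W" "f ` W \<subseteq> W" "w \<in> W" "w \<noteq> 0"
  obtains v \<mu> where "v \<in> W" "v \<noteq> 0" "f v = \<mu> *\<^sub>R v"
proof -
  interpret linear f by fact
  let ?S = "W \<inter> sphere 0 1"
  have "compact ?S"
    using closed_subspace[OF W(1)] by (simp add: closed_Int_compact)
  moreover have "inverse (norm w) *\<^sub>R w \<in> ?S" using W by (simp add: subspace_scale)
  moreover have "continuous_on ?S (\<lambda>v. inner v (f v))"
    by (intro continuous_on_inner continuous_on_id linear_continuous_on) (simp add: linear_conv_bounded_linear[symmetric] \<open>linear f\<close>)
  ultimately have "\<exists>v\<in>?S. \<forall>u\<in>?S. inner u (f u) \<le> inner v (f v)"
    by (intro continuous_attains_sup) blast+
  then obtain v where v: "v \<in> ?S" and max: "\<And>u. u \<in> ?S \<Longrightarrow> inner u (f u) \<le> inner v (f v)"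
    by blast
  let ?m = "inner v (f v)"
  define r where "r = f v - ?m *\<^sub>R v"
  have rW: "r \<in> W" using v W by (auto simp: r_def intro!: subspace_diff subspace_scale)
  have vv: "inner v v = 1" using v by (simp add: dot_square_norm)
  have quad: "inner u (f u) \<le> ?m * inner u u" if "u \<in> W" for u
  proof (cases "u = 0")
    case False
    have "inner (inverse (norm u) *\<^sub>R u) (f (inverse (norm u) *\<^sub>R u)) \<le> ?m"
      using that False W by (intro max) (simp add: subspace_scale)
    then have "inner u (f u) / (norm u * norm u) \<le> ?m" by (simp add: scale field_simps)
    then show ?thesis using False by (simp add: divide_le_eq dot_square_norm power2_eq_square)
  qed (simp add: zero)
  \<comment> \<open>The Rayleigh bound at \<open>v + t r\<close>: the terms of order zero cancel,
    and the linear term is twice \<open>inner r (f v) - ?m * inner r v\<close>, which is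
    \<open>inner r r\<close>.\<close>
  have key: "2 * t * inner r r \<le> t\<^sup>2 * (?m * inner r r - inner r (f r))" for t
  proof -
    have "inner (v + t *\<^sub>R r) (f (v + t *\<^sub>R r)) \<le> ?m * inner (v + t *\<^sub>R r) (v + t *\<^sub>R r)"
      using v W rW by (intro quad subspace_add subspace_scale) auto
    moreover have "inner v (f r) = inner r (f v)" using sym[of v r] by (simp add: inner_commute)
    moreover have "inner r (f v) = inner r r + ?m * inner r v" by (simp add: r_def algebra_simps)
    moreover have "inner v r = inner r v" by (rule inner_commute)
    ultimately show ?thesis using vv
      by (simp add: scale add algebra_simps power2_eq_square)
  qed
  have "inner r r = 0"
  proof (rule ccontr)
    assume "inner r r \<noteq> 0"
    then have pos: "inner r r > 0" by simp
    \<comment> \<open>With this \<open>t\<close> the quadratic remainder, at most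
      \<open>t\<^sup>2 * c\<close>, is only half of the linear term; the summand 1 keeps
      \<open>c\<close> positive.\<close>
    define c where "c = \<bar>?m * inner r r - inner r (f r)\<bar> + 1"
    define t where "t = inner r r / c"
    have c: "c > 0" by (simp add: c_def)
    have t: "t > 0" using pos c by (simp add: t_def)
    have "2 * t * inner r r \<le> t\<^sup>2 * c"
      by (rule order.trans[OF key mult_left_mono]) (auto simp: c_def)
    also have "\<dots> = t * inner r r" using c by (simp add: t_def power2_eq_square)
    finally show False using t pos by simp
  qed
  then have "f v = ?m *\<^sub>R v" by (simp add: r_def)
  then show ?thesis using v vv that[of v ?m] by (cases "v = 0") auto
qed

text \<open>By symmetry the orthogonal complement of the eigenvectors is invariant; if it were
  nonzero it would contain an eigenvector, which would be orthogonal to itself.\<close>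

lemma span_eigenvectors:
  fixes f :: "'a::euclidean_space \<Rightarrow> 'a"
  assumes "linear f" and sym: "\<And>u v. inner u (f v) = inner (f u) v"
  shows "span {v. \<exists>\<mu>. f v = \<mu> *\<^sub>R v} = UNIV"
proof (rule ccontr)
  interpret linear f by fact
  let ?S = "{v. \<exists>\<mu>. f v = \<mu> *\<^sub>R v}"
  let ?W = "{w. \<forall>v\<in>?S. inner v w = 0}"
  assume "span ?S \<noteq> UNIV"
  then obtain w where w: "w \<noteq> 0" "\<And>x. x \<in> span ?S \<Longrightarrow> orthogonal w x"
    using orthogonal_to_subspace_exists_gen[of ?S UNIV] by (auto simp: orthogonal_commute)
  have W: "subspace ?W"
    by (auto simp: subspace_def inner_right_distrib)
  have "f ` ?W \<subseteq> ?W"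
  proof clarsimp
    fix w v \<mu> assume "\<forall>v. (\<exists>\<mu>. f v = \<mu> *\<^sub>R v) \<longrightarrow> inner v w = 0" "f v = \<mu> *\<^sub>R v"
    then show "inner v (f w) = 0" by (subst sym) auto
  qed
  moreover have "w \<in> ?W"
    using w(2)[OF span_base] by (simp add: orthogonal_def inner_commute)
  ultimately obtain v \<mu> where "v \<in> ?W" "v \<noteq> 0" "f v = \<mu> *\<^sub>R v"
    using eigenvectors_exist[OF assms W _ _ w(1)] by blast
  then show False by auto
qed

subsection \<open>A scalar Fourier integral\<close>

text \<open>Integration by parts gives the antiderivative \<open>Si l - (1 - cos l) / l\<close>, so
  the half-line integral is the limit \<open>pi / 2\<close> of \<open>Si\<close>; the integrand is
  nonnegative, so the limit also yields integrability. Evenness doubles the value, and rescaling by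
  \<open>p\<close> produces the factor \<open>\<bar>p\<bar>\<close>.\<close>

lemma has_bochner_integral_one_minus_cos:
  "has_bochner_integral lborel (\<lambda>l. (1 - cos (p * l)) / l\<^sup>2) (pi * \<bar>p\<bar>)"
proof -
  let ?f = "\<lambda>l::real. (1 - cos l) / l\<^sup>2" and ?G = "\<lambda>l::real. Si l - (1 - cos l) / l"
  have D: "(?G has_real_derivative ?f x) (at x)" if "0 < x" for x
    using that by (auto intro!: derivative_eq_intros DERIV_Si simp: field_simps power2_eq_square)
  have "((\<lambda>l::real. (1 - cos l) / l) \<longlongrightarrow> 0) (at_right 0)" "((\<lambda>l::real. (1 - cos l) / l) \<longlongrightarrow> 0) at_top"
    by real_asymp+
  moreover have "(Si \<longlongrightarrow> Si 0) (at_right 0)"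
    using isCont_Si[of 0] by (simp add: continuous_at_imp_continuous_at_within continuous_within[symmetric])
  moreover have "Si 0 = 0" by (simp add: Si_def zero_ereal_def[symmetric])
  ultimately have lim: "(?G \<longlongrightarrow> 0) (at_right 0)" "(?G \<longlongrightarrow> pi / 2) at_top"
    using tendsto_diff[of Si "Si 0" "at_right 0" "\<lambda>l. (1 - cos l) / l" 0]
      tendsto_diff[of Si "pi/2" at_top "\<lambda>l. (1 - cos l) / l" 0] Si_at_top by auto
  have lim': "((?G \<circ> real_of_ereal) \<longlongrightarrow> 0) (at_right 0)" "((?G \<circ> real_of_ereal) \<longlongrightarrow> pi / 2) (at_left \<infinity>)"
    unfolding zero_ereal_def ereal_tendsto_simps by (rule lim)+
  have c: "isCont ?f x" if "0 < x" for x using that by (auto intro!: continuous_intros)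
  have n: "AE x in lborel. (0::ereal) < ereal x \<longrightarrow> ereal x < \<infinity> \<longrightarrow> 0 \<le> ?f x" by simp
  have FTC: "set_integrable lborel (einterval 0 \<infinity>) ?f" "(LBINT x=0..\<infinity>. ?f x) = pi / 2 - 0"
    by (rule interval_integral_FTC_nonneg[where F = ?G, OF _ _ _ n lim'], simp, (rule D, simp), (rule c, simp))+
  then have "has_bochner_integral lborel (\<lambda>x. indicator {0<..} x *\<^sub>R ?f x) (pi / 2)"
    by (simp add: has_bochner_integral_iff set_integrable_def zero_ereal_def interval_integral_to_infinity_eq set_lebesgue_integral_def)
  moreover have "(\<lambda>x. indicator {0<..} x *\<^sub>R ?f x) = (\<lambda>x. indicator {0..} x *\<^sub>R ?f x)"
    by (auto split: split_indicator)
  ultimately have "has_bochner_integral lborel (\<lambda>x. indicator {0..} x *\<^sub>R ?f x) (pi / 2)" by metis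
  then have "has_bochner_integral lborel ?f (2 *\<^sub>R (pi / 2))"
    by (rule has_bochner_integral_even_function) simp
  then have 1: "has_bochner_integral lborel ?f pi" by simp
  show ?thesis
  proof (cases "p = 0")
    case False
    have "has_bochner_integral lborel (\<lambda>x. ?f (0 + p * x)) (pi /\<^sub>R \<bar>p\<bar>)"
      by (rule lborel_has_bochner_integral_real_affine_iff[OF False, THEN iffD1, OF 1])
    then have "has_bochner_integral lborel (\<lambda>x. p\<^sup>2 * ?f (0 + p * x)) (p\<^sup>2 * (pi /\<^sub>R \<bar>p\<bar>))"
      by (rule has_bochner_integral_mult_right)
    moreover have "p\<^sup>2 * (pi /\<^sub>R \<bar>p\<bar>) = pi * \<bar>p\<bar>"
      using False by (simp add: field_simps power2_eq_square abs_mult_self_eq)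
    moreover have "(\<lambda>x. p\<^sup>2 * ?f (0 + p * x)) = (\<lambda>l. (1 - cos (p * l)) / l\<^sup>2)"
      using False by (auto simp: power_mult_distrib)
    ultimately show ?thesis by metis
  qed (auto intro: has_bochner_integral_zero)
qed

lemma norm_cis_minus_one: "(cmod (cis a - 1))\<^sup>2 = 2 * (1 - cos a)"
  unfolding cmod_power2 using sin_cos_squared_add[of a] by (simp add: power2_eq_square algebra_simps)

text \<open>The real part is a combination of three integrals of the preceding kind, with
  frequencies \<open>p\<close>, \<open>q\<close> and \<open>p - q\<close>; the imaginary part is
  odd. The value is \<open>2 * pi\<close> times the smaller modulus if \<open>p\<close> and
  \<open>q\<close> have the same sign, and 0 if the signs are opposite: this is the origin of
  \<open>min x t\<close>.\<close>

lemma has_bochner_integral_cis_product: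
  "has_bochner_integral lborel (\<lambda>l. (cis (p * l) - 1) * cnj (cis (q * l) - 1) / complex_of_real (l\<^sup>2))
     (complex_of_real (pi * (\<bar>p\<bar> + \<bar>q\<bar> - \<bar>p - q\<bar>)))"
proof -
  let ?c = "\<lambda>p l::real. (1 - cos (p * l)) / l\<^sup>2"
  let ?h = "\<lambda>l. (cis (p * l) - 1) * cnj (cis (q * l) - 1) / complex_of_real (l\<^sup>2)"
  have h_meas: "?h \<in> borel_measurable lborel"
    unfolding measurable_lborel2
    by (intro borel_measurable_divide borel_measurable_continuous_onI) (auto simp: cis_conv_exp intro!: continuous_intros)
  have int: "integrable lborel ?h"
  proof (rule Bochner_Integration.integrable_bound[OF _ h_meas])
    show "integrable lborel (\<lambda>l. ?c p l + ?c q l)"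
      using has_bochner_integral_one_minus_cos by (intro Bochner_Integration.integrable_add) (auto simp: has_bochner_integral_iff)
    show "AE l in lborel. norm (?h l) \<le> norm (?c p l + ?c q l)"
    proof (rule AE_I2)
      fix l :: real
      let ?a = "cmod (cis (p * l) - 1)" and ?b = "cmod (cis (q * l) - 1)"
      have "0 \<le> (?a - ?b)\<^sup>2" by simp
      then have "?a * ?b \<le> (?a\<^sup>2 + ?b\<^sup>2) / 2" by (simp add: power2_eq_square algebra_simps)
      also have "\<dots> = (1 - cos (p * l)) + (1 - cos (q * l))" by (simp add: norm_cis_minus_one)
      finally have "?a * ?b / l\<^sup>2 \<le> ((1 - cos (p * l)) + (1 - cos (q * l))) / l\<^sup>2"
        by (intro divide_right_mono) auto
      moreover have "norm (?h l) = ?a * ?b / l\<^sup>2" by (simp only: norm_mult norm_divide complex_mod_cnj norm_of_real abs_power2)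
      moreover have "?c p l + ?c q l \<le> norm (?c p l + ?c q l)" by simp
      ultimately show "norm (?h l) \<le> norm (?c p l + ?c q l)" unfolding add_divide_distrib by linarith
    qed
  qed
  have Re: "Re (?h l) = ?c p l + ?c q l - ?c (p - q) l" for l
    unfolding Re_divide_of_real by (simp add: cos_diff left_diff_distrib diff_divide_distrib add_divide_distrib algebra_simps)
  have "has_bochner_integral lborel (\<lambda>l. ?c p l + ?c q l - ?c (p - q) l) (pi * \<bar>p\<bar> + pi * \<bar>q\<bar> - pi * \<bar>p - q\<bar>)"
    by (intro has_bochner_integral_add has_bochner_integral_diff has_bochner_integral_one_minus_cos)
  then have intRe: "integral\<^sup>L lborel (\<lambda>l. Re (?h l)) = pi * (\<bar>p\<bar> + \<bar>q\<bar> - \<bar>p - q\<bar>)"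
    unfolding Re by (simp add: has_bochner_integral_iff algebra_simps)
  have "integrable lborel (\<lambda>l. Im (?h l))" using int by (rule integrable_Im)
  then have "integrable lborel (\<lambda>x. indicator {0..} x *\<^sub>R Im (?h x))"
    by (intro integrable_mult_indicator) auto
  then have "has_bochner_integral lborel (\<lambda>l. Im (?h l)) 0"
    unfolding Im_divide_of_real
    by (intro has_bochner_integral_odd_function[OF has_bochner_integral_integrable])
      (simp_all add: algebra_simps diff_divide_distrib add_divide_distrib)
  then have intIm: "integral\<^sup>L lborel (\<lambda>l. Im (?h l)) = 0" by (simp add: has_bochner_integral_iff)
  have "integral\<^sup>L lborel ?h = complex_of_real (pi * (\<bar>p\<bar> + \<bar>q\<bar> - \<bar>p - q\<bar>))"
    using integral_Re[OF int] integral_Im[OF int] intRe intIm by (simp add: complex_eq_iff)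
  then show ?thesis using int by (simp add: has_bochner_integral_iff)
qed

lemma integral_cis:
  assumes "0 \<le> x" "m \<noteq> 0"
  shows "(LINT s:{0..x}|lborel. cis (s * m)) = (cis (x * m) - 1) / (\<i> * m)"
proof -
  have "((\<lambda>s. cis (s * m) / (\<i> * m)) has_vector_derivative cis (s * m)) (at s within {0..x})" for s
    using \<open>m \<noteq> 0\<close> unfolding cis_conv_exp
    by (auto intro!: derivative_eq_intros has_vector_derivative_real_field simp: field_simps)
  then have "(LINT s:{0..x}|lborel. cis (s * m)) = cis (x * m) / (\<i> * m) - cis (0 * m) / (\<i> * m)"
    unfolding set_lebesgue_integral_def using assms
    by (intro integral_FTC_atLeastAtMost) (auto simp: cis_conv_exp intro!: continuous_intros)
  then show ?thesis by (simp add: diff_divide_distrib)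
qed

subsection \<open>The boundary data and the eigenvectors of \<open>B\<close>\<close>

lemma norm_vec_le_sum: "norm x \<le> (\<Sum>i\<in>UNIV. norm (x $ i))" for x :: "'b::real_normed_vector^'k"
  by (simp add: norm_vec_def L2_set_le_sum)

lemma norm_matrix_le_entries:
  fixes A :: "'a::real_normed_vector^'n^'m"
  shows "norm A \<le> (\<Sum>i\<in>UNIV. \<Sum>j\<in>UNIV. norm (A $ i $ j))"
  by (rule order.trans[OF norm_vec_le_sum]) (auto intro: sum_mono norm_vec_le_sum)

lemma continuous_on_matrixI:
  fixes A :: "'x::topological_space \<Rightarrow> complex^'n^'m"
  assumes "\<And>v. continuous_on S (\<lambda>x. A x *v v)"
  shows "continuous_on S A"
proof -
  have "continuous_on S (\<lambda>x. \<chi> i j. A x $ i $ j)"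
    unfolding matrix_nth_cinner
    by (intro continuous_on_vec_lambda cin.continuous_on continuous_on_const assms)
  then show ?thesis by (simp add: vec_lambda_eta)
qed

section \<open>Upper and lower blocks of vectors of size 2n\<close>

definition upper :: "complex^('n + 'n) \<Rightarrow> complex^'n" where "upper v = (\<chi> a. v $ Inl a)"
definition lower :: "complex^('n + 'n) \<Rightarrow> complex^'n" where "lower v = (\<chi> a. v $ Inr a)"

lemma sum_sum_type: "(\<Sum>i\<in>UNIV. f i) = (\<Sum>a\<in>UNIV. f (Inl a)) + (\<Sum>a\<in>UNIV. f (Inr (a::'n::finite)))"
  for f :: "'n::finite + 'n \<Rightarrow> 'b::comm_monoid_add"
  by (simp add: UNIV_Plus_UNIV[symmetric] sum.Plus del: UNIV_Plus_UNIV)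

lemma block_eqI: "upper u = upper v \<Longrightarrow> lower u = lower v \<Longrightarrow> u = v"
  unfolding vec_eq_iff upper_def lower_def by (metis sumE vec_lambda_beta)

lemma cinner_block: "cinner u v = cinner (upper u) (upper v) + cinner (lower u) (lower v)"
  by (simp add: cinner_def upper_def lower_def sum_sum_type)

lemma upper_B_mat: "upper (B_mat B1 B2 *v v) = B1 *v upper v"
  and lower_B_mat: "lower (B_mat B1 B2 *v v) = - (B2 *v lower v)"
  and upper_stack: "upper (stack A C *v w) = A *v w"
  and lower_stack: "lower (stack A C *v w) = C *v w"
  by (simp_all add: B_mat_def block_diag_def stack_def upper_def lower_def matrix_vector_mult_def
      sum_sum_type vec_eq_iff sum_negf)

lemma upper_lower_linear:
  "upper (u + v) = upper u + upper v" "lower (u + v) = lower u + lower v"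
  "upper (r *\<^sub>R v) = r *\<^sub>R upper v" "lower (r *\<^sub>R v) = r *\<^sub>R lower v"
  "upper 0 = 0" "lower 0 = 0"
  by (simp_all add: upper_def lower_def vec_eq_iff)

lemma stack_adj: "mat_adj (stack (mat 1) H) *v u = upper u + mat_adj H *v lower u"
  by (rule cinner_ext) (simp add: cinner_mat_adj cinner_block upper_stack lower_stack cin.add_right)

lemma matrix_inv_mult:
  fixes A :: "complex^'n^'n"
  assumes "\<And>v. A *v v = 0 \<Longrightarrow> v = 0"
  shows "matrix_inv A ** A = mat 1" "A ** matrix_inv A = mat 1"
proof -
  have "invertible A"
    unfolding invertible_left_inverse matrix_left_invertible_ker using assms by blast
  then have "A ** matrix_inv A = mat 1 \<and> matrix_inv A ** A = mat 1"
    unfolding invertible_def matrix_inv_def by (rule someI_ex)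
  then show "matrix_inv A ** A = mat 1" "A ** matrix_inv A = mat 1" by auto
qed

lemma mat_scale_mult_vec: "mat_scale c A *v v = c *s (A *v v)"
  by (simp add: mat_scale_def matrix_vector_mult_def vec_eq_iff sum_distrib_left mult.assoc)

lemma matrix_vector_scale: "(A :: complex^'a^'b) *v (c *s v) = c *s (A *v v)"
  by (simp add: matrix_vector_mult_def vec_eq_iff sum_distrib_left mult_ac)

lemma mat_pow_eigenvector:
  assumes "A *v v = c *s v" shows "mat_pow A k *v v = c ^ k *s v"
  by (induction k) (simp_all add: matrix_vector_mul_assoc[symmetric] matrix_vector_scale assms mult.commute)

lemma real_span_induct:
  fixes v :: "'a::real_vector"
  assumes "span S = UNIV" "\<And>v. v \<in> S \<Longrightarrow> P v" "P 0" "\<And>u v. P u \<Longrightarrow> P v \<Longrightarrow> P (u + v)" "\<And>r v. P v \<Longrightarrow> P (r *\<^sub>R v)"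
  shows "P v"
proof -
  have "v \<in> span S" using assms(1) by simp
  then show ?thesis by (rule span_induct) (use assms in \<open>auto simp: subspace_def\<close>)
qed

lemma scaleR_flip: "v = c *\<^sub>R w \<Longrightarrow> c \<noteq> 0 \<Longrightarrow> w = (1 / c) *\<^sub>R v" for v :: "'a::real_vector"
  by simp

section \<open>Eigenvectors of B and the boundary matrix\<close>

locale boundary_data =
  fixes B1 B2 H :: "complex^'n^'n"
  assumes B1: "pos_def B1" and B2: "pos_def B2" and HB: "B1 = mat_adj H ** B2 ** H"
begin

abbreviation "B \<equiv> B_mat B1 B2"
abbreviation "A \<equiv> matrix_inv B"
abbreviation "B1i \<equiv> matrix_inv B1"
abbreviation "St \<equiv> stack (mat 1) H"

definition eigen :: "real \<Rightarrow> complex^('n + 'n) \<Rightarrow> bool" where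
  "eigen b v \<longleftrightarrow> B *v v = b *\<^sub>R v \<and> v \<noteq> 0"

lemma pos_def_ker: "pos_def C \<Longrightarrow> C *v v = 0 \<Longrightarrow> v = 0"
  unfolding pos_def_def by (metis cin.zero_right order_less_irrefl zero_complex.simps(1))

lemma B_ker: "B *v v = 0 \<Longrightarrow> v = 0"
  using pos_def_ker[OF B1, of "upper v"] pos_def_ker[OF B2, of "lower v"]
  by (metis block_eqI upper_B_mat lower_B_mat upper_lower_linear(5,6) neg_equal_0_iff_equal)

text \<open>\<open>B1\<close> is injective and factors through \<open>H\<close>. As \<open>H\<close>
  is square, it is then also onto, which is needed to describe eigenvectors in the lower
  block.\<close>

lemma H_ker: "H *v v = 0 \<Longrightarrow> v = 0"
  using pos_def_ker[OF B1, of v] by (simp add: HB matrix_vector_mul_assoc[symmetric])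

lemmas A_inv = matrix_inv_mult[of B, OF B_ker] and B1_inv = matrix_inv_mult[of B1, OF pos_def_ker[OF B1]]

lemma H_surj: obtains w where "u = H *v w"
  by (metis matrix_inv_mult(2)[of H, OF H_ker] matrix_vector_mul_assoc matrix_vector_mul_lid)

lemma B_sym: "cinner u (B *v v) = cinner (B *v u) v"
  using B1 B2 by (simp add: pos_def_def cinner_block upper_B_mat lower_B_mat mat_adj_mult_vec cin.minus_left cin.minus_right)

lemma eigen_ne: "eigen b v \<Longrightarrow> b \<noteq> 0"
  using B_ker by (auto simp: eigen_def)

lemma eigen_A: "eigen b v \<Longrightarrow> A *v v = complex_of_real (1 / b) *s v"
proof -
  assume e: "eigen b v"
  have "b *\<^sub>R (A *v v) = A *v (B *v v)" using e by (simp add: eigen_def matrix_vector_scaleR)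
  also have "\<dots> = v" by (simp add: matrix_vector_mul_assoc A_inv)
  finally have "(1 / b) *\<^sub>R (b *\<^sub>R (A *v v)) = (1 / b) *\<^sub>R v" by simp
  then show ?thesis using eigen_ne[OF e] by (simp add: scaleR_conv_vector_scale)
qed

text \<open>Complex vectors are regarded as a real Euclidean space, in which \<open>B\<close> is symmetric. Hence the
  eigenvalues are real, and additive, real homogeneous statements need only be checked on eigenvectors.\<close>

lemma eigen_span: "span {v. \<exists>b. eigen b v} = UNIV"
proof -
  have "span {v. \<exists>\<mu>. B *v v = \<mu> *\<^sub>R v} = UNIV"
  proof (rule span_eigenvectors)
    show "linear ((*v) B)" by (rule linearI) (simp_all add: matrix_vector_scaleR matrix_vector_right_distrib)
    show "inner u (B *v v) = inner (B *v u) v" for u v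
      unfolding cinner_inner[symmetric] B_sym ..
  qed
  moreover have "{v. \<exists>\<mu>. B *v v = \<mu> *\<^sub>R v} \<subseteq> insert 0 {v. \<exists>b. eigen b v}"
    by (auto simp: eigen_def)
  ultimately have "span (insert 0 {v. \<exists>b. eigen b v}) = UNIV"
    using span_mono[of "{v. \<exists>\<mu>. B *v v = \<mu> *\<^sub>R v}" "insert 0 {v. \<exists>b. eigen b v}"] by auto
  then show ?thesis by simp
qed

lemma eigen_induct:
  assumes "\<And>b v. eigen b v \<Longrightarrow> P v" "P 0" "\<And>u v. P u \<Longrightarrow> P v \<Longrightarrow> P (u + v)" "\<And>r v. P v \<Longrightarrow> P (r *\<^sub>R v)"
  shows "P v"
  by (rule real_span_induct[OF eigen_span]) (use assms in auto)

lemma eigen_orthogonal: "eigen b u \<Longrightarrow> eigen c v \<Longrightarrow> b \<noteq> c \<Longrightarrow> cinner u v = 0"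
  using B_sym[of u v] by (simp add: eigen_def cin.scaleR_left cin.scaleR_right)

text \<open>On the lower block \<open>B\<close> is the negative definite \<open>- B2\<close>. With
  \<open>eigen_upper\<close>, the sign of the eigenvalue decides in which block the eigenvector
  lives.\<close>

lemma eigen_lower: assumes "eigen b v" "b > 0" shows "lower v = 0"
proof (rule ccontr)
  assume "lower v \<noteq> 0"
  then have "0 < Re (cinner (lower v) (B2 *v lower v))" using B2 by (simp add: pos_def_def)
  moreover have "B2 *v lower v = - (b *\<^sub>R lower v)"
    using lower_B_mat[of B1 B2 v] assms(1) by (simp add: eigen_def upper_lower_linear minus_equation_iff)
  ultimately show False using assms(2) by (simp add: cin.minus_right cin.scaleR_right cinner_self mult_less_0_iff)
qed

lemma eigen_upper: assumes "eigen b v" "b < 0" shows "upper v = 0"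
proof (rule ccontr)
  assume "upper v \<noteq> 0"
  then have "0 < Re (cinner (upper v) (B1 *v upper v))" using B1 by (simp add: pos_def_def)
  moreover have "B1 *v upper v = b *\<^sub>R upper v"
    using upper_B_mat[of B1 B2 v] assms(1) by (simp add: eigen_def upper_lower_linear)
  ultimately show False using assms(2) by (simp add: cin.scaleR_right cinner_self zero_less_mult_iff)
qed

text \<open>For positive eigenvalues only the upper blocks are seen, and \<open>B1i\<close> acts on
  them as \<open>1 / c\<close>. For negative ones write \<open>lower v = H *v w\<close>: the
  relation between \<open>B1\<close>, \<open>B2\<close> and \<open>H\<close> turns the eigenvalue
  equation of \<open>B2\<close> into one saying that \<open>B1i\<close> maps
  \<open>mat_adj H *v lower v\<close> to \<open>w\<close> divided by \<open>\<bar>c\<bar>\<close>,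
  and moving \<open>H\<close> across the inner product restores \<open>lower v\<close>.\<close>

lemma form_eigen:
  assumes u: "eigen b u" and v: "eigen c v" and "b * c > 0"
  shows "cinner (mat_adj St *v u) (B1i *v (mat_adj St *v v)) = cinner u v / complex_of_real \<bar>c\<bar>"
proof (cases "c > 0")
  case True
  then have "b > 0" using \<open>b * c > 0\<close> by (simp add: zero_less_mult_iff)
  then have l: "lower u = 0" "lower v = 0" using True eigen_lower u v by auto
  have "B1 *v upper v = c *\<^sub>R upper v"
    using upper_B_mat[of B1 B2 v] v by (simp add: eigen_def upper_lower_linear)
  then have "B1i *v (B1 *v upper v) = c *\<^sub>R (B1i *v upper v)" by (simp add: matrix_vector_scaleR)
  then have "upper v = c *\<^sub>R (B1i *v upper v)" by (simp add: matrix_vector_mul_assoc B1_inv)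
  then have "B1i *v upper v = (1 / c) *\<^sub>R upper v" using True by (intro scaleR_flip) auto
  then show ?thesis using True l
    by (simp add: stack_adj cinner_block cin.scaleR_right scaleR_conv_of_real[where 'a=complex] cin.zero_left)
next
  case False
  then have c: "c < 0" "b < 0" using \<open>b * c > 0\<close> by (auto simp: zero_less_mult_iff)
  then have l: "upper u = 0" "upper v = 0" using eigen_upper u v by auto
  have e: "B2 *v lower v = - (c *\<^sub>R lower v)"
    using lower_B_mat[of B1 B2 v] v by (simp add: eigen_def upper_lower_linear minus_equation_iff)
  obtain w where w: "lower v = H *v w" by (rule H_surj)
  have "B1 *v w = mat_adj H *v (B2 *v lower v)" by (simp add: HB w matrix_vector_mul_assoc matrix_mul_assoc)
  also have "\<dots> = (- c) *\<^sub>R (mat_adj H *v lower v)" by (simp add: e mv.minus_right matrix_vector_scaleR)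
  finally have "B1i *v (B1 *v w) = (- c) *\<^sub>R (B1i *v (mat_adj H *v lower v))" by (simp add: matrix_vector_scaleR mv.minus_right)
  then have "w = (- c) *\<^sub>R (B1i *v (mat_adj H *v lower v))" by (simp add: matrix_vector_mul_assoc B1_inv)
  then have "B1i *v (mat_adj H *v lower v) = (1 / (- c)) *\<^sub>R w"
    using c by (intro scaleR_flip) auto
  then show ?thesis using c l
    by (simp add: stack_adj cinner_block cin.scaleR_right scaleR_conv_of_real[where 'a=complex] cin.zero_left cin.minus_right w
        flip: mat_adj_mult_vec)
qed

end

subsection \<open>The free solution\<close>

lemma summable_matrixI:
  fixes f :: "nat \<Rightarrow> complex^'n^'m"
  assumes "\<And>v. summable (\<lambda>k. f k *v v)"
  shows "summable f"
proof -
  have "(\<lambda>k. f k $ i $ j) sums (\<Sum>k. f k $ i $ j)" for i j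
    unfolding matrix_nth_cinner
    by (intro summable_sums bounded_linear.summable[OF cin.bounded_linear_right] assms)
  then have "f sums (\<chi> i j. \<Sum>k. f k $ i $ j)"
    unfolding sums_def by (auto intro!: vec_tendstoI simp: sum_component)
  then show ?thesis by (rule sums_summable)
qed

lemma bounded_linear_vector_scale: "bounded_linear (\<lambda>z. z *s (v :: complex^'a))"
  unfolding linear_conv_bounded_linear[symmetric]
  by (auto intro!: linearI simp: vec_eq_iff algebra_simps)

lemma measurable_matrix_vector [measurable (raw)]:
  fixes f :: "'x \<Rightarrow> complex^'a^'b"
  assumes "f \<in> borel_measurable M" "g \<in> borel_measurable M"
  shows "(\<lambda>x. f x *v g x) \<in> borel_measurable M"
  by (rule borel_measurable_continuous_Pair[OF assms]) (intro mv.continuous_on continuous_intros)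

lemma measurable_matrix_matrix [measurable (raw)]:
  fixes f :: "'x \<Rightarrow> complex^'a^'b" and g :: "'x \<Rightarrow> complex^'c^'a"
  assumes "f \<in> borel_measurable M" "g \<in> borel_measurable M"
  shows "(\<lambda>x. f x ** g x) \<in> borel_measurable M"
  by (rule borel_measurable_continuous_Pair[OF assms]) (intro mm.continuous_on continuous_intros)

lemma measurable_cinner [measurable (raw)]:
  assumes "f \<in> borel_measurable M" "g \<in> borel_measurable M"
  shows "(\<lambda>x. cinner (f x) (g x)) \<in> borel_measurable M"
  by (rule borel_measurable_continuous_Pair[OF assms]) (intro cin.continuous_on continuous_intros)

lemma measurable_mat_adj [measurable (raw)]:
  assumes "f \<in> borel_measurable M"
  shows "(\<lambda>x. mat_adj (f x)) \<in> borel_measurable M"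
  using assms by (rule borel_measurable_continuous_on[OF linear_continuous_on[OF bounded_linear_mat_adj]])

context boundary_data
begin

abbreviation "X c \<equiv> mat_exp (mat_scale c A)"

lemma mat_exp_terms_eigen:
  assumes "eigen b v"
  shows "(\<lambda>k. ((1 / fact k) *\<^sub>R mat_pow (mat_scale c A) k) *v v) sums (exp (c / b) *s v)"
proof -
  have "((1 / fact k) *\<^sub>R mat_pow (mat_scale c A) k) *v v = ((c / b) ^ k /\<^sub>R fact k) *s v" for k
    using mat_pow_eigenvector[of "mat_scale c A" v "c / b" k] eigen_A[OF assms]
    by (simp add: matrix_vector_scaleR mat_scale_mult_vec vector_smult_assoc scaleR_conv_vector_scale divide_inverse scaleR_conv_of_real[where 'a=complex])
  moreover have "(\<lambda>k. ((c / b) ^ k /\<^sub>R fact k) *s v) sums (exp (c / b) *s v)"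
    by (rule bounded_linear.sums[OF bounded_linear_vector_scale exp_converges])
  ultimately show ?thesis by simp
qed

text \<open>Convergence is checked vector by vector: on an eigenvector the series is the scalar
  exponential series, and eigenvectors span.\<close>

lemma X_sums: "(\<lambda>k. (1 / fact k) *\<^sub>R mat_pow (mat_scale c A) k) sums X c"
proof -
  have "summable (\<lambda>k. ((1 / fact k) *\<^sub>R mat_pow (mat_scale c A) k) *v v)" for v
  proof (induction v rule: eigen_induct)
    case (1 b v) then show ?case by (rule sums_summable[OF mat_exp_terms_eigen])
  next
    case (3 u v) then show ?case by (simp only: mv.add_right summable_add)
  next
    case (4 r v) then show ?case by (simp only: matrix_vector_scaleR(1) summable_scaleR_right)
  qed (simp add: mv.zero_right)
  then show ?thesis unfolding mat_exp_def by (intro summable_sums summable_matrixI)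
qed

lemma X_eigen: "eigen b v \<Longrightarrow> X c *v v = exp (c / b) *s v"
  by (rule sums_unique2[OF bounded_linear.sums[OF mv.bounded_linear_left X_sums] mat_exp_terms_eigen])

lemma continuous_on_X: "continuous_on UNIV X"
proof (rule continuous_on_matrixI)
  show "continuous_on UNIV (\<lambda>c. X c *v v)" for v
  proof (induction v rule: eigen_induct)
    case (1 b v) then show ?case by (auto simp: X_eigen vector_scalar_mult_def dest: eigen_ne intro!: continuous_intros)
  qed (auto simp: mv.add_right matrix_vector_scaleR intro!: continuous_intros)
qed

text \<open>The eigenvalues are real, so the exponentials that occur have modulus 1. The induction
  gives a bound depending on the vector; taking it at the unit vectors bounds all entries uniformly
  in \<open>r\<close>.\<close>

lemma X_bounded: "\<exists>C. \<forall>r::real. norm (X (\<i> * of_real r)) \<le> C"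
proof -
  have "\<exists>C. \<forall>r::real. norm (X (\<i> * of_real r) *v v) \<le> C" for v
  proof (induction v rule: eigen_induct)
    case (1 b v)
    have "norm (exp (\<i> * of_real r / of_real b) *s v) \<le> norm v" for r
      by (simp add: norm_vector_scale norm_exp_eq_Re)
    then show ?case using 1 by (auto simp: X_eigen)
  next
    case (3 u v)
    then obtain C D where "\<And>r. norm (X (\<i> * of_real r) *v u) \<le> C" "\<And>r. norm (X (\<i> * of_real r) *v v) \<le> D" by blast
    then have "norm (X (\<i> * of_real r) *v (u + v)) \<le> C + D" for r
      by (auto simp: mv.add_right intro: norm_triangle_mono)
    then show ?case by blast
  next
    case (4 r v)
    then obtain C where "\<And>r. norm (X (\<i> * of_real r) *v v) \<le> C" by blast
    then have "norm (X (\<i> * of_real s) *v (r *\<^sub>R v)) \<le> \<bar>r\<bar> * C" for s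
      by (auto simp: matrix_vector_scaleR intro: mult_left_mono)
    then show ?case by blast
  qed (auto intro: exI[of _ 0])
  then obtain C where C: "\<And>v r. norm (X (\<i> * of_real r) *v v) \<le> C v" by metis
  have "norm (X (\<i> * of_real r)) \<le> (\<Sum>i\<in>(UNIV :: ('n + 'n) set). \<Sum>j\<in>UNIV. C (axis j 1))" for r
  proof (rule order.trans[OF norm_matrix_le_entries], intro sum_mono)
    fix i j
    have "X (\<i> * of_real r) $ i $ j = (X (\<i> * of_real r) *v axis j 1) $ i"
      by (rule trans[OF matrix_nth_cinner vec_eq_cinner_axis[symmetric]])
    also have "norm \<dots> \<le> norm (X (\<i> * of_real r) *v axis j 1)"
      by (rule Finite_Cartesian_Product.norm_nth_le)
    finally show "norm (X (\<i> * of_real r) $ i $ j) \<le> C (axis j 1)" using C order.trans by blast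
  qed
  then show ?thesis by blast
qed

section \<open>The free solution on the real axis and its primitive\<close>

abbreviation "E \<equiv> e0 B1 B2 H"
abbreviation "Et \<equiv> e0_tilde B1 B2 H"

lemma E_eq: "E x l = X (\<i> * l * of_real x) ** St" by (simp add: e0_def)

lemma continuous_on_E [continuous_intros]:
  assumes "continuous_on S f" "continuous_on S g"
  shows "continuous_on S (\<lambda>z. E (f z) (g z))"
  unfolding E_eq
  by (intro mm.continuous_on continuous_on_const continuous_on_compose2[OF continuous_on_X]) (auto intro!: continuous_intros assms)

lemma E_bounded: "\<exists>C. \<forall>x l::real. norm (E x (of_real l)) \<le> C"
proof -
  obtain C where C: "\<And>r. norm (X (\<i> * of_real r)) \<le> C" using X_bounded by blast
  obtain K where K: "\<And>a b. norm ((a :: complex^('n + 'n)^('n + 'n)) ** (b :: complex^'n^('n + 'n))) \<le> norm a * norm b * K" "0 \<le> K"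
    using mm.nonneg_bounded by blast
  have "norm (E x (of_real l)) \<le> C * norm St * K" for x l
  proof -
    have "norm (E x (of_real l)) \<le> norm (X (\<i> * of_real (l * x))) * norm St * K"
      unfolding E_eq using K(1)[of "X (\<i> * of_real (l * x))" St] by (simp add: mult.assoc)
    also have "\<dots> \<le> C * norm St * K" using K by (intro mult_right_mono C) auto
    finally show ?thesis .
  qed
  then show ?thesis by blast
qed

lemma E_meas [measurable]: "(\<lambda>x. E x l) \<in> borel_measurable borel" "(\<lambda>l. E x (of_real l)) \<in> borel_measurable borel"
  "(\<lambda>z. E (fst z) (complex_of_real (snd z))) \<in> borel_measurable borel"
  by (auto intro!: borel_measurable_continuous_onI continuous_intros)

lemma Et_meas [measurable]: "(\<lambda>l. Et x (of_real l)) \<in> borel_measurable borel"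
proof -
  have "(\<lambda>(l, t). indicator {0..x} t *\<^sub>R E t (of_real l)) \<in> borel_measurable (borel \<Otimes>\<^sub>M lborel)"
    unfolding split_beta' by (intro borel_measurable_scaleR measurable_compose[OF _ E_meas(3), of "\<lambda>z. (snd z, fst z)", simplified]) measurable
  then show ?thesis
    unfolding e0_tilde_def set_lebesgue_integral_def by (rule lborel.borel_measurable_lebesgue_integral)
qed

lemma E_integrable: "set_integrable lborel {0..x} (\<lambda>t. E t l)"
  by (auto intro!: borel_integrable_atLeastAtMost' continuous_intros)

lemma bounded_linear_adj_mult_vec: "bounded_linear (\<lambda>C :: complex^'a^'b. mat_adj C *v u)"
  by (rule bounded_linear_compose[OF mv.bounded_linear_left bounded_linear_mat_adj])

lemma Et_adj: "mat_adj (Et x l) *v u = (LINT t:{0..x}|lborel. mat_adj (E t l) *v u)"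
  unfolding e0_tilde_def set_lebesgue_integral_def
  using integral_bounded_linear[OF bounded_linear_adj_mult_vec[of u] E_integrable[unfolded set_integrable_def], of x l]
  by (simp add: mat_adj_scaleR matrix_vector_scaleR)

text \<open>Tested against an eigenvector: one with another eigenvalue is orthogonal to
  \<open>u\<close>, and one with the same eigenvalue gives the same exponential factor.\<close>

lemma X_adj_eigen:
  assumes "eigen b u" shows "mat_adj (X c) *v u = cnj (exp (c / b)) *s u"
proof (rule cinner_ext)
  fix w
  have "cinner u (X c *v w) = exp (c / b) * cinner u w"
  proof (induction w rule: eigen_induct)
    case (1 b' v) then show ?case
      using eigen_orthogonal[OF assms 1] by (cases "b = b'") (auto simp: X_eigen cinner_scale_right)
  qed (auto simp: mv.add_right matrix_vector_scaleR cin.add_right cin.scaleR_right cin.zero_right algebra_simps)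
  then have "cnj (cinner u (X c *v w)) = cnj (exp (c / b) * cinner u w)" by simp
  then show "cinner w (mat_adj (X c) *v u) = cinner w (cnj (exp (c / b)) *s u)"
    by (simp add: cinner_mat_adj cinner_scale_right cinner_commute[of _ u])
qed

lemma E_adj_eigen:
  "eigen b u \<Longrightarrow> mat_adj (E x (of_real l)) *v u = cnj (cis (x * (l / b))) *s (mat_adj St *v u)"
proof -
  assume e: "eigen b u"
  have "exp (\<i> * complex_of_real l * complex_of_real x / complex_of_real b) = cis (x * (l / b))"
    by (simp add: cis_conv_exp mult_ac)
  then show ?thesis
    by (simp only: E_eq mat_adj_mult matrix_vector_mul_assoc[symmetric] X_adj_eigen[OF e] matrix_vector_scale)
qed

text \<open>The point \<open>l = 0\<close> is excluded because there the quotient takes the default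
  value 0 of division instead of the value of the integral; being a single point, it is discarded in
  the integration over \<open>l\<close>.\<close>

lemma Et_adj_eigen:
  assumes "eigen b u" "l \<noteq> 0" "0 \<le> x"
  shows "mat_adj (Et x (of_real l)) *v u
    = cnj (of_real b * (cis (x / b * l) - 1) / (\<i> * of_real l)) *s (mat_adj St *v u)"
proof -
  have "mat_adj (Et x (of_real l)) *v u = (LINT t:{0..x}|lborel. cnj (cis (t * (l / b))) *s (mat_adj St *v u))"
    by (simp only: Et_adj E_adj_eigen[OF assms(1)])
  also have "\<dots> = cnj (LINT t:{0..x}|lborel. cis (t * (l / b))) *s (mat_adj St *v u)"
  proof -
    have bl: "bounded_linear (\<lambda>z. cnj z *s w)" for w :: "complex^'n"
      by (rule bounded_linear_compose[OF bounded_linear_vector_scale bounded_linear_cnj])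
    have "set_integrable lborel {0..x} (\<lambda>t. cis (t * (l / b)))"
      by (auto intro!: borel_integrable_atLeastAtMost' continuous_intros simp: cis_conv_exp eigen_ne[OF assms(1)])
    from integral_bounded_linear[OF bl this[unfolded set_integrable_def], of "mat_adj St *v u"]
    have "(LINT t|lborel. cnj (indicator {0..x} t *\<^sub>R cis (t * (l / b))) *s (mat_adj St *v u))
        = cnj (LINT t:{0..x}|lborel. cis (t * (l / b))) *s (mat_adj St *v u)"
      by (simp only: set_lebesgue_integral_def)
    moreover have "cnj (r *\<^sub>R z) *s w = r *\<^sub>R (cnj z *s w)" for r z and w :: "complex^'n"
      by (simp add: vec_eq_iff)
    ultimately show ?thesis by (simp only: set_lebesgue_integral_def)
  qed
  also have "(LINT t:{0..x}|lborel. cis (t * (l / b))) = of_real b * (cis (x / b * l) - 1) / (\<i> * of_real l)"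
    using integral_cis[OF assms(3), of "l / b"] assms(2) eigen_ne[OF assms(1)] by (simp add: field_simps)
  finally show ?thesis .
qed

text \<open>The eigenvalues enter the scalar integral only through \<open>p = x / b\<close> and
  \<open>q = t / c\<close>. For opposite signs that integral vanishes, so \<open>form_eigen\<close>
  is needed for equal signs only; there, distinct eigenvalues contribute nothing by orthogonality,
  and for \<open>b = c\<close> the value \<open>2 * min x t / \<bar>b\<bar>\<close> remains.\<close>

lemma free_form_eigen:
  assumes u: "eigen b u" and v: "eigen c v" and x: "0 \<le> x" and t: "0 \<le> t"
  shows "has_bochner_integral lborel
    (\<lambda>l. cinner (mat_adj (Et x (of_real l)) *v u) (B1i *v (mat_adj (Et t (of_real l)) *v v)))
    (of_real (2 * pi * min x t) * cinner u v)"
proof -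
  define \<kappa> where "\<kappa> = cinner (mat_adj St *v u) (B1i *v (mat_adj St *v v))"
  let ?f = "\<lambda>l. cinner (mat_adj (Et x (of_real l)) *v u) (B1i *v (mat_adj (Et t (of_real l)) *v v))"
  let ?h = "\<lambda>l::real. (cis (x / b * l) - 1) * cnj (cis (t / c * l) - 1) / complex_of_real (l\<^sup>2)"
  have f: "?f l = of_real (b * c) * \<kappa> * ?h l" if "l \<noteq> 0" for l
  proof -
    have "?f l = (of_real b * (cis (x / b * l) - 1) / (\<i> * of_real l)) * (cnj (of_real c * (cis (t / c * l) - 1) / (\<i> * of_real l)) * \<kappa>)"
      by (simp only: Et_adj_eigen[OF u that x] Et_adj_eigen[OF v that t] cinner_scale_left cinner_scale_right
          matrix_vector_scale complex_cnj_cnj \<kappa>_def mult_ac)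
    then show ?thesis using that by (simp add: field_simps power2_eq_square)
  qed
  have val: "of_real (b * c) * \<kappa> * of_real (pi * (\<bar>x / b\<bar> + \<bar>t / c\<bar> - \<bar>x / b - t / c\<bar>)) = of_real (2 * pi * min x t) * cinner u v"
  proof (cases "b * c > 0")
    case True
    then have \<kappa>: "\<kappa> = cinner u v / of_real \<bar>c\<bar>" unfolding \<kappa>_def by (rule form_eigen[OF u v])
    show ?thesis
    proof (cases "b = c")
      case b: True
      have "\<bar>x / b\<bar> + \<bar>t / b\<bar> - \<bar>x / b - t / b\<bar> = 2 * min x t / \<bar>b\<bar>"
        using x t by (simp add: abs_divide flip: diff_divide_distrib) (simp add: min_def field_simps flip: add_divide_distrib diff_divide_distrib)
      then have "of_real (b * c) * \<kappa> * of_real (pi * (\<bar>x / b\<bar> + \<bar>t / c\<bar> - \<bar>x / b - t / c\<bar>))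
        = of_real (b * b * (1 / \<bar>b\<bar>) * (pi * (2 * min x t / \<bar>b\<bar>))) * cinner u v"
        unfolding \<kappa> b[symmetric] by (simp only: of_real_mult of_real_divide of_real_1) (simp add: divide_inverse mult_ac)
      also have "b * b * (1 / \<bar>b\<bar>) * (pi * (2 * min x t / \<bar>b\<bar>)) = 2 * pi * min x t"
        using eigen_ne[OF u] by (simp add: field_simps abs_mult_self_eq)
      finally show ?thesis .
    next
      case False then show ?thesis using eigen_orthogonal[OF u v] \<kappa> by simp
    qed
  next
    case False
    then have bc: "b * c < 0" using eigen_ne[OF u] eigen_ne[OF v] by (simp add: not_less le_less)
    then have "(0 \<le> x / b \<and> t / c \<le> 0) \<or> (x / b \<le> 0 \<and> 0 \<le> t / c)"
      using x t by (auto simp: mult_less_0_iff intro: divide_nonneg_pos divide_nonneg_neg)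
    then have "\<bar>x / b\<bar> + \<bar>t / c\<bar> - \<bar>x / b - t / c\<bar> = 0" by linarith
    moreover have "cinner u v = 0" using bc by (intro eigen_orthogonal[OF u v]) (auto simp: mult_less_0_iff)
    ultimately show ?thesis by simp
  qed
  have "has_bochner_integral lborel (\<lambda>l. of_real (b * c) * \<kappa> * ?h l) (of_real (2 * pi * min x t) * cinner u v)"
    unfolding val[symmetric] by (intro has_bochner_integral_mult_right has_bochner_integral_cis_product)
  moreover have "AE l in lborel. ?f l = of_real (b * c) * \<kappa> * ?h l"
    using AE_lborel_singleton[of 0] by eventually_elim (rule f)
  moreover have "?f \<in> borel_measurable lborel"
    by measurable
  ultimately show ?thesis by (subst has_bochner_integral_cong_AE) (auto dest: borel_measurable_has_bochner_integral)
qed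

lemma free_form:
  assumes "0 \<le> x" "0 \<le> t"
  shows "has_bochner_integral lborel
    (\<lambda>l. cinner (mat_adj (Et x (of_real l)) *v u) (B1i *v (mat_adj (Et t (of_real l)) *v v)))
    (of_real (2 * pi * min x t) * cinner u v)" (is "?P u v")
proof -
  have e: "?P u v" if "eigen b u" for b u v
  proof (induction v rule: eigen_induct)
    case (1 c v) show ?case by (rule free_form_eigen[OF that 1 assms])
  next
    case (3 v w) from has_bochner_integral_add[OF this] show ?case
      by (simp only: mv.add_right cin.add_right distrib_left)
  next
    case (4 r v) from has_bochner_integral_scaleR_right[OF this, of r] show ?case
      by (simp only: matrix_vector_scaleR cin.scaleR_right mult_scaleR_right)
  qed (simp add: cin.zero_right mv.zero_right has_bochner_integral_zero)
  show ?thesis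
  proof (induction u rule: eigen_induct)
    case (1 b u) then show ?case by (rule e)
  next
    case (3 v w) from has_bochner_integral_add[OF this] show ?case
      by (simp only: mv.add_right cin.add_left distrib_left)
  next
    case (4 r v) from has_bochner_integral_scaleR_right[OF this, of r] show ?case
      by (simp only: matrix_vector_scaleR cin.scaleR_left mult_scaleR_right)
  qed (simp add: cin.zero_left mv.zero_right has_bochner_integral_zero)
qed

end

subsection \<open>Densities of matrix measures\<close>

lemma measure_eqI_Ioc:
  fixes M N :: "real measure"
  assumes "sets M = sets borel" "sets N = sets borel"
    and eq: "\<And>a b. a \<le> b \<Longrightarrow> emeasure M {a<..b} = emeasure N {a<..b}"
    and fin: "\<And>a b. a \<le> b \<Longrightarrow> emeasure M {a<..b} \<noteq> \<infinity>"
  shows "M = N"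
proof (rule measure_eqI_generator_eq)
  let ?E = "range (\<lambda>(a, b). {a<..b::real})"
  have "{a<..b} \<inter> {c<..d} = {max a c<..min b d}" for a b c d :: real by auto
  then show "Int_stable ?E" unfolding Int_stable_def by (auto simp: image_iff)
  show "sets M = sigma_sets UNIV ?E" "sets N = sigma_sets UNIV ?E"
    using assms(1,2) by (simp_all add: borel_sigma_sets_Ioc)
  show "emeasure M X = emeasure N X" if X: "X \<in> ?E" for X
  proof -
    obtain a b where "X = {a<..b}" using X by auto
    then show ?thesis using eq[of a b] by (cases "a \<le> b") auto
  qed
  show "range (\<lambda>i. {- real i<..real i}) \<subseteq> ?E" by auto
  show "(\<Union>i. {- real i<..real i}) = UNIV"
  proof (intro equalityI subsetI UNIV_I)
    fix x :: real
    obtain i where "\<bar>x\<bar> < real i" using reals_Archimedean2 by blast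
    then have "x \<in> {- real i<..real i}" by auto
    then show "x \<in> (\<Union>i. {- real i<..real i})" by blast
  qed
  show "emeasure M {- real i<..real i} \<noteq> \<infinity>" for i by (rule fin) auto
qed auto

text \<open>The positive and negative parts of \<open>h\<close> are densities of measures that agree on intervals.\<close>

lemma AE_zero_of_interval_integrals:
  fixes M :: "real measure" and h :: "real \<Rightarrow> real"
  assumes "sigma_finite_measure M" and [measurable_cong]: "sets M = sets borel"
    and [measurable]: "h \<in> borel_measurable borel"
    and int: "\<And>a b. a \<le> b \<Longrightarrow> set_integrable M {a<..b} h"
    and zero: "\<And>a b. a \<le> b \<Longrightarrow> (LINT x:{a<..b}|M. h x) = 0"
  shows "AE x in M. h x = 0"
proof -
  interpret sigma_finite_measure M by fact
  let ?N = "\<lambda>s::real. density M (\<lambda>x. ennreal (max 0 (s * h x)))"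
  have em: "emeasure (?N s) {a<..b} = ennreal (LINT x|M. max 0 (s * (indicator {a<..b} x *\<^sub>R h x)))"
    if "a \<le> b" for s a b
  proof -
    have "emeasure (?N s) {a<..b} = (\<integral>\<^sup>+x. ennreal (max 0 (s * (indicator {a<..b} x *\<^sub>R h x))) \<partial>M)"
      by (subst emeasure_density) (auto intro!: nn_integral_cong split: split_indicator)
    also have "\<dots> = ennreal (LINT x|M. max 0 (s * (indicator {a<..b} x *\<^sub>R h x)))"
      using int[OF that] by (intro nn_integral_eq_integral integrable_max integrable_mult_right) (auto simp: set_integrable_def)
    finally show ?thesis .
  qed
  have "?N 1 = ?N (-1)"
  proof (rule measure_eqI_Ioc)
    show "sets (?N 1) = sets borel" "sets (?N (-1)) = sets borel" by (simp_all add: assms)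
  next
    fix a b :: real assume ab: "a \<le> b"
    let ?k = "\<lambda>x. indicator {a<..b} x *\<^sub>R h x"
    have k: "integrable M ?k" using int[OF ab] by (simp add: set_integrable_def)
    have "(LINT x|M. max 0 (1 * ?k x)) - (LINT x|M. max 0 (- 1 * ?k x)) = (LINT x|M. max 0 (1 * ?k x) - max 0 (- 1 * ?k x))"
      using k by (intro Bochner_Integration.integral_diff[symmetric] integrable_max integrable_mult_right) auto
    also have "\<dots> = (LINT x|M. ?k x)" by (intro Bochner_Integration.integral_cong) (auto simp: max_def)
    also have "\<dots> = 0" using zero[OF ab] by (simp add: set_lebesgue_integral_def)
    finally show "emeasure (?N 1) {a<..b} = emeasure (?N (-1)) {a<..b}"
      unfolding em[OF ab] by simp
    show "emeasure (?N 1) {a<..b} \<noteq> \<infinity>" unfolding em[OF ab] by simp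
  qed
  then have "AE x in M. ennreal (max 0 (1 * h x)) = ennreal (max 0 (- 1 * h x))"
    by (intro density_unique) auto
  then show ?thesis by eventually_elim (auto simp: max_def split: if_splits)
qed

lemma pos_semidef_diag: "pos_semidef C \<Longrightarrow> 0 \<le> Re (C $ i $ i)"
  by (simp add: pos_semidef_def matrix_nth_cinner)

lemma trace_diff: "trace (C - D) = trace C - trace D" for C D :: "complex^'n^'n"
  by (simp add: trace_def sum_subtractf)

text \<open>\<open>interval_measure\<close> has its intended meaning for nondecreasing
  right-continuous functions. Monotonicity of the trace comes from the nonnegative diagonals of the
  increments of \<open>\<sigma>\<close>, right-continuity from linearity of the trace.\<close>

lemma trace_measure_props:
  fixes \<sigma> :: "real \<Rightarrow> complex^'a^'a"
  assumes "increasing_matrix \<sigma>"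
  shows "sets (trace_measure \<sigma>) = sets borel" "sigma_finite_measure (trace_measure \<sigma>)"
proof -
  have mono: "Re (trace (\<sigma> a)) \<le> Re (trace (\<sigma> b))" if "a \<le> b" for a b
  proof (cases "a = b")
    case False
    then have "pos_semidef (\<sigma> b - \<sigma> a)" using assms that by (simp add: increasing_matrix_def)
    then have "0 \<le> Re (trace (\<sigma> b - \<sigma> a))" by (auto simp: trace_def intro!: sum_nonneg dest: pos_semidef_diag)
    then show ?thesis by (simp add: trace_diff)
  qed simp
  have "bounded_linear (\<lambda>C :: complex^'a^'a. Re (trace C))"
    unfolding linear_conv_bounded_linear[symmetric] trace_def
    by (auto intro!: linearI simp: sum.distrib sum_distrib_left)
  from bounded_linear.continuous[OF this] have "continuous (at_right a) (\<lambda>l. Re (trace (\<sigma> l)))" for a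
    using assms unfolding increasing_matrix_def by blast
  then show "sets (trace_measure \<sigma>) = sets borel" "sigma_finite_measure (trace_measure \<sigma>)"
    using mono unfolding trace_measure_def by (auto intro!: sigma_finite_interval_measure)
qed

lemma bounded_linear_Re_Im_nth: "bounded_linear (\<lambda>C :: complex^'a^'b. Re (C $ i $ j))" "bounded_linear (\<lambda>C :: complex^'a^'b. Im (C $ i $ j))"
  unfolding linear_conv_bounded_linear[symmetric] by (auto intro!: linearI)

text \<open>The two densities have the same integral over every half-open interval; real and
  imaginary parts of the entries reduce the claim to
  \<open>AE_zero_of_interval_integrals\<close>.\<close>

lemma matrix_density_unique:
  assumes inc: "increasing_matrix \<sigma>" and \<Phi>: "matrix_density \<sigma> \<Phi>" and \<Psi>: "matrix_density \<sigma> \<Psi>"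
  shows "AE l in trace_measure \<sigma>. \<Phi> l = \<Psi> l"
proof -
  have meas: "\<Phi> \<in> borel_measurable borel" "\<Psi> \<in> borel_measurable borel"
    using \<Phi> \<Psi> by (auto simp: matrix_density_def)
  have *: "AE l in trace_measure \<sigma>. T (\<Phi> l - \<Psi> l) = 0" if T: "bounded_linear T" for T :: "_ \<Rightarrow> real"
  proof (rule AE_zero_of_interval_integrals[OF trace_measure_props(2,1)[OF inc]])
    show "(\<lambda>l. T (\<Phi> l - \<Psi> l)) \<in> borel_measurable borel"
      using meas by (intro borel_measurable_continuous_on[OF linear_continuous_on[OF T]]) measurable
    fix a b :: real assume ab: "a \<le> b"
    let ?d = "\<lambda>l. indicator {a<..b} l *\<^sub>R \<Phi> l - indicator {a<..b} l *\<^sub>R \<Psi> l"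
    have i: "integrable (trace_measure \<sigma>) (\<lambda>l. indicator {a<..b} l *\<^sub>R \<Phi> l)" "integrable (trace_measure \<sigma>) (\<lambda>l. indicator {a<..b} l *\<^sub>R \<Psi> l)"
      and e: "(LINT l|trace_measure \<sigma>. indicator {a<..b} l *\<^sub>R \<Phi> l) = \<sigma> b - \<sigma> a"
        "(LINT l|trace_measure \<sigma>. indicator {a<..b} l *\<^sub>R \<Psi> l) = \<sigma> b - \<sigma> a"
      using \<Phi> \<Psi> ab by (auto simp: matrix_density_def set_integrable_def set_lebesgue_integral_def)
    have "has_bochner_integral (trace_measure \<sigma>) ?d ((\<sigma> b - \<sigma> a) - (\<sigma> b - \<sigma> a))"
      using i e by (intro has_bochner_integral_diff) (auto simp: has_bochner_integral_iff)
    from has_bochner_integral_bounded_linear[OF T this]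
    have "has_bochner_integral (trace_measure \<sigma>) (\<lambda>l. T (?d l)) 0"
      using T by (simp add: linear_simps)
    moreover have "T (?d l) = indicator {a<..b} l *\<^sub>R T (\<Phi> l - \<Psi> l)" for l
      using linear_simps(5)[OF T] by (metis scaleR_diff_right)
    ultimately show "set_integrable (trace_measure \<sigma>) {a<..b} (\<lambda>l. T (\<Phi> l - \<Psi> l))"
      "(LINT l:{a<..b}|trace_measure \<sigma>. T (\<Phi> l - \<Psi> l)) = 0"
      by (auto simp: has_bochner_integral_iff set_integrable_def set_lebesgue_integral_def)
  qed
  have "AE l in trace_measure \<sigma>. \<forall>i\<in>UNIV. \<forall>j\<in>UNIV. Re ((\<Phi> l - \<Psi> l) $ i $ j) = 0 \<and> Im ((\<Phi> l - \<Psi> l) $ i $ j) = 0"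
    using *[OF bounded_linear_Re_Im_nth(1)] *[OF bounded_linear_Re_Im_nth(2)]
    by (intro AE_finite_allI AE_conjI) auto
  then show ?thesis by eventually_elim (simp add: vec_eq_iff complex_eq_iff)
qed

text \<open>Replaces the density hidden in the definition by a fixed one, so that integrals of
  several pairs of functions can be added. Measurability of \<open>f\<close> and \<open>g\<close>
  allows the integral to be transferred along an almost everywhere equality.\<close>

lemma has_form_integral_density:
  assumes inc: "increasing_matrix \<sigma>" and \<Phi>: "matrix_density \<sigma> \<Phi>"
    and fg: "f \<in> borel_measurable borel" "g \<in> borel_measurable borel"
  shows "has_form_integral \<sigma> f g J \<longleftrightarrow> has_bochner_integral (trace_measure \<sigma>) (\<lambda>l. cinner (f l) (\<Phi> l *v g l)) J"
proof
  note [measurable_cong] = trace_measure_props(1)[OF inc]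
  assume "has_form_integral \<sigma> f g J"
  then obtain \<Psi> where \<Psi>: "matrix_density \<sigma> \<Psi>" and J: "has_bochner_integral (trace_measure \<sigma>) (\<lambda>l. cinner (f l) (\<Psi> l *v g l)) J"
    by (auto simp: has_form_integral_def)
  have [measurable]: "\<Phi> \<in> borel_measurable borel" using \<Phi> by (auto simp: matrix_density_def)
  note fg[measurable]
  have "AE l in trace_measure \<sigma>. cinner (f l) (\<Phi> l *v g l) = cinner (f l) (\<Psi> l *v g l)"
    using matrix_density_unique[OF inc \<Phi> \<Psi>] by eventually_elim simp
  then show "has_bochner_integral (trace_measure \<sigma>) (\<lambda>l. cinner (f l) (\<Phi> l *v g l)) J"
    using J by (subst has_bochner_integral_cong_AE) (auto dest: borel_measurable_has_bochner_integral)
qed (use \<Phi> in \<open>auto simp: has_form_integral_def\<close>)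

lemma has_matrix_integral_density:
  assumes inc: "increasing_matrix \<sigma>" and \<Phi>: "matrix_density \<sigma> \<Phi>"
    and fg: "U \<in> borel_measurable borel" "V \<in> borel_measurable borel"
  shows "has_matrix_integral \<sigma> U V J \<longleftrightarrow> has_bochner_integral (trace_measure \<sigma>) (\<lambda>l. U l ** \<Phi> l ** mat_adj (V l)) J"
proof
  note [measurable_cong] = trace_measure_props(1)[OF inc]
  assume "has_matrix_integral \<sigma> U V J"
  then obtain \<Psi> where \<Psi>: "matrix_density \<sigma> \<Psi>" and J: "has_bochner_integral (trace_measure \<sigma>) (\<lambda>l. U l ** \<Psi> l ** mat_adj (V l)) J"
    by (auto simp: has_matrix_integral_def)
  have [measurable]: "\<Phi> \<in> borel_measurable borel" using \<Phi> by (auto simp: matrix_density_def)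
  note fg[measurable]
  have "AE l in trace_measure \<sigma>. U l ** \<Phi> l ** mat_adj (V l) = U l ** \<Psi> l ** mat_adj (V l)"
    using matrix_density_unique[OF inc \<Phi> \<Psi>] by eventually_elim simp
  then show "has_bochner_integral (trace_measure \<sigma>) (\<lambda>l. U l ** \<Phi> l ** mat_adj (V l)) J"
    using J by (subst has_bochner_integral_cong_AE) (auto dest: borel_measurable_has_bochner_integral)
qed (use \<Phi> in \<open>auto simp: has_matrix_integral_def\<close>)

text \<open>Passes between the matrix integrals of parts 2 and 3 and the sesquilinear forms used in
  the proofs. In the converse, \<open>emb\<close> reassembles the matrix from its entries.\<close>

lemma has_bochner_integral_matrix_iff:
  fixes C :: "'x \<Rightarrow> complex^'a^'b"
  shows "has_bochner_integral M C J \<longleftrightarrow> (\<forall>u v. has_bochner_integral M (\<lambda>x. cinner u (C x *v v)) (cinner u (J *v v)))"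
proof (intro iffI allI)
  fix u v assume "has_bochner_integral M C J"
  then show "has_bochner_integral M (\<lambda>x. cinner u (C x *v v)) (cinner u (J *v v))"
    by (rule has_bochner_integral_bounded_linear[OF bounded_linear_compose[OF cin.bounded_linear_right mv.bounded_linear_left]])
next
  assume *: "\<forall>u v. has_bochner_integral M (\<lambda>x. cinner u (C x *v v)) (cinner u (J *v v))"
  define emb :: "'b \<Rightarrow> 'a \<Rightarrow> complex \<Rightarrow> complex^'a^'b" where "emb i j z = (\<chi> k m. if k = i \<and> m = j then z else 0)" for i j z
  have bl: "bounded_linear (emb i j)" for i j
    unfolding linear_conv_bounded_linear[symmetric] by (auto intro!: linearI simp: emb_def vec_eq_iff)
  have dec: "(\<Sum>i\<in>UNIV. \<Sum>j\<in>UNIV. emb i j (D $ i $ j)) = D" for D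
  proof -
    have "(\<Sum>j\<in>UNIV. if k = i \<and> m = j then D $ i $ j else 0) = (if k = i then D $ k $ m else 0)" for k m i
      by (cases "k = i") (auto simp: sum.delta')
    then show ?thesis by (simp add: emb_def vec_eq_iff)
  qed
  have "has_bochner_integral M (\<lambda>x. \<Sum>i\<in>UNIV. \<Sum>j\<in>UNIV. emb i j (C x $ i $ j)) (\<Sum>i\<in>UNIV. \<Sum>j\<in>UNIV. emb i j (J $ i $ j))"
    unfolding matrix_nth_cinner using *
    by (intro has_bochner_integral_sum has_bochner_integral_bounded_linear[OF bl]) auto
  then show "has_bochner_integral M C J" by (simp only: dec)
qed

lemma cinner_sandwich: "cinner u ((U ** \<Phi> ** mat_adj V) *v v) = cinner (mat_adj U *v u) (\<Phi> *v (mat_adj V *v v))"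
  by (simp only: matrix_vector_mul_assoc[symmetric] mat_adj_mult_vec)

text \<open>The signs of the imaginary terms are those for a form that is conjugate linear in its
  first argument.\<close>

lemma polarization:
  "cinner f (\<Phi> *v g) = (cinner (f + g) (\<Phi> *v (f + g)) - cinner (f - g) (\<Phi> *v (f - g))
     - \<i> * cinner (f + \<i> *s g) (\<Phi> *v (f + \<i> *s g)) + \<i> * cinner (f - \<i> *s g) (\<Phi> *v (f - \<i> *s g))) / 4"
  by (simp add: matrix_vector_scale cinner_scale_left cinner_scale_right mv.add_right mv.diff_right cin.add_left
      cin.add_right cin.diff_left cin.diff_right algebra_simps)

lemma has_bochner_integral_polarization:
  assumes "has_bochner_integral M (\<lambda>x. cinner (f x + g x) (\<Phi> x *v (f x + g x))) a"
    and "has_bochner_integral M (\<lambda>x. cinner (f x - g x) (\<Phi> x *v (f x - g x))) b"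
    and "has_bochner_integral M (\<lambda>x. cinner (f x + \<i> *s g x) (\<Phi> x *v (f x + \<i> *s g x))) c"
    and "has_bochner_integral M (\<lambda>x. cinner (f x - \<i> *s g x) (\<Phi> x *v (f x - \<i> *s g x))) d"
  shows "has_bochner_integral M (\<lambda>x. cinner (f x) (\<Phi> x *v g x)) ((a - b - \<i> * c + \<i> * d) / 4)"
proof -
  have "has_bochner_integral M (\<lambda>x. (cinner (f x + g x) (\<Phi> x *v (f x + g x)) - cinner (f x - g x) (\<Phi> x *v (f x - g x))
     - \<i> * cinner (f x + \<i> *s g x) (\<Phi> x *v (f x + \<i> *s g x)) + \<i> * cinner (f x - \<i> *s g x) (\<Phi> x *v (f x - \<i> *s g x))) / 4)
     ((a - b - \<i> * c + \<i> * d) / 4)"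
    by (intro has_bochner_integral_divide_zero has_bochner_integral_add has_bochner_integral_diff
        has_bochner_integral_mult_right assms)
  then show ?thesis by (simp only: polarization[symmetric])
qed

section \<open>The free spectral function and its density\<close>

context boundary_data
begin

lemma B1i_adj: "mat_adj B1i = B1i"
proof -
  have "mat_adj (B1i ** B1) = mat 1" by (simp add: B1_inv)
  then have "B1 ** mat_adj B1i = mat 1" using B1 by (simp add: mat_adj_mult pos_def_def)
  then have "B1i ** (B1 ** mat_adj B1i) = B1i" by simp
  then show ?thesis by (simp add: matrix_mul_assoc B1_inv)
qed

lemma B1i_pos: "v \<noteq> 0 \<Longrightarrow> 0 < Re (cinner v (B1i *v v))"
proof -
  assume v: "v \<noteq> 0"
  have e: "B1 *v (B1i *v v) = v" by (simp add: matrix_vector_mul_assoc B1_inv)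
  then have "B1i *v v \<noteq> 0" using v by auto
  then have "0 < Re (cinner (B1i *v v) (B1 *v (B1i *v v)))" using B1 by (simp add: pos_def_def)
  then show ?thesis unfolding e by (subst mat_adj_mult_vec) (simp add: B1i_adj)
qed

text \<open>The growth rate of the trace of \<open>sigma0 B1\<close>: the trace measure is
  \<open>tr0\<close> times Lebesgue measure.\<close>

definition tr0 :: real where "tr0 = Re (trace B1i) / (2 * pi)"

lemma tr0_pos: "tr0 > 0"
proof -
  have "0 < Re (B1i $ i $ i)" for i
    unfolding matrix_nth_cinner by (rule B1i_pos) (simp add: axis_eq_0_iff)
  then show ?thesis by (auto simp: tr0_def trace_def intro!: sum_pos divide_pos_pos)
qed

lemma trace_measure_sigma0: "trace_measure (sigma0 B1) = density lborel (\<lambda>_. ennreal tr0)"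
proof -
  have "Re (trace (sigma0 B1 l)) = tr0 * l" for l
    by (simp add: sigma0_def tr0_def trace_def sum_distrib_left sum_distrib_right sum_divide_distrib mult.commute)
  then have *: "trace_measure (sigma0 B1) = interval_measure (\<lambda>l. tr0 * l)"
    by (simp add: trace_measure_def)
  have em: "emeasure (interval_measure (\<lambda>l. tr0 * l)) {a<..b} = ennreal (tr0 * b - tr0 * a)" if "a \<le> b" for a b
    using that tr0_pos by (intro emeasure_interval_measure_Ioc) (auto intro!: continuous_intros mult_left_mono)
  show ?thesis unfolding *
  proof (rule measure_eqI_Ioc)
    fix a b :: real assume ab: "a \<le> b"
    show "emeasure (interval_measure (\<lambda>l. tr0 * l)) {a<..b} = emeasure (density lborel (\<lambda>_. ennreal tr0)) {a<..b}"
      using ab tr0_pos unfolding em[OF ab]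
      by (simp add: emeasure_density nn_integral_cmult_indicator ennreal_mult'[symmetric] right_diff_distrib)
    show "emeasure (interval_measure (\<lambda>l. tr0 * l)) {a<..b} \<noteq> \<infinity>" unfolding em[OF ab] by simp
  qed auto
qed

lemma sigma0_increasing: "increasing_matrix (sigma0 B1)"
proof -
  have "pos_semidef (sigma0 B1 l - sigma0 B1 m)" if "m < l" for l m
  proof -
    have "0 \<le> Re (cinner v (B1i *v v))" for v using B1i_pos[of v] by (cases "v = 0") (auto simp: cin.zero_left)
    moreover have "sigma0 B1 l - sigma0 B1 m = ((l - m) / (2 * pi)) *\<^sub>R B1i"
      by (simp add: sigma0_def diff_divide_distrib scaleR_left_diff_distrib)
    ultimately show ?thesis using that
      by (auto simp: pos_semidef_def mat_adj_scaleR B1i_adj matrix_vector_scaleR cin.scaleR_right)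
  qed
  then show ?thesis unfolding increasing_matrix_def
    by (auto simp: mat_adj_scaleR B1i_adj sigma0_def[abs_def] intro!: continuous_intros)
qed

text \<open>The Lebesgue density of \<open>sigma0 B1\<close> is \<open>B1i / (2 * pi)\<close>; the
  further division by \<open>tr0\<close> makes it a density relative to the trace measure.\<close>

definition \<Phi>0 :: "real \<Rightarrow> complex^'n^'n" where "\<Phi>0 l = (1 / (2 * pi * tr0)) *\<^sub>R B1i"

lemma density_sigma0: "matrix_density (sigma0 B1) \<Phi>0"
  unfolding matrix_density_def
proof (intro conjI allI impI)
  show "\<Phi>0 \<in> borel_measurable borel" by (simp add: \<Phi>0_def[abs_def])
  have "0 \<le> Re (cinner v (B1i *v v))" for v using B1i_pos[of v] by (cases "v = 0") (auto simp: cin.zero_left)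
  then show "pos_semidef (\<Phi>0 l)" for l using tr0_pos
    by (auto simp: \<Phi>0_def pos_semidef_def mat_adj_scaleR B1i_adj matrix_vector_scaleR cin.scaleR_right)
  fix a b :: real assume ab: "a \<le> b"
  have "has_bochner_integral (density lborel (\<lambda>_. ennreal tr0)) (\<lambda>l. indicator {a<..b} l *\<^sub>R \<Phi>0 l) (sigma0 B1 b - sigma0 B1 a)"
  proof (rule has_bochner_integral_density)
    have "has_bochner_integral lborel (\<lambda>l. indicator {a<..b} l *\<^sub>R (1 / (2 * pi)) *\<^sub>R B1i) (measure lborel {a<..b} *\<^sub>R (1 / (2 * pi)) *\<^sub>R B1i)"
      using ab by (intro has_bochner_integral_indicator) auto
    then show "has_bochner_integral lborel (\<lambda>l. tr0 *\<^sub>R indicator {a<..b} l *\<^sub>R \<Phi>0 l) (sigma0 B1 b - sigma0 B1 a)"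
      using tr0_pos ab by (simp add: \<Phi>0_def sigma0_def field_simps) (simp add: diff_divide_distrib scaleR_left_diff_distrib)
  qed (use tr0_pos in \<open>auto simp: \<Phi>0_def\<close>)
  then show "set_integrable (trace_measure (sigma0 B1)) {a<..b} \<Phi>0"
    "(LINT l:{a<..b}|trace_measure (sigma0 B1). \<Phi>0 l) = sigma0 B1 b - sigma0 B1 a"
    by (auto simp: trace_measure_sigma0 set_integrable_def set_lebesgue_integral_def has_bochner_integral_iff)
qed

text \<open>The normalization of \<open>sigma0\<close> cancels the \<open>2 * pi\<close> of
  \<open>free_form\<close>, and \<open>tr0\<close> cancels between measure and density. This is the
  Plancherel identity for the step functions with values \<open>u\<close> on \<open>[0, x]\<close>
  and \<open>v\<close> on \<open>[0, t]\<close>.\<close>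

lemma free_form_sigma0:
  assumes "0 \<le> x" "0 \<le> t"
  shows "has_bochner_integral (trace_measure (sigma0 B1))
    (\<lambda>l. cinner (mat_adj (Et x (of_real l)) *v u) (\<Phi>0 l *v (mat_adj (Et t (of_real l)) *v v)))
    (of_real (min x t) * cinner u v)"
  unfolding trace_measure_sigma0
proof (rule has_bochner_integral_density)
  have "has_bochner_integral lborel
    (\<lambda>l. (1 / (2 * pi)) *\<^sub>R cinner (mat_adj (Et x (of_real l)) *v u) (B1i *v (mat_adj (Et t (of_real l)) *v v)))
    ((1 / (2 * pi)) *\<^sub>R (of_real (2 * pi * min x t) * cinner u v))"
    by (intro has_bochner_integral_scaleR_right free_form assms)
  then show "has_bochner_integral lborel
    (\<lambda>l. tr0 *\<^sub>R cinner (mat_adj (Et x (of_real l)) *v u) (\<Phi>0 l *v (mat_adj (Et t (of_real l)) *v v)))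
    (of_real (min x t) * cinner u v)"
    using tr0_pos by (simp add: \<Phi>0_def matrix_vector_scaleR cin.scaleR_right scaleR_conv_of_real[where 'a=complex])
qed (use tr0_pos in \<open>auto simp: \<Phi>0_def\<close>)

end

subsection \<open>Density of step functions\<close>

lemma bounded_linear_vector_scale_right: "bounded_linear (\<lambda>v :: complex^'a. c *s v)"
  unfolding linear_conv_bounded_linear[symmetric] by (auto intro!: linearI simp: vec_eq_iff algebra_simps)

lemma measurable_vector_scale [measurable]:
  "f \<in> borel_measurable M \<Longrightarrow> (\<lambda>x. c *s (f x :: complex^'a)) \<in> borel_measurable M"
  by (rule borel_measurable_continuous_on[OF linear_continuous_on[OF bounded_linear_vector_scale_right]])

text \<open>A version of \<open>L2_comp\<close> in which all integrals run over the whole line;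
  fixing \<open>a\<close> makes mean-square bounds into bounds for the integral of the norm.\<close>

definition L2on :: "real \<Rightarrow> (real \<Rightarrow> complex^'a) \<Rightarrow> bool" where
  "L2on a f \<longleftrightarrow> f \<in> borel_measurable borel \<and> (\<forall>x. x \<notin> {0..a} \<longrightarrow> f x = 0) \<and> integrable lborel (\<lambda>x. (norm (f x))\<^sup>2)"

definition sqnorm :: "(real \<Rightarrow> complex^'a) \<Rightarrow> real" where
  "sqnorm f = (LINT x|lborel. (norm (f x))\<^sup>2)"

lemma sqnorm_nonneg: "0 \<le> sqnorm f"
  by (simp add: sqnorm_def)

lemma L2onD:
  assumes "L2on a f"
  shows L2on_measurable: "f \<in> borel_measurable borel" and L2on_outside: "x \<notin> {0..a} \<Longrightarrow> f x = 0"
    and L2on_square_integrable: "integrable lborel (\<lambda>x. (norm (f x))\<^sup>2)"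
  using assms by (auto simp: L2on_def)

lemma norm_add_square_le: "(norm (u + v))\<^sup>2 \<le> 2 * (norm u)\<^sup>2 + 2 * (norm v)\<^sup>2" for u v :: "'a::real_normed_vector"
proof -
  have "(norm (u + v))\<^sup>2 \<le> (norm u + norm v)\<^sup>2" by (intro power_mono norm_triangle_ineq) auto
  also have "\<dots> \<le> 2 * (norm u)\<^sup>2 + 2 * (norm v)\<^sup>2"
    using zero_le_power2[of "norm u - norm v"] by (simp add: power2_eq_square algebra_simps)
  finally show ?thesis .
qed

lemma L2on_add:
  assumes f: "L2on a f" and g: "L2on a g" shows "L2on a (\<lambda>x. f x + g x)"
  unfolding L2on_def
proof (intro conjI allI impI)
  note [measurable] = L2on_measurable[OF f] L2on_measurable[OF g]
  show "(\<lambda>x. f x + g x) \<in> borel_measurable borel" by measurable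
  show "integrable lborel (\<lambda>x. (norm (f x + g x))\<^sup>2)"
    by (rule Bochner_Integration.integrable_bound[of _ "\<lambda>x. 2 * (norm (f x))\<^sup>2 + 2 * (norm (g x))\<^sup>2"])
      (auto intro!: norm_add_square_le Bochner_Integration.integrable_add integrable_mult_right
        L2on_square_integrable[OF f] L2on_square_integrable[OF g] order.trans[OF norm_add_square_le])
qed (auto simp: L2on_outside[OF f] L2on_outside[OF g])

lemma sqnorm_add_le:
  assumes f: "L2on a f" and g: "L2on a g"
  shows "sqnorm (\<lambda>x. f x + g x) \<le> 2 * sqnorm f + 2 * sqnorm g"
proof -
  have "sqnorm (\<lambda>x. f x + g x) \<le> (LINT x|lborel. 2 * (norm (f x))\<^sup>2 + 2 * (norm (g x))\<^sup>2)"
    unfolding sqnorm_def using L2on_square_integrable[OF f] L2on_square_integrable[OF g] L2on_square_integrable[OF L2on_add[OF f g]]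
    by (intro integral_mono norm_add_square_le) auto
  then show ?thesis using L2on_square_integrable[OF f] L2on_square_integrable[OF g] by (simp add: sqnorm_def)
qed

lemma L2on_scale: "L2on a f \<Longrightarrow> L2on a (\<lambda>x. c *s f x)"
  unfolding L2on_def
proof (intro conjI allI impI)
  assume f: "f \<in> borel_measurable borel \<and> (\<forall>x. x \<notin> {0..a} \<longrightarrow> f x = 0) \<and> integrable lborel (\<lambda>x. (norm (f x))\<^sup>2)"
  show "(\<lambda>x. c *s f x) \<in> borel_measurable borel" using f by (intro measurable_vector_scale) blast
qed (auto simp: norm_vector_scale power_mult_distrib)

lemma L2on_uminus: "L2on a f \<Longrightarrow> L2on a (\<lambda>x. - f x)"
  by (auto simp: L2on_def)

lemma L2on_diff: "L2on a f \<Longrightarrow> L2on a g \<Longrightarrow> L2on a (\<lambda>x. f x - g x)"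
  using L2on_add[of a f "\<lambda>x. - g x"] L2on_uminus[of a g] by simp

lemma sqnorm_minus_commute: "sqnorm (\<lambda>x. f x - g x) = sqnorm (\<lambda>x. g x - f x)"
  by (simp add: sqnorm_def norm_minus_commute)

lemma sqnorm_diff_triangle:
  assumes "L2on a f" "L2on a g" "L2on a h"
  shows "sqnorm (\<lambda>x. f x - h x) \<le> 2 * sqnorm (\<lambda>x. f x - g x) + 2 * sqnorm (\<lambda>x. g x - h x)"
  using sqnorm_add_le[OF L2on_diff[OF assms(1,2)] L2on_diff[OF assms(2,3)]] by simp

lemma L2on_indicator:
  assumes [measurable]: "A \<in> sets borel" and "0 \<le> a"
  shows "L2on a (\<lambda>x. indicator (A \<inter> {0..a}) x *\<^sub>R v)"
proof -
  have "emeasure lborel (A \<inter> {0..a}) \<le> emeasure lborel {0..a}" by (intro emeasure_mono) auto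
  also have "\<dots> < \<infinity>" by (simp add: emeasure_lborel_Icc_eq)
  finally have "integrable lborel (\<lambda>x. indicator (A \<inter> {0..a}) x *\<^sub>R (norm v)\<^sup>2)"
    by (intro integrable_scaleR_left integrable_real_indicator) auto
  moreover have "(\<lambda>x. (norm (indicator (A \<inter> {0..a}) x *\<^sub>R v))\<^sup>2) = (\<lambda>x. indicator (A \<inter> {0..a}) x *\<^sub>R (norm v)\<^sup>2)"
    by (auto split: split_indicator)
  ultimately show ?thesis by (auto simp: L2on_def split: split_indicator)
qed

lemma L2on_inner_integrable:
  assumes f: "L2on a f" and g: "L2on b g"
  shows "integrable lborel (\<lambda>x. norm (f x) * norm (g x))"
proof (rule Bochner_Integration.integrable_bound[of _ "\<lambda>x. (norm (f x))\<^sup>2 + (norm (g x))\<^sup>2"])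
  note [measurable] = L2on_measurable[OF f] L2on_measurable[OF g]
  show "(\<lambda>x. norm (f x) * norm (g x)) \<in> borel_measurable lborel" by measurable
  have "u * v \<le> u\<^sup>2 + v\<^sup>2" if "0 \<le> u" "0 \<le> v" for u v :: real
    using sum_squares_bound[of u v] zero_le_power2[of u] zero_le_power2[of v] by linarith
  then show "AE x in lborel. norm (norm (f x) * norm (g x)) \<le> norm ((norm (f x))\<^sup>2 + (norm (g x))\<^sup>2)"
    by (auto simp: abs_mult)
qed (use L2on_square_integrable[OF f] L2on_square_integrable[OF g] in auto)

text \<open>The discriminant argument behind the Cauchy-Schwarz inequality, with the degenerate case
  of an affine function treated separately.\<close>

lemma quadratic_form_nonneg_discriminant:
  fixes A B P :: real
  assumes "\<And>t. 0 \<le> A - 2 * t * P + t\<^sup>2 * B" and "0 \<le> A" "0 \<le> B"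
  shows "P \<le> sqrt A * sqrt B"
proof (cases "B = 0")
  case True
  \<comment> \<open>If \<open>P\<close> were nonzero, this \<open>t\<close> would give the value
    -1.\<close>
  then have "P = 0" using assms(1)[of "(A + 1) / (2 * P)"] by (cases "P = 0") auto
  then show ?thesis using assms by simp
next
  case False
  then have B: "B > 0" using assms by simp
  \<comment> \<open>\<open>P / B\<close> is the minimiser of the quadratic polynomial.\<close>
  have "0 \<le> (A - 2 * (P / B) * P + (P / B)\<^sup>2 * B) * B" using assms(1)[of "P / B"] B by simp
  also have "\<dots> = A * B - P\<^sup>2" using B by (simp add: power2_eq_square field_simps)
  finally have "P\<^sup>2 \<le> A * B" by simp
  then have "P \<le> sqrt (A * B)" by (rule real_le_rsqrt)
  then show ?thesis by (simp add: real_sqrt_mult)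
qed

lemma L2on_Cauchy_Schwarz:
  assumes f: "L2on a f" and g: "L2on b g"
  shows "(LINT x|lborel. norm (f x) * norm (g x)) \<le> sqrt (sqnorm f) * sqrt (sqnorm g)"
proof (rule quadratic_form_nonneg_discriminant)
  fix t :: real
  have "0 \<le> (LINT x|lborel. (norm (f x) - t * norm (g x))\<^sup>2)" by simp
  also have "\<dots> = (LINT x|lborel. (norm (f x))\<^sup>2 - 2 * t * (norm (f x) * norm (g x)) + t\<^sup>2 * (norm (g x))\<^sup>2)"
    by (simp add: power2_eq_square algebra_simps)
  also have "\<dots> = sqnorm f - 2 * t * (LINT x|lborel. norm (f x) * norm (g x)) + t\<^sup>2 * sqnorm g"
    using L2on_square_integrable[OF f] L2on_square_integrable[OF g] L2on_inner_integrable[OF f g]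
    by (simp add: sqnorm_def)
  finally show "0 \<le> sqnorm f - 2 * t * (LINT x|lborel. norm (f x) * norm (g x)) + t\<^sup>2 * sqnorm g" .
qed (rule sqnorm_nonneg)+

lemma L2on_norm_integrable:
  assumes f: "L2on a f"
  shows "integrable lborel (\<lambda>x. norm (f x))"
proof (rule Bochner_Integration.integrable_bound[of _ "\<lambda>x. indicator {0..a} x + (norm (f x))\<^sup>2"])
  note [measurable] = L2on_measurable[OF f]
  show "(\<lambda>x. norm (f x)) \<in> borel_measurable lborel" by measurable
  have "u \<le> 1 + u\<^sup>2" for u :: real
    using zero_le_power2[of "u - 1"] zero_le_power2[of "u + 1"] by (simp add: power2_eq_square algebra_simps)
  then show "AE x in lborel. norm (norm (f x)) \<le> norm (indicator {0..a} x + (norm (f x))\<^sup>2)"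
    using L2on_outside[OF f] by (auto split: split_indicator)
  show "integrable lborel (\<lambda>x. indicator {0..a} x + (norm (f x))\<^sup>2)"
    by (intro Bochner_Integration.integrable_add integrable_real_indicator L2on_square_integrable[OF f])
      (auto simp: emeasure_lborel_Icc_eq)
qed

lemma L2on_L1_le:
  assumes f: "L2on a f" and a: "0 \<le> a"
  shows "(LINT x|lborel. norm (f x)) \<le> sqrt (sqnorm f) * sqrt a"
proof -
  \<comment> \<open>A function of norm 1 on \<open>[0, a]\<close>; \<open>undefined\<close> merely
    selects some coordinate.\<close>
  let ?g = "\<lambda>x::real. indicator (UNIV \<inter> {0..a}) x *\<^sub>R (axis undefined 1 :: complex^'a)"
  have g: "L2on a ?g" by (rule L2on_indicator) (use a in auto)
  have "(LINT x|lborel. norm (f x)) = (LINT x|lborel. norm (f x) * norm (?g x))"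
    using L2on_outside[OF f] by (intro Bochner_Integration.integral_cong) (auto split: split_indicator)
  also have "\<dots> \<le> sqrt (sqnorm f) * sqrt (sqnorm ?g)" by (rule L2on_Cauchy_Schwarz[OF f g])
  also have "sqnorm ?g = (LINT x|lborel. indicator {0..a} x)"
    unfolding sqnorm_def by (intro Bochner_Integration.integral_cong) (auto split: split_indicator)
  also have "\<dots> = a" using a by simp
  finally show ?thesis .
qed

text \<open>Only intervals starting at 0 are generators, since \<open>Et\<close> yields the
  transforms of exactly these; other intervals arise as differences. Scalars are absorbed into
  \<open>v\<close>, so closure under addition suffices.\<close>

inductive stepf :: "real \<Rightarrow> (real \<Rightarrow> complex^'a) \<Rightarrow> bool" for a where
  gen: "0 \<le> x \<Longrightarrow> x \<le> a \<Longrightarrow> stepf a (\<lambda>s. indicator {0..x} s *\<^sub>R v)"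
| add: "stepf a f \<Longrightarrow> stepf a g \<Longrightarrow> stepf a (\<lambda>s. f s + g s)"

lemma stepf_L2on: "stepf a f \<Longrightarrow> L2on a f"
proof (induction rule: stepf.induct)
  case (gen x v)
  have "L2on a (\<lambda>s. indicator ({0..x} \<inter> {0..a}) s *\<^sub>R v)" by (rule L2on_indicator) (use gen in auto)
  moreover have e: "{0..x} \<inter> {0..a} = {0..x}" using gen by auto
  ultimately show ?case unfolding e by simp
qed (rule L2on_add)

lemma stepf_uminus: "stepf a f \<Longrightarrow> stepf a (\<lambda>s. - f s)"
proof (induction rule: stepf.induct)
  case (gen x v) then show ?case using stepf.gen[of x a "- v"] by simp
next
  case (add f g) then show ?case using stepf.add[of a "\<lambda>s. - f s" "\<lambda>s. - g s"] by simp
qed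

lemma stepf_diff: "stepf a f \<Longrightarrow> stepf a g \<Longrightarrow> stepf a (\<lambda>s. f s - g s)"
  using stepf.add[of a f "\<lambda>s. - g s"] stepf_uminus[of a g] by simp

definition approximable :: "real \<Rightarrow> (real \<Rightarrow> complex^'a) \<Rightarrow> bool" where
  "approximable a f \<longleftrightarrow> (\<forall>e>0. \<exists>s. stepf a s \<and> sqnorm (\<lambda>x. f x - s x) < e)"

lemma approximable_stepf: "stepf a f \<Longrightarrow> approximable a f"
  unfolding approximable_def by (auto intro!: exI[of _ f] simp: sqnorm_def)

lemma approximable_add:
  assumes "L2on a f" "L2on a g" "approximable a f" "approximable a g"
  shows "approximable a (\<lambda>x. f x + g x)"
  unfolding approximable_def
proof (intro allI impI)
  fix e :: real assume "e > 0"
  then obtain s t where s: "stepf a s" "sqnorm (\<lambda>x. f x - s x) < e / 4" and t: "stepf a t" "sqnorm (\<lambda>x. g x - t x) < e / 4"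
    using assms(3,4) unfolding approximable_def by (meson divide_pos_pos zero_less_numeral)
  have "sqnorm (\<lambda>x. (f x - s x) + (g x - t x)) \<le> 2 * sqnorm (\<lambda>x. f x - s x) + 2 * sqnorm (\<lambda>x. g x - t x)"
    by (intro sqnorm_add_le[of a] L2on_diff assms stepf_L2on s t)
  moreover have "(\<lambda>x. (f x - s x) + (g x - t x)) = (\<lambda>x. (f x + g x) - (s x + t x))" by (auto simp: algebra_simps)
  ultimately have "sqnorm (\<lambda>x. (f x + g x) - (s x + t x)) < e" using s t by simp
  then show "\<exists>s. stepf a s \<and> sqnorm (\<lambda>x. (f x + g x) - s x) < e" using stepf.add[OF s(1) t(1)] by blast
qed

lemma approximable_limit:
  assumes f: "L2on a f" and g: "\<And>k. L2on a (g k)" "\<And>k::nat. approximable a (g k)"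
    and lim: "(\<lambda>k. sqnorm (\<lambda>x. f x - g k x)) \<longlonglongrightarrow> 0"
  shows "approximable a f"
  unfolding approximable_def
proof (intro allI impI)
  fix e :: real assume e: "e > 0"
  then have "eventually (\<lambda>k. sqnorm (\<lambda>x. f x - g k x) < e / 4) sequentially"
    using lim by (intro order_tendstoD) auto
  then obtain k where k: "sqnorm (\<lambda>x. f x - g k x) < e / 4" by (auto simp: eventually_sequentially)
  have "e / 4 > 0" using e by simp
  then obtain s where s: "stepf a s" "sqnorm (\<lambda>x. g k x - s x) < e / 4"
    using g(2) unfolding approximable_def by blast
  have "sqnorm (\<lambda>x. f x - s x) < e"
    using sqnorm_diff_triangle[OF f g(1) stepf_L2on[OF s(1)], of k] k s by simp
  then show "\<exists>s. stepf a s \<and> sqnorm (\<lambda>x. f x - s x) < e" using s by blast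
qed

lemma sqnorm_dominated_convergence:
  fixes g :: "nat \<Rightarrow> real \<Rightarrow> complex^'a"
  assumes f: "L2on a f" and g: "\<And>k. g k \<in> borel_measurable borel"
    and lim: "\<And>x. (\<lambda>k. g k x) \<longlonglongrightarrow> f x" and h: "integrable lborel h" and dom: "\<And>k x. (norm (f x - g k x))\<^sup>2 \<le> h x"
  shows "(\<lambda>k. sqnorm (\<lambda>x. f x - g k x)) \<longlonglongrightarrow> 0"
proof -
  note [measurable] = L2on_measurable[OF f] g
  have "(\<lambda>k. LINT x|lborel. (norm (f x - g k x))\<^sup>2) \<longlonglongrightarrow> (LINT x::real|lborel. (0::real))"
  proof (rule integral_dominated_convergence[where w = h])
    show "integrable lborel h" by (rule h)
    have "(\<lambda>k. (norm (f x - g k x))\<^sup>2) \<longlonglongrightarrow> (norm (f x - f x))\<^sup>2" for x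
      by (intro tendsto_intros lim)
    then show "AE x in lborel. (\<lambda>k. (norm (f x - g k x))\<^sup>2) \<longlonglongrightarrow> 0" by simp
  qed (use dom in auto)
  then show ?thesis by (simp add: sqnorm_def)
qed

text \<open>Induction over the Borel sets from half-lines, which meet \<open>[0, a]\<close> in an
  initial interval or not at all. Complements are differences from \<open>[0, a]\<close>; countable
  disjoint unions are mean-square limits of finite ones.\<close>

lemma approximable_indicator:
  assumes "A \<in> sets borel" and a: "0 \<le> a"
  shows "approximable a (\<lambda>x. indicator (A \<inter> {0..a}) x *\<^sub>R v)"
proof -
  have gen: "sets (borel :: real measure) = sigma_sets UNIV (range (\<lambda>c. {..c}))"
    unfolding borel_eq_atMost by simp
  have "Int_stable (range (\<lambda>c::real. {..c}))"
    by (auto simp: Int_stable_def)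
  moreover have "range (\<lambda>c::real. {..c}) \<subseteq> Pow UNIV" by simp
  moreover have "A \<in> sigma_sets UNIV (range (\<lambda>c::real. {..c}))" using assms(1) gen by simp
  ultimately show ?thesis
  proof (induction rule: sigma_sets_induct_disjoint)
    case (basic C)
    then obtain c where C: "C = {..c}" by auto
    show ?case
    proof (cases "c < 0")
      case True
      then have "C \<inter> {0..a} = {}" using C by auto
      then show ?thesis using approximable_stepf[OF stepf.gen[of 0 a "0"]] a by simp
    next
      case False
      then have "C \<inter> {0..a} = {0..min c a}" using C by auto
      then show ?thesis using False a approximable_stepf[OF stepf.gen[of "min c a" a v]] by simp
    qed
  next
    case empty show ?case using approximable_stepf[OF stepf.gen[of 0 a "0"]] a by simp
  next
    case (compl C)
    then have C: "C \<in> sets borel" using gen by simp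
    have "approximable a (\<lambda>x. - (indicator (C \<inter> {0..a}) x *\<^sub>R v))"
      unfolding approximable_def
    proof (intro allI impI)
      fix e :: real assume "e > 0"
      then obtain s where s: "stepf a s" "sqnorm (\<lambda>x. indicator (C \<inter> {0..a}) x *\<^sub>R v - s x) < e"
        using compl.IH unfolding approximable_def by blast
      have "sqnorm (\<lambda>x. - (indicator (C \<inter> {0..a}) x *\<^sub>R v) - (- s x)) = sqnorm (\<lambda>x. indicator (C \<inter> {0..a}) x *\<^sub>R v - s x)"
        by (simp add: sqnorm_def norm_minus_commute)
      then show "\<exists>s. stepf a s \<and> sqnorm (\<lambda>x. - (indicator (C \<inter> {0..a}) x *\<^sub>R v) - s x) < e"
        using stepf_uminus[OF s(1)] s(2) by (intro exI[of _ "\<lambda>x. - s x"]) simp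
    qed
    moreover have "approximable a (\<lambda>x. indicator {0..a} x *\<^sub>R v)" using a by (intro approximable_stepf stepf.gen) auto
    moreover have "L2on a (\<lambda>x. indicator {0..a} x *\<^sub>R v)" using L2on_indicator[of UNIV a v] a by simp
    moreover have "L2on a (\<lambda>x. - (indicator (C \<inter> {0..a}) x *\<^sub>R v))" by (intro L2on_uminus L2on_indicator C a)
    ultimately have "approximable a (\<lambda>x. indicator {0..a} x *\<^sub>R v + - (indicator (C \<inter> {0..a}) x *\<^sub>R v))"
      by (intro approximable_add)
    moreover have "(\<lambda>x. indicator {0..a} x *\<^sub>R v + - (indicator (C \<inter> {0..a}) x *\<^sub>R v)) = (\<lambda>x. indicator ((UNIV - C) \<inter> {0..a}) x *\<^sub>R v)"
      by (auto split: split_indicator)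
    ultimately show ?case by simp
  next
    case (union C)
    then have C: "C i \<in> sets borel" for i using gen by auto
    let ?U = "\<lambda>k. \<Union>i<k. C i"
    have U: "?U k \<in> sets borel" for k using C by auto
    have "approximable a (\<lambda>x. indicator (?U k \<inter> {0..a}) x *\<^sub>R v)" for k
    proof (induction k)
      case 0 show ?case using approximable_stepf[OF stepf.gen[of 0 a "0"]] a by simp
    next
      case (Suc k)
      have "C i \<inter> C k = {}" if "i < k" for i using union(1) that by (simp add: disjoint_family_on_def)
      then have "x \<in> C i \<Longrightarrow> i < k \<Longrightarrow> x \<notin> C k" for x i by blast
      then have "(\<lambda>x. indicator (?U (Suc k) \<inter> {0..a}) x *\<^sub>R v)
        = (\<lambda>x. indicator (?U k \<inter> {0..a}) x *\<^sub>R v + indicator (C k \<inter> {0..a}) x *\<^sub>R v)"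
        by (intro ext) (auto simp: lessThan_Suc indicator_def)
      moreover have "approximable a (\<lambda>x. indicator (?U k \<inter> {0..a}) x *\<^sub>R v + indicator (C k \<inter> {0..a}) x *\<^sub>R v)"
        by (intro approximable_add L2on_indicator U C a Suc union)
      ultimately show ?case by simp
    qed
    moreover have "(\<lambda>k. sqnorm (\<lambda>x. indicator ((\<Union>i. C i) \<inter> {0..a}) x *\<^sub>R v - indicator (?U k \<inter> {0..a}) x *\<^sub>R v)) \<longlonglongrightarrow> 0"
    proof (rule sqnorm_dominated_convergence)
      show "L2on a (\<lambda>x. indicator ((\<Union>i. C i) \<inter> {0..a}) x *\<^sub>R v)" using C by (intro L2on_indicator a) auto
      show "(\<lambda>x. indicator (?U k \<inter> {0..a}) x *\<^sub>R v) \<in> borel_measurable borel" for k using C by measurable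
      show "(\<lambda>k. indicator (?U k \<inter> {0..a}) x *\<^sub>R v) \<longlonglongrightarrow> indicator ((\<Union>i. C i) \<inter> {0..a}) x *\<^sub>R v" for x
        unfolding indicator_inter_arith by (intro tendsto_intros LIMSEQ_indicator_UN)
      show "integrable lborel (\<lambda>x. indicator {0..a} x *\<^sub>R (norm v)\<^sup>2)"
        by (intro integrable_scaleR_left integrable_real_indicator) (auto simp: emeasure_lborel_Icc_eq)
      show "(norm (indicator ((\<Union>i. C i) \<inter> {0..a}) x *\<^sub>R v - indicator (?U k \<inter> {0..a}) x *\<^sub>R v))\<^sup>2 \<le> indicator {0..a} x *\<^sub>R (norm v)\<^sup>2" for k x
        by (auto split: split_indicator)
    qed
    moreover have "L2on a (\<lambda>x. indicator ((\<Union>i. C i) \<inter> {0..a}) x *\<^sub>R v)" using C by (intro L2on_indicator a) auto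
    moreover have "L2on a (\<lambda>x. indicator (?U k \<inter> {0..a}) x *\<^sub>R v)" for k by (intro L2on_indicator U a)
    ultimately show ?case by (rule approximable_limit[where g = "\<lambda>k x. indicator (?U k \<inter> {0..a}) x *\<^sub>R v", rotated 2])
  qed
qed

text \<open>Simple functions dominated by \<open>2 * norm (f x)\<close> converge to \<open>f\<close>
  in mean square, and each is a finite sum of vectors times indicators of its level sets.\<close>

lemma approximable_L2on:
  assumes f: "L2on a f" and a: "0 \<le> a"
  shows "approximable a f"
proof -
  note [measurable] = L2on_measurable[OF f]
  obtain F :: "nat \<Rightarrow> real \<Rightarrow> complex^'a" where F: "\<And>i. simple_function borel (F i)" and lim: "\<And>x. (\<lambda>i. F i x) \<longlonglongrightarrow> f x"
    and bd: "\<And>i x. norm (F i x) \<le> 2 * norm (f x)"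
    using borel_measurable_implies_sequence_metric[of f borel 0] by auto
  have Fm [measurable]: "F i \<in> borel_measurable borel" for i using F by (rule borel_measurable_simple_function)
  \<comment> \<open>The constant 9 is the square of 1 + 2, where 2 comes from the bound
    \<open>bd\<close>.\<close>
  have dom: "(norm (f x - F k x))\<^sup>2 \<le> 9 * (norm (f x))\<^sup>2" for k x
  proof -
    have "norm (f x - F k x) \<le> norm (f x) + norm (F k x)" by (rule norm_triangle_ineq4)
    also have "\<dots> \<le> 3 * norm (f x)" using bd[of k x] by simp
    finally have "(norm (f x - F k x))\<^sup>2 \<le> (3 * norm (f x))\<^sup>2" by (rule power_mono) simp
    then show ?thesis by (simp add: power_mult_distrib)
  qed
  have L: "L2on a (F k)" for k
    unfolding L2on_def
  proof (intro conjI allI impI)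
    show "F k \<in> borel_measurable borel" by measurable
    show "F k x = 0" if "x \<notin> {0..a}" for x using bd[of k x] L2on_outside[OF f that] by simp
    show "integrable lborel (\<lambda>x. (norm (F k x))\<^sup>2)"
    proof (rule Bochner_Integration.integrable_bound[of _ "\<lambda>x. 4 * (norm (f x))\<^sup>2"])
      show "AE x in lborel. norm ((norm (F k x))\<^sup>2) \<le> norm (4 * (norm (f x))\<^sup>2)"
        using power_mono[OF bd norm_ge_zero, of _ _ 2] by (auto simp: power_mult_distrib)
    qed (use L2on_square_integrable[OF f] in auto)
  qed
  have "approximable a (F k)" for k
  proof -
    have ind: "L2on a (\<lambda>x. indicator (F k -` {y} \<inter> {0..a}) x *\<^sub>R y)" "approximable a (\<lambda>x. indicator (F k -` {y} \<inter> {0..a}) x *\<^sub>R y)" for y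
      using a measurable_sets_borel[OF Fm, of "{y}" k] by (auto intro: L2on_indicator approximable_indicator)
    have sum: "L2on a (\<lambda>x. \<Sum>y\<in>Y. indicator (F k -` {y} \<inter> {0..a}) x *\<^sub>R y) \<and> approximable a (\<lambda>x. \<Sum>y\<in>Y. indicator (F k -` {y} \<inter> {0..a}) x *\<^sub>R y)"
      if "finite Y" for Y
      using that
    proof induction
      case empty
      have "stepf a (\<lambda>x. 0)" using stepf.gen[of 0 a 0] a by simp
      then show ?case using stepf_L2on approximable_stepf by auto
    next
      case (insert y Y)
      then have "L2on a (\<lambda>x. \<Sum>y\<in>Y. indicator (F k -` {y} \<inter> {0..a}) x *\<^sub>R y)" "approximable a (\<lambda>x. \<Sum>y\<in>Y. indicator (F k -` {y} \<inter> {0..a}) x *\<^sub>R y)"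
        by blast+
      then show ?case
        unfolding sum.insert[OF insert.hyps] by (intro conjI L2on_add approximable_add ind)
    qed
    have fin: "finite (range (F k))" using F[of k] by (simp add: simple_function_def)
    \<comment> \<open>Cutting the level sets down to \<open>[0, a]\<close> changes nothing, because
      \<open>F k\<close> vanishes outside.\<close>
    have "(\<Sum>y\<in>range (F k). indicator (F k -` {y} \<inter> {0..a}) x *\<^sub>R y) = F k x" for x
    proof -
      have "(\<Sum>y\<in>range (F k). indicator (F k -` {y} \<inter> {0..a}) x *\<^sub>R y) = (\<Sum>y\<in>range (F k). if y = F k x then F k x else 0)"
        using L2on_outside[OF L, of x k] by (intro sum.cong) (auto split: split_indicator)
      then show ?thesis using fin by simp
    qed
    then show ?thesis using sum[OF fin] by simp
  qed
  moreover have "(\<lambda>k. sqnorm (\<lambda>x. f x - F k x)) \<longlonglongrightarrow> 0"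
    using L2on_square_integrable[OF f] by (intro sqnorm_dominated_convergence[OF f Fm lim _ dom]) auto
  ultimately show ?thesis by (rule approximable_limit[where g = F, OF f L])
qed

lemma stepf_sequence:
  assumes f: "L2on a f" and a: "0 \<le> a"
  obtains s where "\<And>k::nat. stepf a (s k)" "(\<lambda>k. sqnorm (\<lambda>x. f x - s k x)) \<longlonglongrightarrow> 0"
proof -
  have "\<exists>s. stepf a s \<and> sqnorm (\<lambda>x. f x - s x) < inverse (real (Suc k))" for k
    using approximable_L2on[OF assms] unfolding approximable_def by simp
  then obtain s where s: "\<And>k. stepf a (s k)" "\<And>k. sqnorm (\<lambda>x. f x - s k x) < inverse (real (Suc k))" by metis
  have "(\<lambda>k. sqnorm (\<lambda>x. f x - s k x)) \<longlonglongrightarrow> 0"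
    by (rule tendsto_sandwich[OF _ _ tendsto_const LIMSEQ_inverse_real_of_nat])
      (use s(2) in \<open>auto simp: sqnorm_nonneg intro!: always_eventually less_imp_le\<close>)
  then show ?thesis using s that by blast
qed

subsection \<open>Extension of form identities from step functions\<close>

text \<open>If \<open>f\<close> is not integrable, its integral is 0 by convention and the bound
  holds because \<open>g\<close> is nonnegative.\<close>

lemma norm_integral_le:
  fixes f :: "'x \<Rightarrow> 'b::{banach, second_countable_topology}"
  assumes "integrable M g" "\<And>x. norm (f x) \<le> g x"
  shows "norm (integral\<^sup>L M f) \<le> integral\<^sup>L M g"
proof (cases "integrable M f")
  case True
  have "norm (integral\<^sup>L M f) \<le> (LINT x|M. norm (f x))" by (rule integral_norm_bound)
  also have "\<dots> \<le> integral\<^sup>L M g" using True assms by (intro integral_mono) auto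
  finally show ?thesis .
next
  case False
  have "0 \<le> g x" for x using assms(2)[of x] norm_ge_zero order.trans by blast
  then show ?thesis using False by (simp add: not_integrable_integral_eq)
qed

lemma tendsto_norm_bound:
  fixes x :: "nat \<Rightarrow> 'b::real_normed_vector"
  assumes "\<And>j. norm (x j - y) \<le> b j" "b \<longlonglongrightarrow> 0"
  shows "x \<longlonglongrightarrow> y"
  by (rule LIM_zero_cancel, rule Lim_null_comparison[OF _ assms(2)]) (use assms(1) in simp)

lemma pos_semidef_form_real: "pos_semidef P \<Longrightarrow> cinner u (P *v u) = of_real (Re (cinner u (P *v u)))"
proof -
  assume "pos_semidef P"
  then have "cinner u (P *v u) = cnj (cinner u (P *v u))"
    by (subst cinner_commute) (simp add: pos_semidef_def mat_adj_mult_vec)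
  then show ?thesis by (metis Reals_cnj_iff of_real_Re)
qed

text \<open>Positivity at the vector \<open>e u - v\<close> bounds the mixed term by a weighted sum
  of the two quadratic terms.\<close>

lemma pos_semidef_add_le:
  assumes "pos_semidef P" "e > 0"
  shows "Re (cinner (u + v) (P *v (u + v))) \<le> (1 + e) * Re (cinner u (P *v u)) + (1 + 1 / e) * Re (cinner v (P *v v))"
proof -
  let ?p = "\<lambda>u. Re (cinner u (P *v u))" and ?b = "Re (cinner u (P *v v))"
  have b: "Re (cinner v (P *v u)) = ?b"
    using assms(1) by (subst cinner_commute) (simp add: pos_semidef_def mat_adj_mult_vec)
  have "0 \<le> ?p (e *\<^sub>R u - v)" using assms by (simp add: pos_semidef_def)
  also have "\<dots> = e\<^sup>2 * ?p u - 2 * e * ?b + ?p v"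
    using b by (simp add: mv.diff_right mv.scaleR_right cin.diff_left cin.diff_right cin.scaleR_left cin.scaleR_right algebra_simps power2_eq_square)
  finally have "2 * ?b * e \<le> (e * ?p u + ?p v / e) * e" using assms(2) by (simp add: algebra_simps power2_eq_square)
  then have "2 * ?b \<le> e * ?p u + ?p v / e" using assms(2) by (simp only: mult_le_cancel_right_pos)
  then show ?thesis using b by (simp add: mv.add_right cin.add_left cin.add_right algebra_simps)
qed

text \<open>\<open>S\<close> is the form of \<open>I + k\<close>, with which the integral of the form \<open>q\<close> of the transforms is compared.\<close>

locale kernel_form =
  fixes M :: "real measure" and \<Phi> :: "real \<Rightarrow> complex^'n^'n" and G :: "real \<Rightarrow> real \<Rightarrow> complex^'n^'m"
    and k :: "real \<Rightarrow> real \<Rightarrow> complex^'m^'m" and a C D :: real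
  assumes M [measurable_cong]: "sets M = sets borel"
    and \<Phi> [measurable]: "\<Phi> \<in> borel_measurable borel" and \<Phi>_pos: "\<And>l. pos_semidef (\<Phi> l)"
    and a: "0 \<le> a" and D: "0 \<le> D" and C: "0 \<le> C"
    and G_meas: "(\<lambda>z. G (fst z) (snd z)) \<in> borel_measurable borel"
    and G_bound: "\<And>x l v. norm (mat_adj (G x l) *v v) \<le> C * norm v"
    and k_meas: "(\<lambda>z. k (fst z) (snd z)) \<in> borel_measurable borel"
    and k_bound: "\<And>x t u v. cmod (cinner u (k x t *v v)) \<le> D * norm u * norm v"
begin

definition T :: "(real \<Rightarrow> complex^'m) \<Rightarrow> real \<Rightarrow> complex^'n" where
  "T f l = (LINT x|lborel. mat_adj (G x l) *v f x)"

definition S :: "(real \<Rightarrow> complex^'m) \<Rightarrow> (real \<Rightarrow> complex^'m) \<Rightarrow> complex" where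
  "S f g = (LINT x|lborel. cinner (f x) (g x)) + (LINT t|lborel. LINT x|lborel. cinner (f x) (k x t *v g t))"

definition q :: "(real \<Rightarrow> complex^'m) \<Rightarrow> (real \<Rightarrow> complex^'m) \<Rightarrow> real \<Rightarrow> complex" where
  "q f g l = cinner (T f l) (\<Phi> l *v T g l)"

lemma G_meas' [measurable]: "(\<lambda>z. G (fst z) (snd z)) \<in> borel_measurable (borel \<Otimes>\<^sub>M borel)"
  and k_meas' [measurable]: "(\<lambda>z. k (fst z) (snd z)) \<in> borel_measurable (borel \<Otimes>\<^sub>M borel)"
  using G_meas k_meas by (simp_all add: borel_prod)

lemma G_meas1 [measurable]: "(\<lambda>x. G x l) \<in> borel_measurable borel"
  and k_meas1 [measurable]: "(\<lambda>x. k x t) \<in> borel_measurable borel"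
  using measurable_compose[OF _ G_meas', of "\<lambda>x. (x, l)" borel] measurable_compose[OF _ k_meas', of "\<lambda>x. (x, t)" borel] by simp_all

lemma T_integrable:
  assumes f: "L2on a f" shows "integrable lborel (\<lambda>x. mat_adj (G x l) *v f x)"
proof (rule Bochner_Integration.integrable_bound[of _ "\<lambda>x. C * norm (f x)"])
  note [measurable] = L2on_measurable[OF f]
  show "(\<lambda>x. mat_adj (G x l) *v f x) \<in> borel_measurable lborel" by measurable
  show "AE x in lborel. norm (mat_adj (G x l) *v f x) \<le> norm (C * norm (f x))"
    using G_bound C by simp
qed (use L2on_norm_integrable[OF f] in auto)

lemma T_add: "L2on a f \<Longrightarrow> L2on a g \<Longrightarrow> T (\<lambda>x. f x + g x) l = T f l + T g l"
  unfolding T_def by (simp add: mv.add_right T_integrable)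

lemma T_diff: "L2on a f \<Longrightarrow> L2on a g \<Longrightarrow> T (\<lambda>x. f x - g x) l = T f l - T g l"
  unfolding T_def by (simp add: mv.diff_right T_integrable)

lemma T_scale: "L2on a f \<Longrightarrow> T (\<lambda>x. c *s f x) l = c *s T f l"
  unfolding T_def matrix_vector_scale
  by (rule integral_bounded_linear[OF bounded_linear_vector_scale_right]) (rule T_integrable)

lemma T_meas [measurable]:
  assumes f: "L2on a f" shows "T f \<in> borel_measurable borel"
proof -
  note [measurable] = L2on_measurable[OF f]
  have "(\<lambda>z. G (snd z) (fst z)) \<in> borel_measurable (borel \<Otimes>\<^sub>M borel)"
    using measurable_compose[OF _ G_meas', of "\<lambda>z. (snd z, fst z)" "borel \<Otimes>\<^sub>M borel"] by simp
  then have [measurable]: "(\<lambda>z. G (snd z) (fst z)) \<in> borel_measurable (borel \<Otimes>\<^sub>M lborel)" by simp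
  have "(\<lambda>(l, x). mat_adj (G x l) *v f x) \<in> borel_measurable (borel \<Otimes>\<^sub>M lborel)"
    unfolding split_beta' by measurable
  from lborel.borel_measurable_lebesgue_integral[OF this] show ?thesis unfolding T_def[abs_def] .
qed

lemma T_bound:
  assumes f: "L2on a f" shows "norm (T f l) \<le> C * (sqrt (sqnorm f) * sqrt a)"
proof -
  have "norm (T f l) \<le> (LINT x|lborel. C * norm (f x))"
    unfolding T_def by (rule norm_integral_le) (use G_bound L2on_norm_integrable[OF f] in auto)
  also have "\<dots> \<le> C * (sqrt (sqnorm f) * sqrt a)" using L2on_L1_le[OF f a] C by (simp add: mult_left_mono)
  finally show ?thesis .
qed

lemma cinner_integrable:
  assumes f: "L2on a f" and g: "L2on a g" shows "integrable lborel (\<lambda>x. cinner (f x) (g x))"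
proof (rule Bochner_Integration.integrable_bound[OF L2on_inner_integrable[OF f g]])
  note [measurable] = L2on_measurable[OF f] L2on_measurable[OF g]
  show "(\<lambda>x. cinner (f x) (g x)) \<in> borel_measurable lborel" by measurable
qed (auto simp: norm_cinner)

lemma k_integrable1:
  assumes f: "L2on a f" shows "integrable lborel (\<lambda>x. cinner (f x) (k x t *v v))"
proof (rule Bochner_Integration.integrable_bound[of _ "\<lambda>x. D * norm (f x) * norm v"])
  note [measurable] = L2on_measurable[OF f]
  show "(\<lambda>x. cinner (f x) (k x t *v v)) \<in> borel_measurable lborel" by measurable
  show "AE x in lborel. norm (cinner (f x) (k x t *v v)) \<le> norm (D * norm (f x) * norm v)"
    using k_bound D by simp
qed (use L2on_norm_integrable[OF f] in auto)

lemma k_bound1: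
  assumes f: "L2on a f" shows "cmod (LINT x|lborel. cinner (f x) (k x t *v v)) \<le> D * (LINT x|lborel. norm (f x)) * norm v"
proof -
  have "cmod (LINT x|lborel. cinner (f x) (k x t *v v)) \<le> (LINT x|lborel. D * norm (f x) * norm v)"
    using L2on_norm_integrable[OF f] k_bound by (intro norm_integral_le) auto
  then show ?thesis by simp
qed

lemma k_integrable2:
  assumes f: "L2on a f" and g: "L2on a g" shows "integrable lborel (\<lambda>t. LINT x|lborel. cinner (f x) (k x t *v g t))"
proof (rule Bochner_Integration.integrable_bound[of _ "\<lambda>t. D * (LINT x|lborel. norm (f x)) * norm (g t)"])
  note [measurable] = L2on_measurable[OF f] L2on_measurable[OF g]
  have "(\<lambda>z. k (snd z) (fst z)) \<in> borel_measurable (borel \<Otimes>\<^sub>M borel)"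
    using measurable_compose[OF _ k_meas', of "\<lambda>z. (snd z, fst z)" "borel \<Otimes>\<^sub>M borel"] by simp
  then have [measurable]: "(\<lambda>z. k (snd z) (fst z)) \<in> borel_measurable (borel \<Otimes>\<^sub>M lborel)" by simp
  have "(\<lambda>(t, x). cinner (f x) (k x t *v g t)) \<in> borel_measurable (borel \<Otimes>\<^sub>M lborel)"
    unfolding split_beta' by measurable
  from lborel.borel_measurable_lebesgue_integral[OF this]
  show "(\<lambda>t. LINT x|lborel. cinner (f x) (k x t *v g t)) \<in> borel_measurable lborel" by simp
  have "0 \<le> (LINT x|lborel. norm (f x))" by simp
  then show "AE t in lborel. norm (LINT x|lborel. cinner (f x) (k x t *v g t)) \<le> norm (D * (LINT x|lborel. norm (f x)) * norm (g t))"
    using k_bound1[OF f] D by (auto simp: abs_mult)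
qed (use L2on_norm_integrable[OF g] in auto)

lemma S_add_left: "L2on a f \<Longrightarrow> L2on a g \<Longrightarrow> L2on a h \<Longrightarrow> S (\<lambda>x. f x + g x) h = S f h + S g h"
  unfolding S_def by (simp add: cin.add_left cinner_integrable k_integrable1 k_integrable2)

lemma S_add_right: "L2on a f \<Longrightarrow> L2on a g \<Longrightarrow> L2on a h \<Longrightarrow> S h (\<lambda>x. f x + g x) = S h f + S h g"
  unfolding S_def by (simp add: cin.add_right mv.add_right cinner_integrable k_integrable1 k_integrable2)

lemma S_scale_left: "S (\<lambda>x. c *s f x) h = cnj c * S f h"
  unfolding S_def by (simp add: cinner_scale_left distrib_left)

lemma S_scale_right: "S h (\<lambda>x. c *s f x) = c * S h f"
  unfolding S_def by (simp add: cinner_scale_right matrix_vector_scale distrib_left)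

lemma S_diff_left: "L2on a f \<Longrightarrow> L2on a g \<Longrightarrow> L2on a h \<Longrightarrow> S (\<lambda>x. f x - g x) h = S f h - S g h"
  unfolding S_def by (simp add: cin.diff_left cinner_integrable k_integrable1 k_integrable2)

lemma S_diff_right: "L2on a f \<Longrightarrow> L2on a g \<Longrightarrow> L2on a h \<Longrightarrow> S h (\<lambda>x. f x - g x) = S h f - S h g"
  unfolding S_def by (simp add: cin.diff_right mv.diff_right cinner_integrable k_integrable1 k_integrable2)

text \<open>The kernel part is bounded by \<open>D\<close> times the integrals of the two norms;
  each costs a factor \<open>sqrt a\<close> against the mean-square norm, whence
  \<open>D * a\<close>.\<close>

lemma S_bound:
  assumes f: "L2on a f" and g: "L2on a g"
  shows "cmod (S f g) \<le> (1 + D * a) * (sqrt (sqnorm f) * sqrt (sqnorm g))"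
proof -
  have "cmod (LINT x|lborel. cinner (f x) (g x)) \<le> (LINT x|lborel. norm (f x) * norm (g x))"
    using L2on_inner_integrable[OF f g] by (intro norm_integral_le norm_cinner)
  also have "\<dots> \<le> sqrt (sqnorm f) * sqrt (sqnorm g)" by (rule L2on_Cauchy_Schwarz[OF f g])
  finally have 1: "cmod (LINT x|lborel. cinner (f x) (g x)) \<le> sqrt (sqnorm f) * sqrt (sqnorm g)" .
  have "cmod (LINT t|lborel. LINT x|lborel. cinner (f x) (k x t *v g t)) \<le> (LINT t|lborel. D * (LINT x|lborel. norm (f x)) * norm (g t))"
    using L2on_norm_integrable[OF g] k_bound1[OF f] by (intro norm_integral_le) auto
  also have "\<dots> = D * ((LINT x|lborel. norm (f x)) * (LINT x|lborel. norm (g x)))" by simp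
  also have "\<dots> \<le> D * ((sqrt (sqnorm f) * sqrt a) * (sqrt (sqnorm g) * sqrt a))"
    using D a sqnorm_nonneg[of f] by (intro mult_left_mono mult_mono L2on_L1_le f g) auto
  also have "\<dots> = D * a * (sqrt (sqnorm f) * sqrt (sqnorm g))" using a by (simp add: mult_ac)
  finally show ?thesis unfolding S_def using 1 by (intro order.trans[OF norm_triangle_ineq]) (simp add: distrib_right)
qed

lemma q_add_left: "L2on a f \<Longrightarrow> L2on a g \<Longrightarrow> q (\<lambda>x. f x + g x) h l = q f h l + q g h l"
  unfolding q_def by (simp add: T_add cin.add_left)

lemma q_add_right: "L2on a f \<Longrightarrow> L2on a g \<Longrightarrow> q h (\<lambda>x. f x + g x) l = q h f l + q h g l"
  unfolding q_def by (simp add: T_add cin.add_right mv.add_right)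

lemma q_meas [measurable]: "L2on a f \<Longrightarrow> L2on a g \<Longrightarrow> q f g \<in> borel_measurable M"
  unfolding q_def[abs_def] by measurable

lemma q_nonneg: "0 \<le> Re (q f f l)" and q_real: "q f f l = of_real (Re (q f f l))"
  using \<Phi>_pos[of l] pos_semidef_form_real[OF \<Phi>_pos] by (auto simp: pos_semidef_def q_def)

lemma q_add_le:
  assumes "L2on a f" "L2on a g" "e > 0"
  shows "Re (q (\<lambda>x. f x + g x) (\<lambda>x. f x + g x) l) \<le> (1 + e) * Re (q f f l) + (1 + 1 / e) * Re (q g g l)"
  unfolding q_def T_add[OF assms(1,2)] by (rule pos_semidef_add_le[OF \<Phi>_pos assms(3)])

section \<open>Extension from generators to all square integrable functions\<close>

context
  assumes generators: "\<And>x t u v. 0 \<le> x \<Longrightarrow> x \<le> a \<Longrightarrow> 0 \<le> t \<Longrightarrow> t \<le> a \<Longrightarrow>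
    has_bochner_integral M (q (\<lambda>s. indicator {0..x} s *\<^sub>R u) (\<lambda>s. indicator {0..t} s *\<^sub>R v))
      (S (\<lambda>s. indicator {0..x} s *\<^sub>R u) (\<lambda>s. indicator {0..t} s *\<^sub>R v))"
begin

lemma stepf_form:
  assumes "stepf a f" "stepf a g" shows "has_bochner_integral M (q f g) (S f g)"
  using assms(1)
proof (induction rule: stepf.induct)
  case (gen x u)
  have f: "L2on a (\<lambda>s. indicator {0..x} s *\<^sub>R u)" using gen by (intro stepf_L2on stepf.gen)
  show ?case using assms(2)
  proof (induction rule: stepf.induct)
    case (gen t v) then show ?case by (intro generators \<open>0 \<le> x\<close> \<open>x \<le> a\<close>)
  next
    case (add g h)
    have eq: "q (\<lambda>s. indicator {0..x} s *\<^sub>R u) (\<lambda>s. g s + h s) = (\<lambda>l. q (\<lambda>s. indicator {0..x} s *\<^sub>R u) g l + q (\<lambda>s. indicator {0..x} s *\<^sub>R u) h l)"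
      using add by (intro ext q_add_right stepf_L2on)
    show ?case unfolding eq S_add_right[OF stepf_L2on[OF add(1)] stepf_L2on[OF add(2)] f]
      by (intro has_bochner_integral_add add)
  qed
next
  case (add f h)
  have eq: "q (\<lambda>s. f s + h s) g = (\<lambda>l. q f g l + q h g l)"
    using add by (intro ext q_add_left stepf_L2on)
  show ?case unfolding eq S_add_left[OF stepf_L2on[OF add(1)] stepf_L2on[OF add(2)] stepf_L2on[OF assms(2)]]
    by (intro has_bochner_integral_add add)
qed

text \<open>The a priori bound for Fatou's lemma: on step functions the integral of \<open>q\<close>
  equals \<open>S\<close>, which is bounded by the mean-square norm.\<close>

lemma stepf_nn_integral:
  assumes s: "stepf a s"
  shows "(\<integral>\<^sup>+l. ennreal (Re (q s s l)) \<partial>M) \<le> ennreal ((1 + D * a) * sqnorm s)"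
proof -
  have i: "has_bochner_integral M (\<lambda>l. Re (q s s l)) (Re (S s s))"
    by (rule has_bochner_integral_Re[OF stepf_form[OF s s]])
  then have "(\<integral>\<^sup>+l. ennreal (Re (q s s l)) \<partial>M) = ennreal (Re (S s s))"
    by (subst nn_integral_eq_integral) (auto simp: q_nonneg has_bochner_integral_iff)
  also have "Re (S s s) \<le> (1 + D * a) * sqnorm s"
    using S_bound[OF stepf_L2on[OF s] stepf_L2on[OF s]] complex_Re_le_cmod[of "S s s"]
    by (simp add: sqnorm_nonneg)
  finally show ?thesis by (simp add: ennreal_leI)
qed

text \<open>By Fatou's lemma, the form of the transforms of the remainders \<open>f - s\<^sub>j\<close> is bounded by their
  square norm. With this, the inequality \<open>q(u + v) \<le> (1 + e) q(u) + (1 + 1/e) q(v)\<close> squeezes the form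
  of \<open>f\<close> between limits of those of \<open>s\<^sub>j\<close>, without recourse to a square root of \<open>\<Phi>\<close>.\<close>

lemma quadratic_form:
  assumes f: "L2on a f" shows "has_bochner_integral M (q f f) (S f f)"
proof -
  obtain s where s: "\<And>j::nat. stepf a (s j)" and lim: "(\<lambda>j. sqnorm (\<lambda>x. f x - s j x)) \<longlonglongrightarrow> 0"
    using stepf_sequence[OF f a] by blast
  note sL = stepf_L2on[OF s]
  let ?d = "\<lambda>j. sqnorm (\<lambda>x. f x - s j x)"
  let ?r = "\<lambda>j x. f x - s j x"
  have rL: "L2on a (?r j)" for j by (intro L2on_diff f sL)
  define K where "K = 1 + D * a"
  have K: "K \<ge> 0" using D a by (simp add: K_def)
  \<comment> \<open>On a bounded interval mean-square convergence implies convergence of integrals,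
    so the transforms converge at every \<open>l\<close>, as Fatou's lemma requires.\<close>
  have T_lim: "(\<lambda>j. T (s j) l) \<longlonglongrightarrow> T f l" for l
  proof (rule tendsto_norm_bound)
    have "(\<lambda>j. C * (sqrt (?d j) * sqrt a)) \<longlonglongrightarrow> C * (sqrt 0 * sqrt a)"
      by (intro tendsto_intros lim)
    then show "(\<lambda>j. C * (sqrt (?d j) * sqrt a)) \<longlonglongrightarrow> 0" by simp
    show "norm (T (s j) l - T f l) \<le> C * (sqrt (?d j) * sqrt a)" for j
      using T_bound[OF rL, of j l] by (simp add: T_diff[OF f sL] norm_minus_commute)
  qed
  \<comment> \<open>For fixed \<open>i\<close> the differences of \<open>s j\<close> and
    \<open>s i\<close> are step functions whose forms tend pointwise to that of
    \<open>f - s i\<close> as \<open>j\<close> grows.\<close>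
  have fatou: "(\<integral>\<^sup>+l. ennreal (Re (q (?r i) (?r i) l)) \<partial>M) \<le> ennreal (K * (2 * ?d i))" for i
  proof -
    let ?w = "\<lambda>j x. s j x - s i x"
    have wL: "L2on a (?w j)" for j by (intro L2on_diff sL)
    have "(\<lambda>j. Re (q (?w j) (?w j) l)) \<longlonglongrightarrow> Re (q (?r i) (?r i) l)" for l
      unfolding q_def T_diff[OF sL sL] T_diff[OF f sL]
      by (intro tendsto_intros cin.tendsto mv.tendsto T_lim)
    then have "(\<integral>\<^sup>+l. ennreal (Re (q (?r i) (?r i) l)) \<partial>M) = (\<integral>\<^sup>+l. liminf (\<lambda>j. ennreal (Re (q (?w j) (?w j) l))) \<partial>M)"
      by (intro nn_integral_cong lim_imp_Liminf[symmetric] tendsto_ennrealI) auto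
    also have "\<dots> \<le> liminf (\<lambda>j. \<integral>\<^sup>+l. ennreal (Re (q (?w j) (?w j) l)) \<partial>M)"
      using wL by (intro nn_integral_liminf) measurable
    also have "\<dots> \<le> liminf (\<lambda>j. ennreal (K * (2 * ?d j + 2 * ?d i)))"
    proof (rule Liminf_mono, rule always_eventually, rule allI)
      fix j
      have "(\<integral>\<^sup>+l. ennreal (Re (q (?w j) (?w j) l)) \<partial>M) \<le> ennreal (K * sqnorm (?w j))"
        unfolding K_def by (intro stepf_nn_integral stepf_diff s)
      also have "sqnorm (?w j) \<le> 2 * ?d j + 2 * ?d i"
        using sqnorm_diff_triangle[OF sL f sL, of j i] by (simp add: sqnorm_minus_commute[of f])
      finally show "(\<integral>\<^sup>+l. ennreal (Re (q (?w j) (?w j) l)) \<partial>M) \<le> ennreal (K * (2 * ?d j + 2 * ?d i))"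
        using K by (simp add: ennreal_leI mult_left_mono)
    qed
    also have "\<dots> = ennreal (K * (2 * 0 + 2 * ?d i))"
      by (intro lim_imp_Liminf tendsto_ennrealI tendsto_intros lim) auto
    finally show ?thesis by simp
  qed
  have r_int: "integrable M (\<lambda>l. Re (q (?r i) (?r i) l))" for i
    using rL[of i] fatou[of i] q_nonneg by (intro integrableI_nonneg) (auto intro: le_less_trans)
  have r_le: "(LINT l|M. Re (q (?r i) (?r i) l)) \<le> K * (2 * ?d i)" for i
  proof -
    have nn: "0 \<le> K * (2 * ?d i)" using K sqnorm_nonneg[of "?r i"] by simp
    have "ennreal (LINT l|M. Re (q (?r i) (?r i) l)) \<le> ennreal (K * (2 * ?d i))"
      using fatou[of i] nn_integral_eq_integral[OF r_int[of i]] q_nonneg by simp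
    then show ?thesis using nn by (simp only: ennreal_le_iff)
  qed
  have s_int: "integrable M (\<lambda>l. Re (q (s i) (s i) l))" and s_val: "(LINT l|M. Re (q (s i) (s i) l)) = Re (S (s i) (s i))" for i
    using has_bochner_integral_Re[OF stepf_form[OF s s]] by (auto simp: has_bochner_integral_iff)
  have upper: "Re (q f f l) \<le> (1 + e) * Re (q (s i) (s i) l) + (1 + 1 / e) * Re (q (?r i) (?r i) l)" if "e > 0" for e i l
    using q_add_le[OF sL[of i] rL[of i] that, of l] by simp
  have lower: "Re (q (s i) (s i) l) \<le> (1 + e) * Re (q f f l) + (1 + 1 / e) * Re (q (?r i) (?r i) l)" if "e > 0" for e i l
  proof -
    have "T (\<lambda>x. - ?r i x) l = - T (?r i) l"
      unfolding T_def by (simp only: mv.minus_right Bochner_Integration.integral_minus)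
    then have "q (\<lambda>x. - ?r i x) (\<lambda>x. - ?r i x) l = q (?r i) (?r i) l"
      by (simp only: q_def mv.minus_right cin.minus_left cin.minus_right minus_minus)
    then show ?thesis using q_add_le[OF f L2on_uminus[OF rL[of i]] that, of l] by simp
  qed
  \<comment> \<open>One approximant with weight \<open>e = 1\<close> already gives an integrable
    majorant.\<close>
  have f_int: "integrable M (\<lambda>l. Re (q f f l))"
  proof (rule Bochner_Integration.integrable_bound)
    show "integrable M (\<lambda>l. (1 + 1) * Re (q (s 0) (s 0) l) + (1 + 1 / 1) * Re (q (?r 0) (?r 0) l))"
      by (intro Bochner_Integration.integrable_add integrable_mult_right s_int r_int)
    show "AE l in M. norm (Re (q f f l)) \<le> norm ((1 + 1) * Re (q (s 0) (s 0) l) + (1 + 1 / 1) * Re (q (?r 0) (?r 0) l))"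
    proof (rule AE_I2)
      fix l
      show "norm (Re (q f f l)) \<le> norm ((1 + 1) * Re (q (s 0) (s 0) l) + (1 + 1 / 1) * Re (q (?r 0) (?r 0) l))"
        using upper[of 1 l 0] q_nonneg[of f l] by (simp only: real_norm_def) linarith
    qed
  qed (use f in measurable)
  define P where "P = (LINT l|M. Re (q f f l))"
  have P: "P \<ge> 0" unfolding P_def by (simp add: q_nonneg)
  have S_lim: "(\<lambda>i. S (s i) (s i)) \<longlonglongrightarrow> S f f"
  proof (rule tendsto_norm_bound)
    let ?B = "\<lambda>i. K * (sqrt (sqnorm f) * sqrt (?d i)) + K * (sqrt (?d i) * sqrt (sqnorm f)) + K * (sqrt (?d i) * sqrt (?d i))"
    have "?B \<longlonglongrightarrow> K * (sqrt (sqnorm f) * sqrt 0) + K * (sqrt 0 * sqrt (sqnorm f)) + K * (sqrt 0 * sqrt 0)"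
      by (intro tendsto_intros lim)
    then show "?B \<longlonglongrightarrow> 0" by simp
    show "norm (S (s i) (s i) - S f f) \<le> ?B i" for i
    proof -
      have eq: "S (s i) (s i) - S f f = - S f (?r i) - S (?r i) f + S (?r i) (?r i)"
        by (simp add: S_diff_left S_diff_right f sL rL)
      have "cmod (- S f (?r i) - S (?r i) f + S (?r i) (?r i)) \<le> cmod (S f (?r i)) + cmod (S (?r i) f) + cmod (S (?r i) (?r i))"
        using norm_triangle_ineq[of "- S f (?r i) - S (?r i) f" "S (?r i) (?r i)"] norm_triangle_ineq4[of "- S f (?r i)" "S (?r i) f"]
        by simp
      also have "\<dots> \<le> ?B i"
        unfolding K_def by (rule add_mono[OF add_mono[OF S_bound[OF f rL] S_bound[OF rL f]] S_bound[OF rL rL]])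
      finally show ?thesis unfolding eq .
    qed
  qed
  define X where "X = Re (S f f)"
  have X_lim: "(\<lambda>i. Re (S (s i) (s i))) \<longlonglongrightarrow> X" unfolding X_def by (intro tendsto_intros S_lim)
  \<comment> \<open>The values on step functions are integrals of real functions, so their limit
    \<open>S f f\<close> is real.\<close>
  have "Im (S (s i) (s i)) = 0" for i
  proof -
    have "Im (q (s i) (s i) l) = 0" for l by (subst q_real) simp
    then show ?thesis using has_bochner_integral_Im[OF stepf_form[OF s s], of i i] by (simp add: has_bochner_integral_iff)
  qed
  then have "(\<lambda>i. 0) \<longlonglongrightarrow> Im (S f f)" using tendsto_Im[OF S_lim] by simp
  then have Im0: "Im (S f f) = 0" by (simp add: LIMSEQ_const_iff)
  \<comment> \<open>With \<open>e\<close> fixed, \<open>i\<close> tends to infinity, so that the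
    remainder vanishes in spite of the factor \<open>1 / e\<close>; only afterwards does
    \<open>eps\<close> let \<open>e\<close> tend to 0.\<close>
  have up: "P \<le> (1 + e) * X" if e: "e > 0" for e
  proof (rule LIMSEQ_le_const)
    have "(\<lambda>i. (1 + e) * Re (S (s i) (s i)) + (1 + 1 / e) * (K * (2 * ?d i))) \<longlonglongrightarrow> (1 + e) * X + (1 + 1 / e) * (K * (2 * 0))"
      by (intro tendsto_intros X_lim lim)
    then show "(\<lambda>i. (1 + e) * Re (S (s i) (s i)) + (1 + 1 / e) * (K * (2 * ?d i))) \<longlonglongrightarrow> (1 + e) * X" by simp
    have "P \<le> (1 + e) * Re (S (s i) (s i)) + (1 + 1 / e) * (K * (2 * ?d i))" for i
    proof -
      have "P \<le> (LINT l|M. (1 + e) * Re (q (s i) (s i) l) + (1 + 1 / e) * Re (q (?r i) (?r i) l))"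
        unfolding P_def by (intro integral_mono f_int Bochner_Integration.integrable_add integrable_mult_right s_int r_int upper e)
      also have "\<dots> = (1 + e) * Re (S (s i) (s i)) + (1 + 1 / e) * (LINT l|M. Re (q (?r i) (?r i) l))"
        using s_int r_int by (simp add: s_val)
      also have "\<dots> \<le> (1 + e) * Re (S (s i) (s i)) + (1 + 1 / e) * (K * (2 * ?d i))"
        using e by (intro add_left_mono mult_left_mono r_le) auto
      finally show ?thesis .
    qed
    then show "\<exists>N. \<forall>i\<ge>N. P \<le> (1 + e) * Re (S (s i) (s i)) + (1 + 1 / e) * (K * (2 * ?d i))" by blast
  qed
  have lo: "X \<le> (1 + e) * P" if e: "e > 0" for e
  proof (rule LIMSEQ_le[OF X_lim])
    have "(\<lambda>i. (1 + e) * P + (1 + 1 / e) * (K * (2 * ?d i))) \<longlonglongrightarrow> (1 + e) * P + (1 + 1 / e) * (K * (2 * 0))"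
      by (intro tendsto_intros lim)
    then show "(\<lambda>i. (1 + e) * P + (1 + 1 / e) * (K * (2 * ?d i))) \<longlonglongrightarrow> (1 + e) * P" by simp
    have "Re (S (s i) (s i)) \<le> (1 + e) * P + (1 + 1 / e) * (K * (2 * ?d i))" for i
    proof -
      have "Re (S (s i) (s i)) \<le> (LINT l|M. (1 + e) * Re (q f f l) + (1 + 1 / e) * Re (q (?r i) (?r i) l))"
        unfolding s_val[symmetric] by (intro integral_mono f_int Bochner_Integration.integrable_add integrable_mult_right s_int r_int lower e)
      also have "\<dots> = (1 + e) * P + (1 + 1 / e) * (LINT l|M. Re (q (?r i) (?r i) l))"
        using f_int r_int by (simp add: P_def)
      also have "\<dots> \<le> (1 + e) * P + (1 + 1 / e) * (K * (2 * ?d i))"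
        using e by (intro add_left_mono mult_left_mono r_le) auto
      finally show ?thesis .
    qed
    then show "\<exists>N. \<forall>i\<ge>N. Re (S (s i) (s i)) \<le> (1 + e) * P + (1 + 1 / e) * (K * (2 * ?d i))" by blast
  qed
  have eps: "u \<le> v" if "\<And>e. e > 0 \<Longrightarrow> u \<le> (1 + e) * v" for u v :: real
  proof (rule tendsto_lowerbound)
    have "((\<lambda>e. (1 + e) * v) \<longlongrightarrow> (1 + 0) * v) (at_right 0)" by (intro tendsto_intros)
    then show "((\<lambda>e. (1 + e) * v) \<longlongrightarrow> v) (at_right 0)" by simp
    show "\<forall>\<^sub>F e in at_right 0. u \<le> (1 + e) * v" using that by (auto simp: eventually_at_right_field intro: exI[of _ 1])
  qed auto
  have "P = X" using eps[OF up] eps[OF lo] by simp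
  then have "has_bochner_integral M (\<lambda>l. Re (q f f l)) X" using f_int by (simp add: has_bochner_integral_iff P_def)
  from has_bochner_integral_of_real[OF this]
  have "has_bochner_integral M (\<lambda>l. complex_of_real (Re (q f f l))) (complex_of_real X)" .
  moreover have "complex_of_real X = S f f" using Im0 by (simp add: X_def complex_eq_iff)
  ultimately show ?thesis unfolding q_real[symmetric] by simp
qed

theorem sesquilinear_form:
  assumes f: "L2on a f" and g: "L2on a g" shows "has_bochner_integral M (q f g) (S f g)"
proof -
  let ?p = "\<lambda>x. f x + g x" and ?m = "\<lambda>x. f x - g x" and ?ip = "\<lambda>x. f x + \<i> *s g x" and ?im = "\<lambda>x. f x - \<i> *s g x"
  have ig: "L2on a (\<lambda>x. \<i> *s g x)" by (rule L2on_scale[OF g])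
  have L: "L2on a ?p" "L2on a ?m" "L2on a ?ip" "L2on a ?im" by (intro L2on_add L2on_diff f g ig)+
  have q: "q f g = (\<lambda>l. (q ?p ?p l - q ?m ?m l - \<i> * q ?ip ?ip l + \<i> * q ?im ?im l) / 4)"
    unfolding q_def T_add[OF f g] T_diff[OF f g] T_add[OF f ig] T_diff[OF f ig] T_scale[OF g]
    by (intro ext polarization)
  have S: "S f g = (S ?p ?p - S ?m ?m - \<i> * S ?ip ?ip + \<i> * S ?im ?im) / 4"
    by (simp add: S_add_left S_add_right S_diff_left S_diff_right L f g ig S_scale_left S_scale_right algebra_simps)
  show ?thesis unfolding q S
    by (intro has_bochner_integral_divide_zero has_bochner_integral_add has_bochner_integral_diff
        has_bochner_integral_mult_right quadratic_form L)
qed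

end
end

subsection \<open>Kernels with a jump on the diagonal\<close>

text \<open>Continuity is demanded at the single point \<open>x\<close>, because the integrands to
  which this is applied jump where they meet the diagonal.\<close>

lemma integral_upto_has_vector_derivative:
  fixes f :: "real \<Rightarrow> 'b::euclidean_space"
  assumes int: "\<And>b. set_integrable lborel {0..b} f" and x: "0 \<le> x" and cont: "continuous (at x within {0..}) f"
  shows "((\<lambda>u. LINT y:{0..u}|lborel. f y) has_vector_derivative f x) (at x within {0..})"
proof -
  have eq: "(LINT y:{0..u}|lborel. f y) = integral {0..u} f" for u
    by (rule set_borel_integral_eq_integral(2)[OF int])
  have "f integrable_on {0..x + 1}" by (rule set_borel_integral_eq_integral(1)[OF int])
  then have "((\<lambda>u. integral {0..u} f) has_vector_derivative f x) (at x within ({0..x + 1} - {}))"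
    using x by (intro integral_has_vector_derivative_continuous_at)
      (auto intro: continuous_within_subset[OF cont])
  then have "((\<lambda>u. integral {0..u} f) has_vector_derivative f x) (at x within {0..x + 1})" by simp
  moreover have "at x within {0..x + 1} = at x within {0..}"
    by (rule at_within_nhd[of x "{..<x + 1}"]) auto
  ultimately show ?thesis by (simp add: eq)
qed

text \<open>Continuity up to the diagonal on each side gives boundedness on squares by compactness,
  although the two kernels may differ on the diagonal.\<close>

locale wedge =
  fixes Fl Fu :: "real \<Rightarrow> real \<Rightarrow> 'b::euclidean_space"
  assumes Fl: "continuous_on {(x, t). 0 \<le> t \<and> t \<le> x} (\<lambda>(x, t). Fl x t)"
    and Fu: "continuous_on {(x, t). 0 \<le> x \<and> x \<le> t} (\<lambda>(x, t). Fu x t)"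
begin

text \<open>The value on the diagonal is immaterial.\<close>

definition \<kappa> :: "real \<Rightarrow> real \<Rightarrow> 'b" where
  "\<kappa> x t = (if 0 \<le> t \<and> t < x then Fl x t else if 0 \<le> x \<and> x \<le> t then Fu x t else 0)"

lemma closed_wedges: "closed {(x, t). 0 \<le> t \<and> t \<le> (x::real)}" "closed {(x, t). 0 \<le> x \<and> x \<le> (t::real)}"
  unfolding split_beta' by (intro closed_Collect_conj closed_Collect_le continuous_intros)+

lemma \<kappa>_meas [measurable]: "(\<lambda>z. \<kappa> (fst z) (snd z)) \<in> borel_measurable borel"
proof -
  let ?L = "{(x, t). 0 \<le> t \<and> t \<le> (x::real)}" and ?U = "{(x, t). 0 \<le> x \<and> x \<le> (t::real)}"
  have s: "{z::real \<times> real. snd z < fst z} \<in> sets borel"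
    by (intro borel_open open_Collect_less continuous_intros)
  have m: "(\<lambda>z. indicator ?L z *\<^sub>R (\<lambda>(x, t). Fl x t) z) \<in> borel_measurable borel"
    "(\<lambda>z. indicator ?U z *\<^sub>R (\<lambda>(x, t). Fu x t) z) \<in> borel_measurable borel"
    using closed_wedges by (auto intro!: borel_measurable_continuous_on_indicator Fl Fu borel_closed)
  have "(\<lambda>z. indicator {z. snd z < fst z} z *\<^sub>R (indicator ?L z *\<^sub>R (\<lambda>(x, t). Fl x t) z)
      + indicator ?U z *\<^sub>R (\<lambda>(x, t). Fu x t) z) \<in> borel_measurable borel"
    by (rule borel_measurable_add[OF borel_measurable_scaleR[OF borel_measurable_indicator[OF s] m(1)] m(2)])
  moreover have "(\<lambda>z. indicator {z. snd z < fst z} z *\<^sub>R (indicator ?L z *\<^sub>R (\<lambda>(x, t). Fl x t) z)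
      + indicator ?U z *\<^sub>R (\<lambda>(x, t). Fu x t) z) = (\<lambda>z. \<kappa> (fst z) (snd z))"
    by (auto simp: fun_eq_iff \<kappa>_def indicator_def)
  ultimately show ?thesis by simp
qed

lemma \<kappa>_meas1 [measurable]: "(\<lambda>y. \<kappa> y t) \<in> borel_measurable borel"
  using measurable_compose[OF _ \<kappa>_meas, of "\<lambda>y. (y, t)" borel] by (simp add: borel_prod[symmetric])

lemma \<kappa>_bounded: obtains D where "0 \<le> D" "\<And>x t. x \<le> a \<Longrightarrow> t \<le> a \<Longrightarrow> norm (\<kappa> x t) \<le> D"
proof -
  let ?L = "{(x, t). 0 \<le> t \<and> t \<le> (x::real)}" and ?U = "{(x, t). 0 \<le> x \<and> x \<le> (t::real)}"
  let ?Q = "cbox (0, 0) (a, a)"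
  have "compact (?L \<inter> ?Q)" "compact (?U \<inter> ?Q)" using closed_wedges by (auto intro: closed_Int_compact)
  then have "bounded ((\<lambda>(x, t). Fl x t) ` (?L \<inter> ?Q))" "bounded ((\<lambda>(x, t). Fu x t) ` (?U \<inter> ?Q))"
    by (auto intro!: compact_imp_bounded compact_continuous_image continuous_on_subset[OF Fl] continuous_on_subset[OF Fu])
  then obtain D1 D2 where D1: "\<forall>y\<in>(\<lambda>(x, t). Fl x t) ` (?L \<inter> ?Q). norm y \<le> D1"
    and D2: "\<forall>y\<in>(\<lambda>(x, t). Fu x t) ` (?U \<inter> ?Q). norm y \<le> D2"
    unfolding bounded_iff by (elim exE)
  have "norm (\<kappa> x t) \<le> \<bar>D1\<bar> + \<bar>D2\<bar>" if "x \<le> a" "t \<le> a" for x t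
  proof -
    have Q: "(x, t) \<in> ?Q" if "0 \<le> x" "0 \<le> t" using that \<open>x \<le> a\<close> \<open>t \<le> a\<close> by (simp add: cbox_Pair_eq)
    consider "0 \<le> t" "t < x" | "\<not> (0 \<le> t \<and> t < x)" "0 \<le> x" "x \<le> t" | "\<kappa> x t = 0" by (force simp: \<kappa>_def)
    then show ?thesis
    proof cases
      case 1
      then have "norm (Fl x t) \<le> D1" using Q by (force intro: bspec[OF D1])
      then show ?thesis using 1 by (simp add: \<kappa>_def)
    next
      case 2
      then have "norm (Fu x t) \<le> D2" using Q by (force intro: bspec[OF D2])
      then show ?thesis using 2 by (simp add: \<kappa>_def)
    qed simp
  qed
  then show ?thesis using that[of "\<bar>D1\<bar> + \<bar>D2\<bar>"] by simp
qed

lemma \<kappa>_tendsto: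
  fixes X T :: "'x \<Rightarrow> real"
  assumes X: "(X \<longlongrightarrow> x) F" and T: "(T \<longlongrightarrow> t) F" and nn: "\<And>n. 0 \<le> X n" "\<And>n. 0 \<le> T n" "0 \<le> x" "0 \<le> t" and ne: "x \<noteq> t"
  shows "((\<lambda>n. \<kappa> (X n) (T n)) \<longlongrightarrow> \<kappa> x t) F"
proof -
  have XT: "((\<lambda>n. (X n, T n)) \<longlongrightarrow> (x, t)) F" by (intro tendsto_intros X T)
  have d: "((\<lambda>n. X n - T n) \<longlongrightarrow> x - t) F" by (intro tendsto_intros X T)
  show ?thesis
  proof (cases "t < x")
    case True
    then have ev: "\<forall>\<^sub>F n in F. 0 < X n - T n" using order_tendstoD(1)[OF d, of 0] by simp
    have "((\<lambda>n. (\<lambda>(x, t). Fl x t) (X n, T n)) \<longlongrightarrow> (\<lambda>(x, t). Fl x t) (x, t)) F"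
      by (rule continuous_on_tendsto_compose[OF Fl XT]) (use nn True ev in \<open>auto elim!: eventually_mono\<close>)
    moreover have "\<forall>\<^sub>F n in F. (\<lambda>(x, t). Fl x t) (X n, T n) = \<kappa> (X n) (T n)"
      using ev by eventually_elim (use nn in \<open>auto simp: \<kappa>_def\<close>)
    ultimately have "((\<lambda>n. \<kappa> (X n) (T n)) \<longlongrightarrow> (\<lambda>(x, t). Fl x t) (x, t)) F" by (rule Lim_transform_eventually)
    moreover have "(\<lambda>(x, t). Fl x t) (x, t) = \<kappa> x t" using True nn by (simp add: \<kappa>_def)
    ultimately show ?thesis by (simp only:)
  next
    case False
    then have ev: "\<forall>\<^sub>F n in F. X n - T n < 0" using order_tendstoD(2)[OF d, of 0] ne by simp
    have "((\<lambda>n. (\<lambda>(x, t). Fu x t) (X n, T n)) \<longlongrightarrow> (\<lambda>(x, t). Fu x t) (x, t)) F"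
      by (rule continuous_on_tendsto_compose[OF Fu XT]) (use nn False ev in \<open>auto elim!: eventually_mono\<close>)
    moreover have "\<forall>\<^sub>F n in F. (\<lambda>(x, t). Fu x t) (X n, T n) = \<kappa> (X n) (T n)"
      using ev by eventually_elim (use nn in \<open>auto simp: \<kappa>_def\<close>)
    ultimately have "((\<lambda>n. \<kappa> (X n) (T n)) \<longlongrightarrow> (\<lambda>(x, t). Fu x t) (x, t)) F" by (rule Lim_transform_eventually)
    moreover have "(\<lambda>(x, t). Fu x t) (x, t) = \<kappa> x t" using False nn by (simp add: \<kappa>_def)
    ultimately show ?thesis by (simp only:)
  qed
qed

lemma \<kappa>_set_integrable: "set_integrable lborel {0..x} (\<lambda>y. \<kappa> y t)"
proof -
  obtain D where D: "0 \<le> D" "\<And>y s. y \<le> max x t \<Longrightarrow> s \<le> max x t \<Longrightarrow> norm (\<kappa> y s) \<le> D" using \<kappa>_bounded by blast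
  show ?thesis unfolding set_integrable_def
  proof (rule Bochner_Integration.integrable_bound[of _ "\<lambda>y. indicator {0..x} y *\<^sub>R D"])
    show "integrable lborel (\<lambda>y. indicator {0..x} y *\<^sub>R D)"
      by (intro integrable_scaleR_left integrable_real_indicator) (auto simp: emeasure_lborel_Icc_eq)
    show "AE y in lborel. norm (indicator {0..x} y *\<^sub>R \<kappa> y t) \<le> norm (indicator {0..x} y *\<^sub>R D)"
      using D by (auto simp: indicator_def intro!: AE_I2)
  qed measurable
qed

text \<open>Primitives of \<open>\<kappa>\<close>, in the first variable and then in both. The first
  variable is integrated first because \<open>continuous_mixed_derivative\<close> differentiates in
  \<open>t\<close> before \<open>x\<close>.\<close>

definition \<kappa>1 :: "real \<Rightarrow> real \<Rightarrow> 'b" where "\<kappa>1 x t = (LINT y:{0..x}|lborel. \<kappa> y t)"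
definition \<kappa>2 :: "real \<Rightarrow> real \<Rightarrow> 'b" where "\<kappa>2 x t = (LINT w:{0..t}|lborel. \<kappa>1 x w)"

text \<open>Integration removes the jump: the integrand converges for every \<open>y\<close> except
  possibly \<open>y = x\<close>, where the interval ends, and \<open>y = t\<close>, where the kernel
  jumps. Boundedness on squares gives domination.\<close>

lemma \<kappa>1_continuous: "continuous_on ({0..} \<times> {0..}) (\<lambda>(x, t). \<kappa>1 x t)"
proof (rule continuous_on_sequentiallyI)
  fix u and z :: "real \<times> real"
  assume u: "\<forall>n. u n \<in> {0..} \<times> {0..}" and z: "z \<in> {0..} \<times> {0..}" and lim: "u \<longlonglongrightarrow> z"
  obtain x t where xt: "z = (x, t)" by fastforce
  define X where "X n = fst (u n)" for n
  define T where "T n = snd (u n)" for n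
  have uXT: "u n = (X n, T n)" for n by (simp add: X_def T_def)
  have X: "X \<longlonglongrightarrow> x" and T: "T \<longlonglongrightarrow> t" using tendsto_fst[OF lim] tendsto_snd[OF lim] by (simp_all add: X_def[abs_def] T_def[abs_def] xt)
  have nn: "0 \<le> X n" "0 \<le> T n" "0 \<le> x" "0 \<le> t" for n using u z by (auto simp: X_def T_def xt mem_Times_iff)
  obtain A1 A2 where A: "\<And>n. norm (X n) \<le> A1" "\<And>n. norm (T n) \<le> A2"
    using X T by (meson BseqE convergentI convergent_imp_Bseq)
  define A where "A = max A1 A2"
  have XA: "X n \<le> A" "T n \<le> A" for n using A[of n] by (auto simp: A_def)
  obtain D where D: "0 \<le> D" "\<And>y s. y \<le> A \<Longrightarrow> s \<le> A \<Longrightarrow> norm (\<kappa> y s) \<le> D" using \<kappa>_bounded by blast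
  have "(\<lambda>n. LINT y|lborel. indicator {0..X n} y *\<^sub>R \<kappa> y (T n)) \<longlonglongrightarrow> (LINT y|lborel. indicator {0..x} y *\<^sub>R \<kappa> y t)"
  proof (rule integral_dominated_convergence[where w = "\<lambda>y. indicator {0..A} y *\<^sub>R D"])
    show "integrable lborel (\<lambda>y. indicator {0..A} y *\<^sub>R D)"
      by (intro integrable_scaleR_left integrable_real_indicator) (auto simp: emeasure_lborel_Icc_eq)
    show "AE y in lborel. norm (indicator {0..X n} y *\<^sub>R \<kappa> y (T n)) \<le> indicator {0..A} y *\<^sub>R D" for n
      using D XA[of n] by (auto simp: indicator_def intro!: AE_I2)
    have "(\<lambda>n. indicator {0..X n} y *\<^sub>R \<kappa> y (T n)) \<longlonglongrightarrow> indicator {0..x} y *\<^sub>R \<kappa> y t" if y: "y \<noteq> x" "y \<noteq> t" for y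
    proof (cases "0 \<le> y \<and> y < x")
      case True
      have "(\<lambda>n. \<kappa> y (T n)) \<longlonglongrightarrow> \<kappa> y t" using True nn y T by (intro \<kappa>_tendsto tendsto_const) auto
      moreover have "\<forall>\<^sub>F n in sequentially. y < X n" using True order_tendstoD(1)[OF X] by blast
      then have "\<forall>\<^sub>F n in sequentially. \<kappa> y (T n) = indicator {0..X n} y *\<^sub>R \<kappa> y (T n)"
        by eventually_elim (use True in \<open>auto simp: indicator_def\<close>)
      ultimately have "(\<lambda>n. indicator {0..X n} y *\<^sub>R \<kappa> y (T n)) \<longlonglongrightarrow> \<kappa> y t" by (rule Lim_transform_eventually)
      then show ?thesis using True by (simp add: indicator_def)
    next
      case False
      have "\<forall>\<^sub>F n in sequentially. indicator {0..X n} y *\<^sub>R \<kappa> y (T n) = 0"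
      proof (cases "0 \<le> y")
        case True
        then have "x < y" using False y by simp
        then have "\<forall>\<^sub>F n in sequentially. X n < y" using order_tendstoD(2)[OF X] by blast
        then show ?thesis by eventually_elim (auto simp: indicator_def)
      qed (auto simp: indicator_def)
      moreover have "indicator {0..x} y *\<^sub>R \<kappa> y t = 0" using False y by (auto simp: indicator_def)
      ultimately show ?thesis by (simp only: tendsto_eventually)
    qed
    then show "AE y in lborel. (\<lambda>n. indicator {0..X n} y *\<^sub>R \<kappa> y (T n)) \<longlonglongrightarrow> indicator {0..x} y *\<^sub>R \<kappa> y t"
      using AE_lborel_singleton[of x] AE_lborel_singleton[of t] by (auto elim: eventually_elim2)
  qed measurable
  then show "(\<lambda>n. (\<lambda>(x, t). \<kappa>1 x t) (u n)) \<longlonglongrightarrow> (\<lambda>(x, t). \<kappa>1 x t) z"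
    by (simp add: uXT xt \<kappa>1_def set_lebesgue_integral_def)
qed

lemma \<kappa>1_continuous_right: "0 \<le> x \<Longrightarrow> continuous_on {0..} (\<lambda>t. \<kappa>1 x t)"
  by (rule continuous_on_compose2[OF \<kappa>1_continuous, of _ "\<lambda>t. (x, t)", simplified]) (auto intro!: continuous_intros)

lemma \<kappa>1_set_integrable: "0 \<le> x \<Longrightarrow> set_integrable lborel {0..b} (\<lambda>t. \<kappa>1 x t)"
  by (intro borel_integrable_atLeastAtMost' continuous_on_subset[OF \<kappa>1_continuous_right]) auto

text \<open>The intermediate derivative required by the definition is \<open>\<kappa>1\<close>,
  which is continuous across the diagonal even where \<open>F\<close> jumps.\<close>

lemma \<kappa>2_mixed_derivative:
  assumes G: "\<And>x t. 0 \<le> x \<Longrightarrow> 0 \<le> t \<Longrightarrow> G x t = \<kappa>2 x t"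
    and F: "\<And>x t. 0 \<le> t \<Longrightarrow> t < x \<Longrightarrow> F x t = Fl x t" "\<And>x t. 0 \<le> x \<Longrightarrow> x < t \<Longrightarrow> F x t = Fu x t"
  shows "continuous_mixed_derivative G F"
proof -
  have 1: "\<forall>x\<ge>0. \<forall>t\<ge>0. ((\<lambda>t. G x t) has_vector_derivative \<kappa>1 x t) (at t within {0..})"
  proof (intro allI impI)
    fix x t :: real assume x: "0 \<le> x" and t: "0 \<le> t"
    have "((\<lambda>t. \<kappa>2 x t) has_vector_derivative \<kappa>1 x t) (at t within {0..})"
      unfolding \<kappa>2_def using x t \<kappa>1_continuous_right[OF x]
      by (intro integral_upto_has_vector_derivative \<kappa>1_set_integrable) (auto simp: continuous_on_eq_continuous_within)
    then show "((\<lambda>t. G x t) has_vector_derivative \<kappa>1 x t) (at t within {0..})"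
      by (rule has_vector_derivative_transform_within[where d = 1]) (use G x t in auto)
  qed
  have 2: "\<forall>x\<ge>0. \<forall>t\<ge>0. x \<noteq> t \<longrightarrow> ((\<lambda>x. \<kappa>1 x t) has_vector_derivative F x t) (at x within {0..})"
  proof (intro allI impI)
    fix x t :: real assume x: "0 \<le> x" and t: "0 \<le> t" and ne: "x \<noteq> t"
    have "continuous (at x within {0..}) (\<lambda>y. \<kappa> y t)"
      unfolding continuous_within_sequentially comp_def
    proof (intro allI impI)
      fix u :: "nat \<Rightarrow> real" assume u: "(\<forall>n. u n \<in> {0..}) \<and> u \<longlonglongrightarrow> x"
      show "(\<lambda>n. \<kappa> (u n) t) \<longlonglongrightarrow> \<kappa> x t" using u x t ne by (intro \<kappa>_tendsto tendsto_const) auto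
    qed
    then have "((\<lambda>x. \<kappa>1 x t) has_vector_derivative \<kappa> x t) (at x within {0..})"
      unfolding \<kappa>1_def using x by (intro integral_upto_has_vector_derivative \<kappa>_set_integrable)
    moreover have "\<kappa> x t = F x t" using x t ne F by (auto simp: \<kappa>_def)
    ultimately show "((\<lambda>x. \<kappa>1 x t) has_vector_derivative F x t) (at x within {0..})" by simp
  qed
  have 3: "\<forall>x t. 0 \<le> t \<and> t < x \<longrightarrow> F x t = Fl x t" "\<forall>x t. 0 \<le> x \<and> x < t \<longrightarrow> F x t = Fu x t"
    using F by auto
  show ?thesis unfolding continuous_mixed_derivative_def
    using \<kappa>1_continuous 1 2 3 Fl Fu by blast
qed

text \<open>Vanishing on the two axes fixes both constants of integration: \<open>G 0 t = 0\<close>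
  gives the initial value of \<open>G'\<close> in \<open>x\<close>, and \<open>G x 0 = 0\<close>
  that of \<open>G\<close> in \<open>t\<close>. Integrating twice then recovers \<open>G\<close>
  from \<open>F\<close>.\<close>

lemma mixed_derivative_\<kappa>2:
  assumes G: "continuous_mixed_derivative G F" and G0: "\<And>x. 0 \<le> x \<Longrightarrow> G x 0 = 0" "\<And>t. 0 \<le> t \<Longrightarrow> G 0 t = 0"
    and F: "\<And>x t. 0 \<le> t \<Longrightarrow> t < x \<Longrightarrow> F x t = Fl x t" "\<And>x t. 0 \<le> x \<Longrightarrow> x < t \<Longrightarrow> F x t = Fu x t"
    and x: "0 \<le> x" and t: "0 \<le> t"
  shows "G x t = \<kappa>2 x t"
proof -
  obtain G' where G': "continuous_on ({0..} \<times> {0..}) (\<lambda>(x, t). G' x t) \<and>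
      (\<forall>x\<ge>0. \<forall>t\<ge>0. ((\<lambda>t. G x t) has_vector_derivative G' x t) (at t within {0..})) \<and>
      (\<forall>x\<ge>0. \<forall>t\<ge>0. x \<noteq> t \<longrightarrow> ((\<lambda>x. G' x t) has_vector_derivative F x t) (at x within {0..}))"
    using G[unfolded continuous_mixed_derivative_def, THEN conjunct1] by (rule exE)
  note G'c = G'[THEN conjunct1]
  have d1: "((\<lambda>t. G x t) has_vector_derivative G' x t) (at t within {0..})" if "0 \<le> x" "0 \<le> t" for x t
    using G'[THEN conjunct2, THEN conjunct1] that by simp
  have d2: "((\<lambda>x. G' x t) has_vector_derivative F x t) (at x within {0..})" if "0 \<le> x" "0 \<le> t" "x \<noteq> t" for x t
    using G'[THEN conjunct2, THEN conjunct2] that by simp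
  have G'0: "G' 0 t = 0" if "0 \<le> t" for t
  proof (rule vector_derivative_unique_within_closed_interval[of 0 "t + 1" t "G 0"])
    show "(G 0 has_vector_derivative G' 0 t) (at t within cbox 0 (t + 1))"
      by (rule has_vector_derivative_within_subset[OF d1]) (use that in auto)
    have "((\<lambda>_. 0) has_vector_derivative 0) (at t within cbox 0 (t + 1))" by (rule has_vector_derivative_const)
    then show "(G 0 has_vector_derivative 0) (at t within cbox 0 (t + 1))"
      by (rule has_vector_derivative_transform_within[where d = 1]) (use that G0 in auto)
  qed (use that in auto)
  have G'\<kappa>: "G' x t = \<kappa>1 x t" if x: "0 \<le> x" and t: "0 \<le> t" for x t
  proof -
    have "((\<lambda>y. F y t) has_integral (G' x t - G' 0 t)) {0..x}"
    \<comment> \<open>At the exceptional point \<open>y = t\<close> the function \<open>G'\<close>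
      is only known to be continuous, which is enough here.\<close>
    proof (rule fundamental_theorem_of_calculus_interior_strong[of "{t}"])
      show "continuous_on {0..x} (\<lambda>y. G' y t)"
        by (rule continuous_on_compose2[OF G'c, of _ "\<lambda>y. (y, t)", simplified]) (use t in \<open>auto intro!: continuous_intros\<close>)
      show "((\<lambda>y. G' y t) has_vector_derivative F y t) (at y)" if "y \<in> {0<..<x} - {t}" for y
        using d2[of y t] that t by (simp add: at_within_interior[of y "{0..}"])
    qed (use x in auto)
    moreover have "\<kappa> y t = F y t" if "y \<in> {0..x} - {t}" for y
      using that t F by (auto simp: \<kappa>_def)
    ultimately have "((\<lambda>y. \<kappa> y t) has_integral (G' x t - G' 0 t)) {0..x}"
      by (intro has_integral_spike_finite[of "{t}" "{0..x}" "\<lambda>y. \<kappa> y t" "\<lambda>y. F y t"]) auto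
    then have "integral {0..x} (\<lambda>y. \<kappa> y t) = G' x t" by (simp add: integral_unique G'0[OF t])
    then show ?thesis unfolding \<kappa>1_def by (simp add: set_borel_integral_eq_integral(2)[OF \<kappa>_set_integrable])
  qed
  have "(LINT w|lborel. indicator {0..t} w *\<^sub>R G' x w) = G x t - G x 0"
  proof (rule integral_FTC_atLeastAtMost[OF t])
    show "(G x has_vector_derivative G' x w) (at w within {0..t})" if "0 \<le> w" "w \<le> t" for w
      by (rule has_vector_derivative_within_subset[OF d1[OF x that(1)]]) auto
    show "continuous_on {0..t} (G' x)"
      by (rule continuous_on_compose2[OF G'c, of _ "\<lambda>t. (x, t)", simplified]) (use x in \<open>auto intro!: continuous_intros\<close>)
  qed
  moreover have "(LINT w|lborel. indicator {0..t} w *\<^sub>R G' x w) = \<kappa>2 x t"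
    unfolding \<kappa>2_def set_lebesgue_integral_def
    by (intro Bochner_Integration.integral_cong) (auto simp: indicator_def G'\<kappa> x)
  ultimately show ?thesis using G0 x by simp
qed

end

subsection \<open>From the integral of \<open>e\<^sub>0\<close> to the kernel identity\<close>

lemma box_integrable1:
  fixes f :: "real \<Rightarrow> 'b::{banach, second_countable_topology}"
  assumes "f \<in> borel_measurable borel" "\<And>y. norm (f y) \<le> D * indicator {0..a} y"
  shows "integrable lborel f"
proof (rule Bochner_Integration.integrable_bound[of _ "\<lambda>y. D * indicator {0..a} y"])
  show "integrable lborel (\<lambda>y. D * indicator {0..a} y)"
    by (intro integrable_mult_right integrable_real_indicator) (auto simp: emeasure_lborel_Icc_eq)
  show "AE y in lborel. norm (f y) \<le> norm (D * indicator {0..a} y)"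
    using assms(2) by (intro AE_I2) (auto intro: order.trans abs_ge_self)
qed (use assms in simp)

text \<open>Fubini's theorem for bounded functions supported in a square, the form in which orders
  of integration are exchanged below.\<close>

lemma box_integrable2:
  fixes h :: "real \<Rightarrow> real \<Rightarrow> 'b::{banach, second_countable_topology}"
  assumes h: "(\<lambda>z. h (fst z) (snd z)) \<in> borel_measurable borel"
    and bd: "\<And>w y. norm (h w y) \<le> D * (indicator {0..a} w * indicator {0..a} y)"
  shows "integrable lborel (\<lambda>w. LINT y|lborel. h w y)"
    and "(LINT w|lborel. LINT y|lborel. h w y) = (LINT y|lborel. LINT w|lborel. h w y)"
proof -
  have [measurable]: "(\<lambda>z. h (fst z) (snd z)) \<in> borel_measurable (lborel \<Otimes>\<^sub>M lborel)"
    using h by (simp add: lborel_prod)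
  have i: "integrable (lborel \<Otimes>\<^sub>M lborel) (\<lambda>z. h (fst z) (snd z))"
  proof (rule Bochner_Integration.integrable_bound[of _ "\<lambda>z. D * indicator ({0..a} \<times> {0..a}) z"])
    have "emeasure (lborel :: (real \<times> real) measure) (cbox (0, 0) (a, a)) < \<infinity>"
      by (simp add: emeasure_lborel_cbox_eq)
    then show "integrable (lborel \<Otimes>\<^sub>M lborel) (\<lambda>z. D * indicator ({0..a} \<times> {0..a}) z :: real)"
      by (intro integrable_mult_right integrable_real_indicator) (simp_all add: cbox_Pair_eq lborel_prod)
    show "AE z in lborel \<Otimes>\<^sub>M lborel. norm (h (fst z) (snd z)) \<le> norm (D * indicator ({0..a} \<times> {0..a}) z)"
      by (intro AE_I2) (auto simp: indicator_times split_beta' intro!: order.trans[OF bd abs_ge_self])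
  qed measurable
  show "integrable lborel (\<lambda>w. LINT y|lborel. h w y)"
    using lborel_pair.integrable_fst'[OF i] by simp
  show "(LINT w|lborel. LINT y|lborel. h w y) = (LINT y|lborel. LINT w|lborel. h w y)"
    using lborel_pair.Fubini_integral[of h] i by (simp add: split_beta')
qed

lemma L2on_mono: "L2on a f \<Longrightarrow> a \<le> b \<Longrightarrow> L2on b f"
  by (auto simp: L2on_def)

lemma L2_comp_L2on:
  assumes "L2_comp f" obtains a where "0 \<le> a" "L2on a (\<lambda>x. indicator {0..} x *\<^sub>R f x)"
proof -
  from assms obtain a where a: "\<And>x. x > a \<Longrightarrow> f x = 0" by (auto simp: L2_comp_def)
  have "L2on (max a 0) (\<lambda>x. indicator {0..} x *\<^sub>R f x)"
    unfolding L2on_def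
  proof (intro conjI allI impI)
    show "(\<lambda>x. indicator {0..} x *\<^sub>R f x) \<in> borel_measurable borel"
      using assms by (simp add: L2_comp_def set_borel_measurable_def)
    show "indicator {0..} x *\<^sub>R f x = 0" if "x \<notin> {0..max a 0}" for x
      using that a[of x] by (auto simp: indicator_def)
    have "(\<lambda>x. (norm (indicator {0..} x *\<^sub>R f x))\<^sup>2) = (\<lambda>x. indicator {0..} x *\<^sub>R (norm (f x))\<^sup>2)"
      by (auto simp: indicator_def)
    then show "integrable lborel (\<lambda>x. (norm (indicator {0..} x *\<^sub>R f x))\<^sup>2)"
      using assms by (simp add: L2_comp_def set_integrable_def)
  qed
  then show ?thesis using that[of "max a 0"] by simp
qed

lemma bounded_linear_cinner_mult: "bounded_linear (\<lambda>C :: complex^'a^'b. cinner u (C *v v))"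
  by (rule bounded_linear_compose[OF cin.bounded_linear_right mv.bounded_linear_left])

lemma gen_fourier_alt: "gen_fourier U f l = (LINT x|lborel. mat_adj (U x (of_real l)) *v (indicator {0..} x *\<^sub>R f x))"
  by (simp add: gen_fourier_def set_lebesgue_integral_def mv.scaleR_right)

lemma cmod_cinner_mult_le:
  obtains B where "0 \<le> B" "\<And>u (C :: complex^'a^'b) v. cmod (cinner u (C *v v)) \<le> norm C * B * norm u * norm v"
proof -
  obtain B where B: "0 \<le> B" "\<And>(C :: complex^'a^'b) v. norm (C *v v) \<le> norm C * norm v * B"
    using mv.nonneg_bounded by blast
  have "cmod (cinner u (C *v v)) \<le> norm C * B * norm u * norm v" for u v and C :: "complex^'a^'b"
  proof -
    have "cmod (cinner u (C *v v)) \<le> norm u * norm (C *v v)" by (rule norm_cinner)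
    also have "\<dots> \<le> norm u * (norm C * norm v * B)" by (intro mult_left_mono B) auto
    finally show ?thesis by (simp add: mult_ac)
  qed
  then show ?thesis using that B(1) by blast
qed

context boundary_data
begin

lemma E_adj_bounded: obtains C where "0 \<le> C" "\<And>x l v. norm (mat_adj (E x (of_real l)) *v v) \<le> C * norm v"
proof -
  obtain C where C: "\<And>x l. norm (E x (of_real l)) \<le> C" using E_bounded by blast
  obtain B where B: "0 \<le> B" "\<And>u (C :: complex^('n + 'n)^'n) v. cmod (cinner u (C *v v)) \<le> norm C * B * norm u * norm v"
    using cmod_cinner_mult_le by blast
  obtain K where K: "0 \<le> K" "\<And>D :: complex^'n^('n + 'n). norm (mat_adj D) \<le> norm D * K"
    using bounded_linear.nonneg_bounded[OF bounded_linear_mat_adj] by blast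
  have "norm (mat_adj (E x (of_real l)) *v v) \<le> C * K * B * norm v" for x l v
  proof -
    let ?M = "mat_adj (E x (of_real l))" and ?w = "mat_adj (E x (of_real l)) *v v"
    have "norm ?w * norm ?w = cmod (cinner ?w ?w)" by (simp add: cinner_self power2_eq_square norm_mult)
    also have "\<dots> \<le> norm ?M * B * norm ?w * norm v" by (rule B)
    finally have "norm ?w \<le> norm ?M * B * norm v" by (cases "norm ?w = 0") (use B in \<open>auto simp: mult_ac\<close>)
    also have "\<dots> \<le> C * K * B * norm v"
      using B K(1) by (intro mult_right_mono order.trans[OF K(2) mult_right_mono[OF C]]) auto
    finally show ?thesis .
  qed
  moreover have "0 \<le> C * K * B" using B K order.trans[OF norm_ge_zero C] by auto
  ultimately show ?thesis using that by blast
qed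

text \<open>Applies \<open>sesquilinear_form\<close> to the free transform. On generators the
  overlap of the two intervals gives \<open>min x t\<close>, and the kernel contributes its double
  integral over the rectangle, which is the form of the hypothesis on \<open>Et\<close>.\<close>

lemma form_extension:
  assumes M: "sets M = sets borel" and \<Phi>: "\<Phi> \<in> borel_measurable borel" "\<And>l. pos_semidef (\<Phi> l)"
    and a: "0 \<le> a" and k: "(\<lambda>z. k (fst z) (snd z)) \<in> borel_measurable borel" and D: "\<And>x t. norm (k x t) \<le> D"
    and gen: "\<And>x t u v. 0 \<le> x \<Longrightarrow> x \<le> a \<Longrightarrow> 0 \<le> t \<Longrightarrow> t \<le> a \<Longrightarrow> has_bochner_integral M
      (\<lambda>l. cinner (mat_adj (Et x (of_real l)) *v u) (\<Phi> l *v (mat_adj (Et t (of_real l)) *v v)))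
      (of_real (min x t) * cinner u v + cinner u ((LINT w:{0..t}|lborel. LINT y:{0..x}|lborel. k y w) *v v))"
    and f: "L2on a f" and g: "L2on a g"
  shows "has_bochner_integral M
    (\<lambda>l. cinner (LINT x|lborel. mat_adj (E x (of_real l)) *v f x) (\<Phi> l *v (LINT x|lborel. mat_adj (E x (of_real l)) *v g x)))
    ((LINT x|lborel. cinner (f x) (g x)) + (LINT t|lborel. LINT x|lborel. cinner (f x) (k x t *v g t)))"
proof -
  obtain C where C: "0 \<le> C" "\<And>x l v. norm (mat_adj (E x (of_real l)) *v v) \<le> C * norm v"
    using E_adj_bounded by blast
  obtain B where B: "0 \<le> B" "\<And>u (C :: complex^('n + 'n)^('n + 'n)) v. cmod (cinner u (C *v v)) \<le> norm C * B * norm u * norm v"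
    using cmod_cinner_mult_le by blast
  have D0: "0 \<le> D" using order.trans[OF norm_ge_zero D] .
  \<comment> \<open>\<open>B\<close> is the bound of the matrix-vector product relative to the norm
    on matrices, so \<open>D * B\<close> bounds the form given by \<open>k\<close>.\<close>
  interpret KF: kernel_form M \<Phi> "\<lambda>x l. E x (of_real l)" k a C "D * B"
  proof unfold_locales
    show "cmod (cinner u (k x t *v v)) \<le> D * B * norm u * norm v" for x t u v
    proof -
      have "norm (k x t) * B * norm u * norm v \<le> D * B * norm u * norm v"
        using B D by (intro mult_right_mono) auto
      then show ?thesis using B(2)[of u "k x t" v] by linarith
    qed
  qed (use M \<Phi> a k D0 B C E_meas in auto)
  have Tgen: "KF.T (\<lambda>s. indicator {0..x} s *\<^sub>R u) l = mat_adj (Et x (of_real l)) *v u" for x u l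
    by (simp add: KF.T_def Et_adj set_lebesgue_integral_def mv.scaleR_right)
  have Sgen: "KF.S (\<lambda>s. indicator {0..x} s *\<^sub>R u) (\<lambda>s. indicator {0..t} s *\<^sub>R v)
      = of_real (min x t) * cinner u v + cinner u ((LINT w:{0..t}|lborel. LINT y:{0..x}|lborel. k y w) *v v)"
    if "0 \<le> x" "x \<le> a" "0 \<le> t" "t \<le> a" for x t u v
  proof -
    have ind: "indicator {0..x} s *\<^sub>R r *\<^sub>R indicator {0..t} s *\<^sub>R z = indicator {0..min x t} s *\<^sub>R r *\<^sub>R z" for s r and z :: complex
      by (auto simp: indicator_def)
    have "(LINT s|lborel. cinner (indicator {0..x} s *\<^sub>R u) (indicator {0..t} s *\<^sub>R v)) = (LINT s|lborel. indicator {0..min x t} s *\<^sub>R cinner u v)"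
      by (intro Bochner_Integration.integral_cong) (auto simp: indicator_def cin.zero_left cin.zero_right)
    also have "\<dots> = of_real (min x t) * cinner u v"
      using that by (subst integral_scaleR_left) (auto simp: emeasure_lborel_Icc_eq scaleR_conv_of_real[where 'a=complex])
    finally have 1: "(LINT s|lborel. cinner (indicator {0..x} s *\<^sub>R u) (indicator {0..t} s *\<^sub>R v)) = of_real (min x t) * cinner u v" .
    have km: "(\<lambda>y. k y w) \<in> borel_measurable borel" for w
      using measurable_compose[OF _ k, of "\<lambda>y. (y, w)" borel] by (simp add: borel_prod[symmetric])
    have k': "(\<lambda>z. k (snd z) (fst z)) \<in> borel_measurable borel"
      using measurable_compose[OF _ k, of "\<lambda>z. (snd z, fst z)" borel] by (simp add: borel_prod[symmetric])
    have int1: "integrable lborel (\<lambda>y. indicator {0..x} y *\<^sub>R k y w)" for w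
      by (rule box_integrable1[where D = D and a = x]) (use km D D0 in \<open>auto simp: indicator_def\<close>)
    have int2: "integrable lborel (\<lambda>w. LINT y|lborel. indicator {0..t} w *\<^sub>R indicator {0..x} y *\<^sub>R k y w)"
    proof (rule box_integrable2(1)[where D = D and a = a])
      have "indicator {0..t} \<in> borel_measurable (borel :: real measure)" "indicator {0..x} \<in> borel_measurable (borel :: real measure)" by auto
      then have [measurable]: "(\<lambda>z::real \<times> real. indicator {0..t} (fst z) :: real) \<in> borel_measurable borel"
         "(\<lambda>z::real \<times> real. indicator {0..x} (snd z) :: real) \<in> borel_measurable borel"
        by (auto simp: borel_prod[symmetric])
      show "(\<lambda>z. indicator {0..t} (fst z) *\<^sub>R indicator {0..x} (snd z) *\<^sub>R k (snd z) (fst z)) \<in> borel_measurable borel"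
        using k' by measurable
      show "norm (indicator {0..t} w *\<^sub>R indicator {0..x} y *\<^sub>R k y w) \<le> D * (indicator {0..a} w * indicator {0..a} y)" for w y
        using D D0 that by (auto simp: indicator_def)
    qed
    have "cinner (indicator {0..x} y *\<^sub>R u) (k y w *v (indicator {0..t} w *\<^sub>R v))
        = cinner u ((indicator {0..t} w *\<^sub>R indicator {0..x} y *\<^sub>R k y w) *v v)" for y w
      by (simp add: cin.scaleR_left cin.scaleR_right mv.scaleR_left mv.scaleR_right mult.left_commute)
    then have "(LINT w|lborel. LINT y|lborel. cinner (indicator {0..x} y *\<^sub>R u) (k y w *v (indicator {0..t} w *\<^sub>R v)))
        = (LINT w|lborel. LINT y|lborel. cinner u ((indicator {0..t} w *\<^sub>R indicator {0..x} y *\<^sub>R k y w) *v v))"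
      by simp
    also have "\<dots> = (LINT w|lborel. cinner u ((LINT y|lborel. indicator {0..t} w *\<^sub>R indicator {0..x} y *\<^sub>R k y w) *v v))"
      by (intro Bochner_Integration.integral_cong refl integral_bounded_linear[OF bounded_linear_cinner_mult] integrable_scaleR_right int1)
    also have "\<dots> = cinner u ((LINT w|lborel. LINT y|lborel. indicator {0..t} w *\<^sub>R indicator {0..x} y *\<^sub>R k y w) *v v)"
      by (rule integral_bounded_linear[OF bounded_linear_cinner_mult int2])
    finally have 2: "(LINT w|lborel. LINT y|lborel. cinner (indicator {0..x} y *\<^sub>R u) (k y w *v (indicator {0..t} w *\<^sub>R v)))
        = cinner u ((LINT w|lborel. LINT y|lborel. indicator {0..t} w *\<^sub>R indicator {0..x} y *\<^sub>R k y w) *v v)" .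
    show ?thesis unfolding KF.S_def 1 2 set_lebesgue_integral_def
      by (simp only: Bochner_Integration.integral_scaleR_right int1)
  qed
  have "has_bochner_integral M (KF.q f g) (KF.S f g)"
  proof (rule KF.sesquilinear_form[OF _ f g])
    fix x t u v assume xt: "0 \<le> x" "x \<le> a" "0 \<le> t" "t \<le> a"
    show "has_bochner_integral M (KF.q (\<lambda>s. indicator {0..x} s *\<^sub>R u) (\<lambda>s. indicator {0..t} s *\<^sub>R v))
        (KF.S (\<lambda>s. indicator {0..x} s *\<^sub>R u) (\<lambda>s. indicator {0..t} s *\<^sub>R v))"
      unfolding Sgen[OF xt] KF.q_def[abs_def] Tgen by (rule gen[OF xt])
  qed
  then show ?thesis unfolding KF.q_def[abs_def] KF.S_def KF.T_def .
qed

lemma Plancherel: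
  assumes a: "0 \<le> a" and f: "L2on a f" and g: "L2on a g"
  shows "has_bochner_integral (trace_measure (sigma0 B1))
    (\<lambda>l. cinner (LINT x|lborel. mat_adj (E x (of_real l)) *v f x) (\<Phi>0 l *v (LINT x|lborel. mat_adj (E x (of_real l)) *v g x)))
    (LINT x|lborel. cinner (f x) (g x))"
proof -
  have "\<Phi>0 \<in> borel_measurable borel" "\<And>l. pos_semidef (\<Phi>0 l)" using density_sigma0 by (auto simp: matrix_density_def)
  from form_extension[OF trace_measure_props(1)[OF sigma0_increasing] this a, of "\<lambda>x t. 0" 0 f g]
  show ?thesis using free_form_sigma0 f g by (simp add: cin.zero_right set_lebesgue_integral_def)
qed

text \<open>The common step of parts 1 and 3: the value of the form on generators, with the double
  primitive of \<open>F\<close>, implies the kernel identity. Subtracting the Plancherel identity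
  for \<open>sigma0 B1\<close> removes the inner product of \<open>f\<close> and
  \<open>g\<close>.\<close>

lemma kernel_identityI:
  assumes inc: "increasing_matrix \<sigma>" and \<Phi>: "matrix_density \<sigma> \<Phi>" and "wedge Fl Fu"
    and F: "\<And>x t. 0 \<le> t \<Longrightarrow> t < x \<Longrightarrow> F x t = Fl x t" "\<And>x t. 0 \<le> x \<Longrightarrow> x < t \<Longrightarrow> F x t = Fu x t"
    and gen: "\<And>x t u v. 0 \<le> x \<Longrightarrow> 0 \<le> t \<Longrightarrow> has_bochner_integral (trace_measure \<sigma>)
      (\<lambda>l. cinner (mat_adj (Et x (of_real l)) *v u) (\<Phi> l *v (mat_adj (Et t (of_real l)) *v v)))
      (of_real (min x t) * cinner u v + cinner u (wedge.\<kappa>2 Fl Fu x t *v v))"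
  shows "kernel_identity E \<sigma> (sigma0 B1) F"
  unfolding kernel_identity_def
proof (intro allI impI)
  interpret wedge Fl Fu by fact
  fix f g :: "real \<Rightarrow> complex^('n + 'n)" assume f: "L2_comp f" and g: "L2_comp g"
  let ?f = "\<lambda>x. indicator {0..} x *\<^sub>R f x" and ?g = "\<lambda>x. indicator {0..} x *\<^sub>R g x"
  obtain a1 a2 where a12: "0 \<le> a1" "L2on a1 ?f" "0 \<le> a2" "L2on a2 ?g" using f g by (elim L2_comp_L2on)
  define a where "a = max a1 a2"
  have a: "0 \<le> a" "L2on a ?f" "L2on a ?g" using a12 by (auto simp: a_def intro: L2on_mono)
  \<comment> \<open>\<open>form_extension\<close> asks for a globally bounded kernel. Cutting off
    beyond \<open>a\<close>, a common bound for the supports, leaves the double integral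
    unchanged.\<close>
  define k where "k x t = (if x \<le> a \<and> t \<le> a then \<kappa> x t else 0)" for x t
  obtain D where D: "0 \<le> D" "\<And>x t. x \<le> a \<Longrightarrow> t \<le> a \<Longrightarrow> norm (\<kappa> x t) \<le> D" using \<kappa>_bounded by blast
  have kD: "norm (k x t) \<le> D" for x t using D by (simp add: k_def)
  have "(\<lambda>z. if fst z \<le> a \<and> snd z \<le> a then \<kappa> (fst z) (snd z) else 0) \<in> borel_measurable borel"
    by (intro measurable_If \<kappa>_meas pred_intros_logic) (auto simp: borel_prod[symmetric])
  then have k_meas: "(\<lambda>z. k (fst z) (snd z)) \<in> borel_measurable borel" by (simp add: k_def)
  have \<kappa>2: "(LINT w:{0..t}|lborel. LINT y:{0..x}|lborel. k y w) = \<kappa>2 x t" if "x \<le> a" "t \<le> a" for x t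
    unfolding \<kappa>2_def \<kappa>1_def set_lebesgue_integral_def
    using that by (intro Bochner_Integration.integral_cong) (auto simp: indicator_def k_def intro!: Bochner_Integration.integral_cong)
  have \<Phi>': "\<Phi> \<in> borel_measurable borel" "\<And>l. pos_semidef (\<Phi> l)" using \<Phi> by (auto simp: matrix_density_def)
  have 1: "has_bochner_integral (trace_measure \<sigma>)
    (\<lambda>l. cinner (gen_fourier E f l) (\<Phi> l *v gen_fourier E g l))
    ((LINT x|lborel. cinner (?f x) (?g x)) + (LINT t|lborel. LINT x|lborel. cinner (?f x) (k x t *v ?g t)))"
    unfolding gen_fourier_alt
    by (rule form_extension[OF trace_measure_props(1)[OF inc] \<Phi>' a(1) k_meas kD _ a(2,3)]) (simp only: \<kappa>2 gen)
  have 2: "has_bochner_integral (trace_measure (sigma0 B1))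
    (\<lambda>l. cinner (gen_fourier E f l) (\<Phi>0 l *v gen_fourier E g l)) (LINT x|lborel. cinner (?f x) (?g x))"
    unfolding gen_fourier_alt by (rule Plancherel[OF a])
  have "(LINT t:{0..}|lborel. (LINT x:{0..}|lborel. cinner (f x) (F x t *v g t))) = (LINT t|lborel. LINT x|lborel. cinner (?f x) (k x t *v ?g t))"
    unfolding set_lebesgue_integral_def
  proof (intro Bochner_Integration.integral_cong refl)
    fix t :: real
    show "indicator {0..} t *\<^sub>R (LINT x|lborel. indicator {0..} x *\<^sub>R cinner (f x) (F x t *v g t)) = (LINT x|lborel. cinner (?f x) (k x t *v ?g t))"
    proof (cases "0 \<le> t")
      case True
      have "(LINT x|lborel. indicator {0..} x *\<^sub>R cinner (f x) (F x t *v g t)) = (LINT x|lborel. cinner (?f x) (k x t *v ?g t))"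
      \<comment> \<open>On the diagonal \<open>F\<close> and \<open>\<kappa>\<close> are unrelated;
        for each \<open>t\<close> this is one point \<open>x\<close>.\<close>
      proof (rule integral_discrete_difference[of "{t}"])
        fix x assume "x \<notin> {t}"
        show "indicator {0..} x *\<^sub>R cinner (f x) (F x t *v g t) = cinner (?f x) (k x t *v ?g t)"
        proof (cases "0 \<le> x")
          case x: True
          have "f x = 0" if "x > a" using L2on_outside[OF a(2), of x] that x by (simp add: indicator_def)
          moreover have "g t = 0" if "t > a" using L2on_outside[OF a(3), of t] that True by (simp add: indicator_def)
          moreover have "k x t = F x t" if "x \<le> a" "t \<le> a"
            using that x True \<open>x \<notin> {t}\<close> F by (auto simp: k_def \<kappa>_def)
          ultimately show ?thesis using x True
            by (cases "x \<le> a"; cases "t \<le> a") (auto simp: indicator_def cin.zero_left cin.zero_right mv.zero_right)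
        qed (simp add: cin.zero_left)
      qed auto
      then show ?thesis using True by simp
    qed (simp add: cin.zero_right mv.zero_right)
  qed
  moreover have "has_form_integral \<sigma> (gen_fourier E f) (gen_fourier E g)
    ((LINT x|lborel. cinner (?f x) (?g x)) + (LINT t|lborel. LINT x|lborel. cinner (?f x) (k x t *v ?g t)))"
    unfolding has_form_integral_def by (rule exI[of _ \<Phi>], rule conjI[OF \<Phi> 1])
  moreover have "has_form_integral (sigma0 B1) (gen_fourier E f) (gen_fourier E g) (LINT x|lborel. cinner (?f x) (?g x))"
    unfolding has_form_integral_def by (rule exI[of _ \<Phi>0], rule conjI[OF density_sigma0 2])
  ultimately show "has_form_integral_diff \<sigma> (sigma0 B1) (gen_fourier E f) (gen_fourier E g)
        (LINT t:{0..}|lborel. (LINT x:{0..}|lborel. cinner (f x) (F x t *v g t)))"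
    unfolding has_form_integral_diff_def by (intro exI conjI) (assumption, assumption, simp only: add_diff_cancel_left')
qed

lemma has_matrix_integral_sigma0:
  assumes "0 \<le> x" "0 \<le> t"
  shows "has_matrix_integral (sigma0 B1) (\<lambda>l. Et x (of_real l)) (\<lambda>l. Et t (of_real l)) (mat_scale (of_real (min x t)) (mat 1))"
  unfolding has_matrix_integral_density[OF sigma0_increasing density_sigma0 Et_meas Et_meas] has_bochner_integral_matrix_iff cinner_sandwich
  using free_form_sigma0[OF assms] by (simp add: mat_scale_mult_vec cinner_scale_right)

text \<open>The integral against \<open>sigma0 B1\<close> is known, so the hypothesis determines the
  one against \<open>\<sigma>\<close> as \<open>min x t\<close> times the identity plus
  \<open>Ft x t\<close>. As \<open>Et\<close> vanishes at 0, \<open>Ft\<close> vanishes on both axes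
  and must be the double primitive of \<open>F\<close>.\<close>

theorem converse_identity:
  assumes inc: "increasing_matrix \<sigma>" and Ft: "kernel_integral Et \<sigma> (sigma0 B1) Ft" and F: "continuous_mixed_derivative Ft F"
  shows "kernel_identity E \<sigma> (sigma0 B1) F"
proof -
  obtain \<Phi> where \<Phi>: "matrix_density \<sigma> \<Phi>"
    using Ft unfolding kernel_integral_def has_matrix_integral_diff_def has_matrix_integral_def by blast
  have val: "has_bochner_integral (trace_measure \<sigma>) (\<lambda>l. Et x (of_real l) ** \<Phi> l ** mat_adj (Et t (of_real l)))
      (mat_scale (of_real (min x t)) (mat 1) + Ft x t)" if "0 \<le> x" "0 \<le> t" for x t
  proof -
    have diff: "has_matrix_integral_diff \<sigma> (sigma0 B1) (\<lambda>l. Et x (of_real l)) (\<lambda>l. Et t (of_real l)) (Ft x t)"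
      using Ft that by (simp add: kernel_integral_def)
    obtain J1 J0 where J: "has_matrix_integral \<sigma> (\<lambda>l. Et x (of_real l)) (\<lambda>l. Et t (of_real l)) J1"
      "has_matrix_integral (sigma0 B1) (\<lambda>l. Et x (of_real l)) (\<lambda>l. Et t (of_real l)) J0" "Ft x t = J1 - J0"
      using diff unfolding has_matrix_integral_diff_def by (elim exE conjE)
    have "J0 = mat_scale (of_real (min x t)) (mat 1)"
      using J(2) has_matrix_integral_sigma0[OF that]
      unfolding has_matrix_integral_density[OF sigma0_increasing density_sigma0 Et_meas Et_meas]
      by (rule has_bochner_integral_eq)
    then show ?thesis using J(1,3) unfolding has_matrix_integral_density[OF inc \<Phi> Et_meas Et_meas] by simp
  qed
  have Et0: "Et 0 l = 0" for l
  proof -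
    have "(LINT t:{0..0}|lborel. E t l) = (LINT t::real|lborel. 0)"
      unfolding set_lebesgue_integral_def
      by (rule integral_discrete_difference[of "{0}"]) (auto simp: indicator_def)
    then show ?thesis by (simp add: e0_tilde_def)
  qed
  have Ft0: "Ft x t = 0" if "0 \<le> x" "0 \<le> t" "x = 0 \<or> t = 0" for x t
  proof -
    have "min x t = 0" using that by auto
    moreover have "(\<lambda>l. Et x (of_real l) ** \<Phi> l ** mat_adj (Et t (of_real l))) = (\<lambda>l. 0)"
      using that(3) Et0 by (auto simp: mm.zero_left mm.zero_right)
    ultimately have "has_bochner_integral (trace_measure \<sigma>) (\<lambda>l. 0) (mat_scale 0 (mat 1) + Ft x t)" using val[OF that(1,2)] by simp
    moreover have "mat_scale 0 (mat 1 :: complex^('n + 'n)^('n + 'n)) = 0" by (simp add: mat_scale_def vec_eq_iff)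
    ultimately show ?thesis by (simp add: has_bochner_integral_iff)
  qed
  obtain Fl where Fl: "continuous_on {(x, t). 0 \<le> t \<and> t \<le> x} (\<lambda>(x, t). Fl x t) \<and> (\<forall>x t. 0 \<le> t \<and> t < x \<longrightarrow> F x t = Fl x t)"
    using F[unfolded continuous_mixed_derivative_def, THEN conjunct2, THEN conjunct1] by (rule exE)
  obtain Fu where Fu: "continuous_on {(x, t). 0 \<le> x \<and> x \<le> t} (\<lambda>(x, t). Fu x t) \<and> (\<forall>x t. 0 \<le> x \<and> x < t \<longrightarrow> F x t = Fu x t)"
    using F[unfolded continuous_mixed_derivative_def, THEN conjunct2, THEN conjunct2] by (rule exE)
  have w: "wedge Fl Fu" using Fl Fu by (simp add: wedge_def)
  have Fe: "\<And>x t. 0 \<le> t \<Longrightarrow> t < x \<Longrightarrow> F x t = Fl x t" "\<And>x t. 0 \<le> x \<Longrightarrow> x < t \<Longrightarrow> F x t = Fu x t"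
    using Fl Fu by simp_all
  show ?thesis
  proof (rule kernel_identityI[OF inc \<Phi> w Fe])
    fix x t u v assume xt: "0 \<le> (x::real)" "0 \<le> (t::real)"
    have "Ft x t = wedge.\<kappa>2 Fl Fu x t"
      using Ft0 by (intro wedge.mixed_derivative_\<kappa>2[OF w F _ _ Fe xt]) auto
    then show "has_bochner_integral (trace_measure \<sigma>)
      (\<lambda>l. cinner (mat_adj (Et x (of_real l)) *v u) (\<Phi> l *v (mat_adj (Et t (of_real l)) *v v)))
      (of_real (min x t) * cinner u v + cinner u (wedge.\<kappa>2 Fl Fu x t *v v))"
      using val[OF xt] unfolding has_bochner_integral_matrix_iff cinner_sandwich
      by (simp add: mv.add_left cin.add_right mat_scale_mult_vec cinner_scale_right)
  qed
qed

end

subsection \<open>The kernel of a transformation operator\<close>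

lemma bounded_bilinear_mult_adj: "bounded_bilinear (\<lambda>(C :: complex^'a^'b) (D :: complex^'a^'c). C ** mat_adj D)"
  by (rule bounded_bilinear.comp[OF bounded_bilinear_matrix_matrix bounded_linear_ident bounded_linear_mat_adj])

lemma bounded_bilinear_adj_mult_vec: "bounded_bilinear (\<lambda>(C :: complex^'a^'b) v. mat_adj C *v v)"
  by (rule bounded_bilinear.comp[OF bounded_bilinear_matrix_vector bounded_linear_mat_adj bounded_linear_ident])

lemma le_mult_indicatorD: "r \<le> b * indicator S s \<Longrightarrow> 0 \<le> b \<Longrightarrow> r \<le> (b :: real)"
  by (cases "s \<in> S") auto

locale triangular_kernel =
  fixes R :: "real \<Rightarrow> real \<Rightarrow> complex^'m^'m"
  assumes R: "continuous_on triangle (\<lambda>(x, t). R x t)"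
begin

text \<open>Extends \<open>R\<close> by 0 above the diagonal. \<open>P\<close> is also 0 on the
  diagonal and for negative second argument, so Volterra integrals become integrals over the line,
  up to one point.\<close>

sublocale W: wedge R "\<lambda>_ _. 0"
  by unfold_locales (use R in \<open>auto simp: triangle_def split_beta'\<close>)

abbreviation P where "P \<equiv> W.\<kappa>"

lemma P_simps: "0 \<le> s \<Longrightarrow> s < y \<Longrightarrow> P y s = R y s" "s < 0 \<Longrightarrow> P y s = 0" "y \<le> s \<Longrightarrow> P y s = 0"
  by (auto simp: W.\<kappa>_def)

lemma P_measurable [measurable (raw)]:
  assumes "f \<in> borel_measurable M" "g \<in> borel_measurable M" shows "(\<lambda>x. P (f x) (g x)) \<in> borel_measurable M"
  using measurable_compose[OF borel_measurable_Pair[OF assms] W.\<kappa>_meas] by simp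

lemma P_bound: obtains b where "0 \<le> b" "\<And>y s. y \<le> a \<Longrightarrow> norm (P y s) \<le> b * indicator {0..a} s"
proof -
  obtain b where b: "0 \<le> b" "\<And>y s. y \<le> a \<Longrightarrow> s \<le> a \<Longrightarrow> norm (P y s) \<le> b" using W.\<kappa>_bounded by blast
  have "norm (P y s) \<le> b * indicator {0..a} s" if "y \<le> a" for y s
  proof (cases "0 \<le> s \<and> s < y")
    case True then show ?thesis using b(2)[OF that, of s] that by (auto simp: indicator_def)
  next
    case False then have "P y s = 0" by (auto simp: W.\<kappa>_def)
    then show ?thesis using b(1) by simp
  qed
  then show ?thesis using that b by blast
qed

text \<open>\<open>mat_adj (N x s) *v u\<close> is the value at \<open>s\<close> of the adjoint of
  the Volterra operator \<open>R\<close> on the step function with value \<open>u\<close> on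
  \<open>[0, x]\<close>.\<close>

definition N :: "real \<Rightarrow> real \<Rightarrow> complex^'m^'m" where
  "N x s = (LINT y|lborel. indicator {0..x} y *\<^sub>R P y s)"

text \<open>The kernel of the operator product of \<open>R\<close> with its adjoint.\<close>

definition Z :: "real \<Rightarrow> real \<Rightarrow> complex^'m^'m" where
  "Z y w = (LINT s|lborel. P y s ** mat_adj (P w s))"

lemma N_measurable [measurable]: "(\<lambda>s. N x s) \<in> borel_measurable borel"
proof -
  have "(\<lambda>(s, y). indicator {0..x} y *\<^sub>R P y s) \<in> borel_measurable (borel \<Otimes>\<^sub>M lborel)"
    unfolding split_beta' by measurable
  from lborel.borel_measurable_lebesgue_integral[OF this] show ?thesis unfolding N_def .
qed

lemma N_integrable: "integrable lborel (\<lambda>y. indicator {0..x} y *\<^sub>R P y s)"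
proof -
  obtain b where b: "0 \<le> b" "\<And>y s. y \<le> x \<Longrightarrow> norm (P y s) \<le> b * indicator {0..x} s" using P_bound by blast
  have "norm (P y s) \<le> b" if "y \<le> x" for y by (rule le_mult_indicatorD[OF b(2)[OF that] b(1)])
  then show ?thesis by (intro box_integrable1[where D = b and a = x]) (use b in \<open>auto simp: indicator_def\<close>)
qed

lemma N_outside: "s \<notin> {0..x} \<Longrightarrow> N x s = 0"
proof -
  assume "s \<notin> {0..x}"
  then have "indicator {0..x} y *\<^sub>R P y s = 0" for y by (auto simp: W.\<kappa>_def indicator_def)
  then show ?thesis by (simp only: N_def Bochner_Integration.integral_zero)
qed

lemma N_bound: assumes "0 \<le> x" obtains b where "0 \<le> b" "\<And>s. norm (N x s) \<le> b * indicator {0..x} s"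
proof -
  obtain b where b: "0 \<le> b" "\<And>y s. y \<le> x \<Longrightarrow> norm (P y s) \<le> b * indicator {0..x} s" using P_bound by blast
  have bd: "norm (P y s) \<le> b" if "y \<le> x" for y s by (rule le_mult_indicatorD[OF b(2)[OF that] b(1)])
  have "norm (N x s) \<le> (b * x) * indicator {0..x} s" for s
  proof (cases "s \<in> {0..x}")
    case True
    have "norm (N x s) \<le> (LINT y|lborel. indicator {0..x} y *\<^sub>R b)"
      unfolding N_def
    proof (rule norm_integral_le)
      show "integrable lborel (\<lambda>y. indicator {0..x} y *\<^sub>R b)"
        by (intro integrable_scaleR_left integrable_real_indicator) (auto simp: emeasure_lborel_Icc_eq)
    qed (use bd in \<open>auto simp: indicator_def\<close>)
    also have "\<dots> = b * x" using assms by (subst integral_scaleR_left) (auto simp: emeasure_lborel_Icc_eq)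
    finally show ?thesis using True by simp
  qed (simp add: N_outside)
  then show ?thesis using that[of "b * x"] b assms by simp
qed

lemma mult_adj_bound:
  obtains c where "0 \<le> c" "\<And>(C :: complex^'m^'m) (D :: complex^'m^'m). norm (C ** mat_adj D) \<le> norm C * norm D * c"
  using bounded_bilinear.nonneg_bounded[OF bounded_bilinear_mult_adj] by blast

lemma PP_bound:
  obtains c where "0 \<le> c" "\<And>y w s. y \<le> a \<Longrightarrow> w \<le> a \<Longrightarrow> norm (P y s ** mat_adj (P w s)) \<le> c * indicator {0..a} s"
proof -
  obtain b where b: "0 \<le> b" "\<And>y s. y \<le> a \<Longrightarrow> norm (P y s) \<le> b * indicator {0..a} s" using P_bound by blast
  obtain c where c: "0 \<le> c" "\<And>(C :: complex^'m^'m) (D :: complex^'m^'m). norm (C ** mat_adj D) \<le> norm C * norm D * c"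
    using mult_adj_bound by blast
  have "norm (P y s ** mat_adj (P w s)) \<le> (b * b * c) * indicator {0..a} s" if "y \<le> a" "w \<le> a" for y w s
  proof -
    have "norm (P y s ** mat_adj (P w s)) \<le> norm (P y s) * norm (P w s) * c" by (rule c)
    also have "\<dots> \<le> (b * indicator {0..a} s) * (b * indicator {0..a} s) * c"
      using b that c by (intro mult_right_mono mult_mono) auto
    also have "\<dots> = (b * b * c) * indicator {0..a} s" by (simp add: indicator_def)
    finally show ?thesis .
  qed
  then show ?thesis using that[of "b * b * c"] b c by simp
qed

lemma Z_measurable [measurable (raw)]:
  assumes "f \<in> borel_measurable M" "g \<in> borel_measurable M" shows "(\<lambda>x. Z (f x) (g x)) \<in> borel_measurable M"
proof -
  have "(\<lambda>(z, s). P (fst z) s ** mat_adj (P (snd z) s)) \<in> borel_measurable ((borel \<Otimes>\<^sub>M borel) \<Otimes>\<^sub>M lborel)"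
    unfolding split_beta' by measurable
  from lborel.borel_measurable_lebesgue_integral[OF this]
  have "(\<lambda>z. Z (fst z) (snd z)) \<in> borel_measurable (borel \<Otimes>\<^sub>M borel)" unfolding Z_def .
  from measurable_compose[OF measurable_Pair[OF assms] this] show ?thesis by simp
qed

lemma Z_bound: assumes "0 \<le> a" obtains c where "0 \<le> c" "\<And>y w. y \<le> a \<Longrightarrow> w \<le> a \<Longrightarrow> norm (Z y w) \<le> c"
proof -
  obtain c where c: "0 \<le> c" "\<And>y w s. y \<le> a \<Longrightarrow> w \<le> a \<Longrightarrow> norm (P y s ** mat_adj (P w s)) \<le> c * indicator {0..a} s"
    using PP_bound by blast
  have "norm (Z y w) \<le> (LINT s|lborel. c * indicator {0..a} s)" if "y \<le> a" "w \<le> a" for y w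
    unfolding Z_def
    by (rule norm_integral_le)
      (use c that in \<open>auto intro!: integrable_mult_right integrable_real_indicator simp: emeasure_lborel_Icc_eq\<close>)
  moreover have "0 \<le> (LINT s|lborel. c * indicator {0..a} s :: real)" using c by (intro integral_nonneg_AE) auto
  ultimately show ?thesis using that by blast
qed

text \<open>For fixed \<open>s\<close> the integrand can fail to converge only at
  \<open>s = x\<close> or \<open>s = t\<close>. Hence the product kernel has no jump, and that of
  \<open>F\<close> comes from \<open>R\<close> and its adjoint alone.\<close>

lemma Z_continuous: "continuous_on ({0..} \<times> {0..}) (\<lambda>(x, t). Z x t)"
proof (rule continuous_on_sequentiallyI)
  fix u and z :: "real \<times> real"
  assume u: "\<forall>n. u n \<in> {0..} \<times> {0..}" and z: "z \<in> {0..} \<times> {0..}" and lim: "u \<longlonglongrightarrow> z"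
  obtain x t where xt: "z = (x, t)" by fastforce
  define X where "X n = fst (u n)" for n
  define T where "T n = snd (u n)" for n
  have uXT: "u n = (X n, T n)" for n by (simp add: X_def T_def)
  have X: "X \<longlonglongrightarrow> x" and T: "T \<longlonglongrightarrow> t" using tendsto_fst[OF lim] tendsto_snd[OF lim] by (simp_all add: X_def[abs_def] T_def[abs_def] xt)
  have nn: "0 \<le> X n" "0 \<le> T n" "0 \<le> x" "0 \<le> t" for n using u z by (auto simp: X_def T_def xt mem_Times_iff)
  obtain A1 A2 where A: "\<And>n. norm (X n) \<le> A1" "\<And>n. norm (T n) \<le> A2"
    using X T by (meson BseqE convergentI convergent_imp_Bseq)
  define A where "A = max A1 A2"
  have XA: "X n \<le> A" "T n \<le> A" for n using A[of n] by (auto simp: A_def)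
  obtain c where c: "0 \<le> c" "\<And>y w s. y \<le> A \<Longrightarrow> w \<le> A \<Longrightarrow> norm (P y s ** mat_adj (P w s)) \<le> c * indicator {0..A} s"
    using PP_bound by blast
  have "(\<lambda>n. LINT s|lborel. P (X n) s ** mat_adj (P (T n) s)) \<longlonglongrightarrow> (LINT s|lborel. P x s ** mat_adj (P t s))"
  proof (rule integral_dominated_convergence[where w = "\<lambda>s. c * indicator {0..A} s"])
    show "integrable lborel (\<lambda>s. c * indicator {0..A} s)"
      by (intro integrable_mult_right integrable_real_indicator) (auto simp: emeasure_lborel_Icc_eq)
    show "AE s in lborel. norm (P (X n) s ** mat_adj (P (T n) s)) \<le> c * indicator {0..A} s" for n
      using c(2)[OF XA] by (intro AE_I2) auto
    have "(\<lambda>n. P (X n) s ** mat_adj (P (T n) s)) \<longlonglongrightarrow> P x s ** mat_adj (P t s)" if s: "s \<noteq> x" "s \<noteq> t" for s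
    proof (cases "0 \<le> s")
      case True
      have "(\<lambda>n. P (X n) s) \<longlonglongrightarrow> P x s" "(\<lambda>n. P (T n) s) \<longlonglongrightarrow> P t s"
        using nn True s X T by (auto intro!: W.\<kappa>_tendsto)
      then show ?thesis by (rule bounded_bilinear.tendsto[OF bounded_bilinear_mult_adj])
    qed (simp add: P_simps)
    then show "AE s in lborel. (\<lambda>n. P (X n) s ** mat_adj (P (T n) s)) \<longlonglongrightarrow> P x s ** mat_adj (P t s)"
      using AE_lborel_singleton[of x] AE_lborel_singleton[of t] by (auto elim: eventually_elim2)
  qed measurable
  then show "(\<lambda>n. (\<lambda>(x, t). Z x t) (u n)) \<longlonglongrightarrow> (\<lambda>(x, t). Z x t) z"
    by (simp add: uXT xt Z_def)
qed

abbreviation "Fl \<equiv> \<lambda>x t. R x t + Z x t"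
abbreviation "Fu \<equiv> \<lambda>x t. mat_adj (R t x) + Z x t"

sublocale FF: wedge Fl Fu
proof
  have Zl: "continuous_on {(x, t). 0 \<le> t \<and> t \<le> x} (\<lambda>(x, t). Z x t)" and Zu: "continuous_on {(x, t). 0 \<le> x \<and> x \<le> t} (\<lambda>(x, t). Z x t)"
    by (auto intro: continuous_on_subset[OF Z_continuous])
  show "continuous_on {(x, t). 0 \<le> t \<and> t \<le> x} (\<lambda>(x, t). R x t + Z x t)"
    using continuous_on_add[OF R[unfolded triangle_def] Zl] by (simp add: split_beta')
  have "continuous_on {(x, t). 0 \<le> x \<and> x \<le> t} (\<lambda>z. (\<lambda>(x, t). R x t) (snd z, fst z))"
    by (rule continuous_on_compose2[OF R[unfolded triangle_def]]) (auto intro!: continuous_intros)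
  then have "continuous_on {(x, t). 0 \<le> x \<and> x \<le> t} (\<lambda>z. mat_adj (R (snd z) (fst z)))"
    using bounded_linear.continuous_on[OF bounded_linear_mat_adj] by auto
  from continuous_on_add[OF this Zu]
  show "continuous_on {(x, t). 0 \<le> x \<and> x \<le> t} (\<lambda>(x, t). mat_adj (R t x) + Z x t)" by (simp add: split_beta')
qed

lemma F_kernel_lower: assumes "0 \<le> t" "t < x" shows "F_kernel R x t = Fl x t"
proof -
  \<comment> \<open>\<open>P t s\<close> vanishes beyond \<open>t\<close>, which restricts the range
    of \<open>Z\<close> by itself; only at \<open>s = t\<close>, where \<open>P\<close> is 0 by
    definition, may the integrands differ.\<close>
  have "(LINT s:{0..t}|lborel. R x s ** mat_adj (R t s)) = Z x t"
    unfolding Z_def set_lebesgue_integral_def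
    by (rule integral_discrete_difference[of "{t}"]) (use assms in \<open>auto simp: indicator_def W.\<kappa>_def mm.zero_left mm.zero_right\<close>)
  then show ?thesis using assms by (simp add: F_kernel_def)
qed

lemma F_kernel_upper: assumes "0 \<le> x" "x < t" shows "F_kernel R x t = Fu x t"
proof -
  have "(LINT s:{0..x}|lborel. R x s ** mat_adj (R t s)) = Z x t"
    unfolding Z_def set_lebesgue_integral_def
    by (rule integral_discrete_difference[of "{x}"]) (use assms in \<open>auto simp: indicator_def W.\<kappa>_def mm.zero_left mm.zero_right\<close>)
  then show ?thesis using assms by (simp add: F_kernel_def)
qed

lemma FF_\<kappa>: "0 \<le> y \<Longrightarrow> 0 \<le> w \<Longrightarrow> y \<noteq> w \<Longrightarrow> FF.\<kappa> y w = P y w + mat_adj (P w y) + Z y w"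
  by (cases "w < y") (auto simp: FF.\<kappa>_def W.\<kappa>_def)

text \<open>Off the diagonal the kernel of \<open>F\<close> is the sum of \<open>P\<close>, its
  adjoint and \<open>Z\<close>. Integrating over \<open>[0, x] \<times> [0, t]\<close> and moving
  one variable outside turns these into \<open>N x\<close> on \<open>[0, t]\<close>, the adjoint of
  \<open>N t\<close> on \<open>[0, x]\<close>, and the product of both.\<close>

lemma N_form_matrix:
  assumes x: "0 \<le> x" and t: "0 \<le> t"
  shows "has_bochner_integral lborel
    (\<lambda>s. indicator {0..x} s *\<^sub>R mat_adj (N t s) + indicator {0..t} s *\<^sub>R N x s + N x s ** mat_adj (N t s)) (FF.\<kappa>2 x t)"
proof -
  let ?i = "\<lambda>x s. indicator {0..x} s :: real"
  define a where "a = max x t"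
  have a: "0 \<le> a" "x \<le> a" "t \<le> a" using x by (auto simp: a_def)
  obtain b where b: "0 \<le> b" "\<And>y s. y \<le> a \<Longrightarrow> norm (P y s) \<le> b * indicator {0..a} s" using P_bound by blast
  obtain bx where bx: "0 \<le> bx" "\<And>s. norm (N x s) \<le> bx * indicator {0..x} s" using N_bound[OF x] by blast
  obtain bt where bt: "0 \<le> bt" "\<And>s. norm (N t s) \<le> bt * indicator {0..t} s" using N_bound[OF t] by blast
  obtain c where c: "0 \<le> c" "\<And>(C :: complex^'m^'m) (D :: complex^'m^'m). norm (C ** mat_adj D) \<le> norm C * norm D * c"
    using mult_adj_bound by blast
  obtain d where d: "0 \<le> d" "\<And>D :: complex^'m^'m. norm (mat_adj D) \<le> norm D * d"
    using bounded_linear.nonneg_bounded[OF bounded_linear_mat_adj] by blast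
  obtain z where z: "0 \<le> z" "\<And>y w. y \<le> a \<Longrightarrow> w \<le> a \<Longrightarrow> norm (Z y w) \<le> z" using Z_bound[OF a(1)] by blast
  have bd: "norm (P y s) \<le> b" if "y \<le> a" for y s by (rule le_mult_indicatorD[OF b(2)[OF that] b(1)])
  have bdx: "norm (N x s) \<le> bx" for s by (rule le_mult_indicatorD[OF bx(2) bx(1)])

  have m2: "(\<lambda>z::real \<times> real. ?i x (snd z)) \<in> borel_measurable borel" "(\<lambda>z::real \<times> real. ?i t (fst z)) \<in> borel_measurable borel"
    by (auto simp: borel_prod[symmetric])
  have pm: "fst \<in> borel_measurable (borel :: (real \<times> real) measure)" "snd \<in> borel_measurable (borel :: (real \<times> real) measure)"
    by (auto simp: borel_prod[symmetric])
  note [measurable] = m2 pm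

  \<comment> \<open>Measurability and bounds for each exchange of integrals: 1 for the adjoint of
    \<open>P\<close>, 2 for \<open>P\<close>, 3 for \<open>N x\<close> times the adjoint of
    \<open>P\<close>, 4 for the integrand of \<open>Z\<close> with \<open>w\<close> fixed, 5 for
    \<open>Z\<close>.\<close>
  have adjP: "norm (mat_adj (P w s)) \<le> b * d" if "w \<le> a" for w s
    using order.trans[OF d(2) mult_right_mono[OF bd[OF that] d(1)]] .
  have m_1: "(\<lambda>z. ?i t (fst z) *\<^sub>R ?i x (snd z) *\<^sub>R mat_adj (P (fst z) (snd z))) \<in> borel_measurable borel" by measurable
  have b_1: "norm (?i t w *\<^sub>R ?i x s *\<^sub>R mat_adj (P w s)) \<le> (b * d) * (?i a w * ?i a s)" for w s
    using adjP[of w s] a b d by (auto simp: indicator_def)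
  note B1 = box_integrable2[OF m_1 b_1]
  have m_2: "(\<lambda>z. ?i t (fst z) *\<^sub>R ?i x (snd z) *\<^sub>R P (snd z) (fst z)) \<in> borel_measurable borel" by measurable
  have b_2: "norm (?i t w *\<^sub>R ?i x s *\<^sub>R P s w) \<le> b * (?i a w * ?i a s)" for w s
    using bd[of s w] a b by (auto simp: indicator_def)
  note B2 = box_integrable2[OF m_2 b_2]
  have m_3: "(\<lambda>z. ?i t (fst z) *\<^sub>R (N x (snd z) ** mat_adj (P (fst z) (snd z)))) \<in> borel_measurable borel"
    using measurable_compose[OF pm(2) N_measurable[of x]] by measurable
  have b_3: "norm (?i t w *\<^sub>R (N x s ** mat_adj (P w s))) \<le> (bx * b * c) * (?i a w * ?i a s)" for w s
  proof (cases "w \<in> {0..t} \<and> s \<in> {0..x}")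
    case True
    have "norm (N x s ** mat_adj (P w s)) \<le> norm (N x s) * norm (P w s) * c" by (rule c)
    also have "\<dots> \<le> bx * b * c" using bdx bd[of w s] True a bx c by (intro mult_right_mono mult_mono) auto
    finally show ?thesis using True a by (auto simp: indicator_def)
  next
    case False
    then have "?i t w *\<^sub>R (N x s ** mat_adj (P w s)) = 0" using N_outside[of s x] by (auto simp: indicator_def mm.zero_left)
    then show ?thesis using bx b c by (auto simp: indicator_def)
  qed
  note B3 = box_integrable2[OF m_3 b_3]
  have m_4: "(\<lambda>z. ?i x (fst z) *\<^sub>R (P (fst z) (snd z) ** mat_adj (P w (snd z)))) \<in> borel_measurable borel" for w
    using measurable_compose[OF pm(1), of "indicator {0..x} :: real \<Rightarrow> real"] by measurable
  have b_4: "norm (?i x y *\<^sub>R (P y s ** mat_adj (P w s))) \<le> (b * b * c) * (?i a y * ?i a s)" if "w \<le> a" for w y s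
  proof (cases "y \<in> {0..x}")
    case True
    have "norm (P y s ** mat_adj (P w s)) \<le> norm (P y s) * norm (P w s) * c" by (rule c)
    also have "\<dots> \<le> (b * ?i a s) * b * c" using bd[of w s] b(2)[of y s] that True a b c by (intro mult_right_mono mult_mono) auto
    finally show ?thesis using True a by (auto simp: indicator_def)
  qed (use b c in auto)
  have m_5: "(\<lambda>z. ?i t (fst z) *\<^sub>R ?i x (snd z) *\<^sub>R Z (snd z) (fst z)) \<in> borel_measurable borel" by measurable
  have b_5: "norm (?i t w *\<^sub>R ?i x y *\<^sub>R Z y w) \<le> z * (?i a w * ?i a y)" for w y
    using z(2)[of y w] z(1) a by (auto simp: indicator_def)
  note B5 = box_integrable2[OF m_5 b_5]

  have T1: "has_bochner_integral lborel (\<lambda>s. ?i x s *\<^sub>R mat_adj (N t s)) (LINT w|lborel. LINT y|lborel. ?i t w *\<^sub>R ?i x y *\<^sub>R mat_adj (P w y))"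
  proof -
    have "?i x s *\<^sub>R mat_adj (N t s) = (LINT w|lborel. ?i t w *\<^sub>R ?i x s *\<^sub>R mat_adj (P w s))" for s
    proof -
      have "mat_adj (N t s) = (LINT w|lborel. mat_adj (?i t w *\<^sub>R P w s))"
        unfolding N_def by (rule integral_bounded_linear[OF bounded_linear_mat_adj N_integrable, symmetric])
      then show ?thesis by (simp add: mat_adj_scaleR flip: Bochner_Integration.integral_scaleR_right) (simp add: mult.commute)
    qed
    moreover have "integrable lborel (\<lambda>s. ?i x s *\<^sub>R mat_adj (N t s))"
    proof (rule box_integrable1[where D = "bt * d" and a = t])
      show "norm (?i x s *\<^sub>R mat_adj (N t s)) \<le> bt * d * ?i t s" for s
        using order.trans[OF d(2) mult_right_mono[OF bt(2) d(1)], of s] bt d by (auto simp: indicator_def split: if_splits)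
    qed measurable
    ultimately show ?thesis using B1(2) by (simp add: has_bochner_integral_iff)
  qed
  have T2: "has_bochner_integral lborel (\<lambda>s. ?i t s *\<^sub>R N x s) (LINT w|lborel. LINT y|lborel. ?i t w *\<^sub>R ?i x y *\<^sub>R P y w)"
  proof -
    have "(\<lambda>s. ?i t s *\<^sub>R N x s) = (\<lambda>w. LINT y|lborel. ?i t w *\<^sub>R ?i x y *\<^sub>R P y w)"
      unfolding N_def by (simp only: Bochner_Integration.integral_scaleR_right)
    then show ?thesis using B2(1) by (simp only: has_bochner_integral_iff)
  qed
  \<comment> \<open>Two exchanges: the integral over \<open>w\<close> is taken out of
    \<open>N t\<close>, then the one over \<open>y\<close> out of \<open>N x\<close>; what remains
    inside is \<open>Z\<close>.\<close>
  have T3: "has_bochner_integral lborel (\<lambda>s. N x s ** mat_adj (N t s)) (LINT w|lborel. LINT y|lborel. ?i t w *\<^sub>R ?i x y *\<^sub>R Z y w)"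
  proof -
    have e1: "N x s ** mat_adj (N t s) = (LINT w|lborel. ?i t w *\<^sub>R (N x s ** mat_adj (P w s)))" for s
    proof -
      have "N x s ** mat_adj (N t s) = (LINT w|lborel. N x s ** mat_adj (?i t w *\<^sub>R P w s))"
        unfolding N_def[of t] by (rule integral_bounded_linear[OF bounded_bilinear.bounded_linear_right[OF bounded_bilinear_mult_adj] N_integrable, symmetric])
      then show ?thesis by (simp add: mat_adj_scaleR matrix_mult_scaleR)
    qed
    have e2: "(LINT s|lborel. ?i t w *\<^sub>R (N x s ** mat_adj (P w s))) = (LINT y|lborel. ?i t w *\<^sub>R ?i x y *\<^sub>R Z y w)" for w
    proof (cases "w \<in> {0..t}")
      case True
      then have w: "w \<le> a" using a by simp
      have "N x s ** mat_adj (P w s) = (LINT y|lborel. ?i x y *\<^sub>R (P y s ** mat_adj (P w s)))" for s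
      proof -
        have "N x s ** mat_adj (P w s) = (LINT y|lborel. (?i x y *\<^sub>R P y s) ** mat_adj (P w s))"
          unfolding N_def by (rule integral_bounded_linear[OF bounded_bilinear.bounded_linear_left[OF bounded_bilinear_mult_adj] N_integrable, symmetric])
        then show ?thesis by (simp add: matrix_mult_scaleR)
      qed
      then have "(LINT s|lborel. N x s ** mat_adj (P w s)) = (LINT y|lborel. LINT s|lborel. ?i x y *\<^sub>R (P y s ** mat_adj (P w s)))"
        using box_integrable2(2)[OF m_4 b_4[OF w]] by simp
      also have "\<dots> = (LINT y|lborel. ?i x y *\<^sub>R Z y w)" by (simp add: Z_def)
      finally show ?thesis by (simp only: Bochner_Integration.integral_scaleR_right)
    qed simp
    have "integrable lborel (\<lambda>s. N x s ** mat_adj (N t s))"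
    proof (rule box_integrable1[where D = "bx * bt * c" and a = t])
      show "norm (N x s ** mat_adj (N t s)) \<le> bx * bt * c * ?i t s" for s
      proof -
        have "norm (N x s ** mat_adj (N t s)) \<le> norm (N x s) * norm (N t s) * c" by (rule c)
        also have "\<dots> \<le> bx * (bt * ?i t s) * c" using bdx bt(2)[of s] bx c by (intro mult_right_mono mult_mono) auto
        finally show ?thesis by (simp add: mult_ac)
      qed
    qed measurable
    moreover have "(LINT s|lborel. N x s ** mat_adj (N t s)) = (LINT w|lborel. LINT y|lborel. ?i t w *\<^sub>R ?i x y *\<^sub>R Z y w)"
      unfolding e1 using B3(2) e2 by simp
    ultimately show ?thesis by (simp add: has_bochner_integral_iff)
  qed
  have i1: "integrable lborel (\<lambda>y. ?i t w *\<^sub>R ?i x y *\<^sub>R mat_adj (P w y))" if "w \<le> a" for w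
    by (rule box_integrable1[where D = "b * d" and a = a]) (use adjP[OF that] b d a in \<open>auto simp: indicator_def\<close>)
  have i2: "integrable lborel (\<lambda>y. ?i t w *\<^sub>R ?i x y *\<^sub>R P y w)" for w
    by (rule box_integrable1[where D = b and a = a]) (use bd b a in \<open>auto simp: indicator_def\<close>)
  have i3: "integrable lborel (\<lambda>y. ?i t w *\<^sub>R ?i x y *\<^sub>R Z y w)" if "w \<le> a" for w
    by (rule box_integrable1[where D = z and a = a]) (use z that a in \<open>auto simp: indicator_def\<close>)
  \<comment> \<open>The decomposition \<open>FF_\<kappa>\<close> is available for
    \<open>y \<noteq> w\<close>, so for each \<open>w\<close> one point is left out.\<close>
  have inner: "?i t w *\<^sub>R (LINT y|lborel. ?i x y *\<^sub>R FF.\<kappa> y w)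
      = (LINT y|lborel. ?i t w *\<^sub>R ?i x y *\<^sub>R mat_adj (P w y)) + (LINT y|lborel. ?i t w *\<^sub>R ?i x y *\<^sub>R P y w) + (LINT y|lborel. ?i t w *\<^sub>R ?i x y *\<^sub>R Z y w)" for w
  proof (cases "w \<in> {0..t}")
    case True
    then have w: "0 \<le> w" "w \<le> a" using a by auto
    have "(LINT y|lborel. ?i t w *\<^sub>R ?i x y *\<^sub>R FF.\<kappa> y w)
        = (LINT y|lborel. ?i t w *\<^sub>R ?i x y *\<^sub>R mat_adj (P w y) + ?i t w *\<^sub>R ?i x y *\<^sub>R P y w + ?i t w *\<^sub>R ?i x y *\<^sub>R Z y w)"
      by (rule integral_discrete_difference[of "{w}"]) (use w FF_\<kappa>[OF _ w(1)] in \<open>auto simp: indicator_def\<close>)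
    then show ?thesis
      by (simp only: Bochner_Integration.integral_add Bochner_Integration.integrable_add i1[OF w(2)] i2 i3[OF w(2)]
          flip: Bochner_Integration.integral_scaleR_right)
  qed simp
  have "FF.\<kappa>2 x t = (LINT w|lborel. LINT y|lborel. ?i t w *\<^sub>R ?i x y *\<^sub>R mat_adj (P w y))
      + (LINT w|lborel. LINT y|lborel. ?i t w *\<^sub>R ?i x y *\<^sub>R P y w) + (LINT w|lborel. LINT y|lborel. ?i t w *\<^sub>R ?i x y *\<^sub>R Z y w)"
    unfolding FF.\<kappa>2_def FF.\<kappa>1_def set_lebesgue_integral_def inner
    by (simp only: Bochner_Integration.integral_add Bochner_Integration.integrable_add B1(1) B2(1) B5(1))
  then show ?thesis using has_bochner_integral_add[OF has_bochner_integral_add[OF T1 T2] T3] by simp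
qed

text \<open>\<open>h x u\<close> is \<open>(I + R)\<^sup>*\<close> applied to the step function with value \<open>u\<close> on \<open>[0, x]\<close>.\<close>

definition h :: "real \<Rightarrow> complex^'m \<Rightarrow> real \<Rightarrow> complex^'m" where
  "h x u s = indicator {0..x} s *\<^sub>R u + mat_adj (N x s) *v u"

text \<open>The four products of the two summands of each \<open>h\<close> are the overlap of the
  intervals and the three terms of \<open>N_form_matrix\<close>.\<close>

lemma h_form:
  assumes x: "0 \<le> x" and t: "0 \<le> t"
  shows "has_bochner_integral lborel (\<lambda>s. cinner (h x u s) (h t v s)) (of_real (min x t) * cinner u v + cinner u (FF.\<kappa>2 x t *v v))"
proof -
  have "has_bochner_integral lborel (\<lambda>s. indicator {0..min x t} s *\<^sub>R cinner u v) (measure lborel {0..min x t} *\<^sub>R cinner u v)"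
    by (intro has_bochner_integral_indicator) (auto simp: emeasure_lborel_Icc_eq)
  then have 1: "has_bochner_integral lborel (\<lambda>s. indicator {0..min x t} s *\<^sub>R cinner u v) (of_real (min x t) * cinner u v)"
    using x t by (simp add: scaleR_conv_of_real[where 'a=complex])
  have 2: "has_bochner_integral lborel
    (\<lambda>s. cinner u ((indicator {0..x} s *\<^sub>R mat_adj (N t s) + indicator {0..t} s *\<^sub>R N x s + N x s ** mat_adj (N t s)) *v v)) (cinner u (FF.\<kappa>2 x t *v v))"
    by (rule has_bochner_integral_bounded_linear[OF bounded_linear_cinner_mult N_form_matrix[OF x t]])
  have e: "cinner (h x u s) (h t v s) = indicator {0..min x t} s *\<^sub>R cinner u v
    + cinner u ((indicator {0..x} s *\<^sub>R mat_adj (N t s) + indicator {0..t} s *\<^sub>R N x s + N x s ** mat_adj (N t s)) *v v)" for s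
  proof -
    have i: "indicator {0..x} s *\<^sub>R indicator {0..t} s *\<^sub>R cinner u v = indicator {0..min x t} s *\<^sub>R cinner u v"
      by (auto simp: indicator_def)
    have "cinner (h x u s) (h t v s) = indicator {0..x} s *\<^sub>R indicator {0..t} s *\<^sub>R cinner u v
      + indicator {0..x} s *\<^sub>R cinner u (mat_adj (N t s) *v v) + indicator {0..t} s *\<^sub>R cinner (mat_adj (N x s) *v u) v
      + cinner (mat_adj (N x s) *v u) (mat_adj (N t s) *v v)"
      unfolding h_def by (simp add: cin.add_left cin.add_right cin.scaleR_left cin.scaleR_right algebra_simps)
    also have "\<dots> = indicator {0..min x t} s *\<^sub>R cinner u v
      + cinner u ((indicator {0..x} s *\<^sub>R mat_adj (N t s) + indicator {0..t} s *\<^sub>R N x s + N x s ** mat_adj (N t s)) *v v)"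
      unfolding i mat_adj_mult_vec[symmetric]
      by (simp add: mv.add_left mv.scaleR_left cin.add_right cin.scaleR_right matrix_vector_mul_assoc)
    finally show ?thesis .
  qed
  show ?thesis unfolding e by (rule has_bochner_integral_add[OF 1 2])
qed

lemma h_L2on: assumes x: "0 \<le> x" shows "L2on x (h x u)"
proof -
  obtain b where b: "0 \<le> b" "\<And>s. norm (N x s) \<le> b * indicator {0..x} s" using N_bound[OF x] by blast
  have 1: "L2on x (\<lambda>s. indicator {0..x} s *\<^sub>R u)" by (intro stepf_L2on stepf.gen) (use x in auto)
  obtain c where c: "0 \<le> c" "\<And>(C :: complex^'m^'m) v. norm (mat_adj C *v v) \<le> norm C * norm v * c"
    using bounded_bilinear.nonneg_bounded[OF bounded_bilinear_adj_mult_vec] by blast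
  have bd: "norm (mat_adj (N x s) *v u) \<le> (b * norm u * c) * indicator {0..x} s" for s
  proof -
    have "norm (mat_adj (N x s) *v u) \<le> norm (N x s) * norm u * c" by (rule c)
    also have "\<dots> \<le> (b * indicator {0..x} s) * norm u * c" using c by (intro mult_right_mono b) auto
    finally show ?thesis by (simp add: mult_ac)
  qed
  have "L2on x (\<lambda>s. mat_adj (N x s) *v u)"
    unfolding L2on_def
  proof (intro conjI allI impI)
    show "integrable lborel (\<lambda>s. (norm (mat_adj (N x s) *v u))\<^sup>2)"
    proof (rule box_integrable1[where D = "(b * norm u * c)\<^sup>2" and a = x])
      show "norm ((norm (mat_adj (N x s) *v u))\<^sup>2) \<le> (b * norm u * c)\<^sup>2 * indicator {0..x} s" for s
        using power_mono[OF bd[of s], of 2] by (auto simp: indicator_def split: if_splits)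
    qed measurable
  qed (auto simp: N_outside mv.zero_left)
  then show ?thesis unfolding h_def[abs_def] by (rule L2on_add[OF 1])
qed

end

subsection \<open>Spectral functions and transformation operators\<close>

lemma set_integral_bounded_linear:
  assumes "bounded_linear T" "set_integrable M S f"
  shows "(LINT t:S|M. T (f t)) = T (LINT t:S|M. f t)"
  using integral_bounded_linear[OF assms(1) assms(2)[unfolded set_integrable_def]]
  by (simp add: set_lebesgue_integral_def linear_simps(5)[OF assms(1)])

lemma triangle_section_continuous:
  assumes "continuous_on triangle (\<lambda>(x, t). R x t)" shows "continuous_on {0..x} (\<lambda>t. R x t)"
proof -
  have "continuous_on {0..x} (\<lambda>t. (x, t))" by (intro continuous_intros)
  moreover have "(\<lambda>t. (x, t)) ` {0..x} \<subseteq> triangle" by (auto simp: triangle_def)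
  ultimately show ?thesis using continuous_on_compose2[OF assms, of "{0..x}" "\<lambda>t. (x, t)"] by simp
qed

lemma solution_continuous:
  assumes "solution B1 B2 H Q Y" shows "continuous_on {0..} (\<lambda>x. Y x l)"
  unfolding continuous_on_eq_continuous_within
proof
  fix x :: real assume "x \<in> {0..}"
  then obtain D where "((\<lambda>x. Y x l) has_vector_derivative D) (at x within {0..})"
    using assms unfolding solution_def by auto
  then show "continuous (at x within {0..}) (\<lambda>x. Y x l)" by (rule has_vector_derivative_continuous)
qed

lemma cinner_integral_polarized:
  fixes f g :: "real \<Rightarrow> complex^'m"
  assumes f: "L2on a f" and g: "L2on a g"
  shows "(LINT x|lborel. cinner (f x) (g x)) = (of_real (sqnorm (\<lambda>x. f x + g x)) - of_real (sqnorm (\<lambda>x. f x - g x))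
     - \<i> * of_real (sqnorm (\<lambda>x. f x + \<i> *s g x)) + \<i> * of_real (sqnorm (\<lambda>x. f x - \<i> *s g x))) / 4"
proof -
  have d: "has_bochner_integral lborel (\<lambda>x. cinner (p x) (mat 1 *v p x)) (of_real (sqnorm p))" if "L2on a p" for p :: "real \<Rightarrow> complex^'m"
    using L2on_square_integrable[OF that]
    by (simp add: cinner_self sqnorm_def has_bochner_integral_iff flip: of_real_power)
  have "has_bochner_integral lborel (\<lambda>x. cinner (f x) (mat 1 *v g x)) ((of_real (sqnorm (\<lambda>x. f x + g x)) - of_real (sqnorm (\<lambda>x. f x - g x))
     - \<i> * of_real (sqnorm (\<lambda>x. f x + \<i> *s g x)) + \<i> * of_real (sqnorm (\<lambda>x. f x - \<i> *s g x))) / 4)"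
    by (intro has_bochner_integral_polarization d L2on_add L2on_diff L2on_scale f g)
  then show ?thesis by (simp add: has_bochner_integral_iff)
qed

locale continuous_solution =
  fixes Y :: "real \<Rightarrow> complex \<Rightarrow> complex^'n^'m"
  assumes Y: "\<And>l. continuous_on {0..} (\<lambda>x. Y x l)"
begin

definition Y0 :: "complex \<Rightarrow> real \<Rightarrow> complex^'n^'m" where "Y0 l t = indicator {0..} t *\<^sub>R Y t l"

lemma Y0_measurable [measurable]: "Y0 l \<in> borel_measurable borel"
  unfolding Y0_def[abs_def] by (intro borel_measurable_continuous_on_indicator Y) auto

lemma Y0_bound: obtains c where "0 \<le> c" "\<And>t. t \<le> a \<Longrightarrow> norm (Y0 l t) \<le> c"
proof -
  have "compact ((\<lambda>t. Y t l) ` {0..a})" by (intro compact_continuous_image continuous_on_subset[OF Y]) auto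
  then obtain c where "\<forall>y\<in>(\<lambda>t. Y t l) ` {0..a}. norm y \<le> c" using compact_imp_bounded bounded_iff by blast
  then have "norm (Y0 l t) \<le> \<bar>c\<bar>" if "t \<le> a" for t
    using that by (auto simp: Y0_def indicator_def intro: order.trans[OF _ abs_ge_self])
  then show ?thesis using that[of "\<bar>c\<bar>"] by simp
qed

lemma gen_fourier_Y0:
  "L2on a f \<Longrightarrow> gen_fourier Y f l = (LINT t|lborel. mat_adj (Y0 (of_real l) t) *v f t)"
  unfolding gen_fourier_alt Y0_def by (simp add: mv.scaleR_right mv.scaleR_left mat_adj_scaleR)

lemma Y0_integrable: assumes f: "L2on a f" shows "integrable lborel (\<lambda>t. mat_adj (Y0 l t) *v f t)"
proof -
  obtain c where c: "0 \<le> c" "\<And>t. t \<le> a \<Longrightarrow> norm (Y0 l t) \<le> c" using Y0_bound by blast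
  obtain k where k: "0 \<le> k" "\<And>(C :: complex^'n^'m) v. norm (mat_adj C *v v) \<le> norm C * norm v * k"
    using bounded_bilinear.nonneg_bounded[OF bounded_bilinear_adj_mult_vec] by blast
  note [measurable] = L2on_measurable[OF f]
  show ?thesis
  proof (rule Bochner_Integration.integrable_bound[of _ "\<lambda>t. c * k * norm (f t)"])
    show "(\<lambda>t. mat_adj (Y0 l t) *v f t) \<in> borel_measurable lborel" by measurable
    have "norm (mat_adj (Y0 l t) *v f t) \<le> c * k * norm (f t)" for t
    proof (cases "t \<le> a")
      case True
      have "norm (mat_adj (Y0 l t) *v f t) \<le> norm (Y0 l t) * norm (f t) * k" by (rule k)
      also have "\<dots> \<le> c * norm (f t) * k" using c(2)[OF True] k by (intro mult_right_mono) auto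
      finally show ?thesis by (simp add: mult_ac)
    qed (use L2on_outside[OF f, of t] in auto)
    then show "AE t in lborel. norm (mat_adj (Y0 l t) *v f t) \<le> norm (c * k * norm (f t))" using c k by simp
  qed (use L2on_norm_integrable[OF f] in auto)
qed

lemma gen_fourier_linear:
  assumes f: "L2on a f" and g: "L2on a g"
  shows "gen_fourier Y (\<lambda>x. f x + g x) l = gen_fourier Y f l + gen_fourier Y g l"
    and "gen_fourier Y (\<lambda>x. f x - g x) l = gen_fourier Y f l - gen_fourier Y g l"
    and "gen_fourier Y (\<lambda>x. c *s f x) l = c *s gen_fourier Y f l"
proof -
  show "gen_fourier Y (\<lambda>x. f x + g x) l = gen_fourier Y f l + gen_fourier Y g l"
    unfolding gen_fourier_Y0[OF f] gen_fourier_Y0[OF g] gen_fourier_Y0[OF L2on_add[OF f g]]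
    by (simp add: mv.add_right Y0_integrable[OF f] Y0_integrable[OF g])
  show "gen_fourier Y (\<lambda>x. f x - g x) l = gen_fourier Y f l - gen_fourier Y g l"
    unfolding gen_fourier_Y0[OF f] gen_fourier_Y0[OF g] gen_fourier_Y0[OF L2on_diff[OF f g]]
    by (simp add: mv.diff_right Y0_integrable[OF f] Y0_integrable[OF g])
  show "gen_fourier Y (\<lambda>x. c *s f x) l = c *s gen_fourier Y f l"
    unfolding gen_fourier_Y0[OF f] gen_fourier_Y0[OF L2on_scale[OF f]] matrix_vector_scale
    by (rule integral_bounded_linear[OF bounded_linear_vector_scale_right Y0_integrable[OF f]])
qed

text \<open>\<open>spectral_function\<close> provides only norms, each with a density of its own.
  Measurability of the two transforms allows one density for all four terms of the
  polarization.\<close>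

lemma spectral_polarized:
  assumes sp: "spectral_function Y \<sigma>" and \<Phi>: "matrix_density \<sigma> \<Phi>" and f: "L2on a f" and g: "L2on a g"
    and meas: "gen_fourier Y f \<in> borel_measurable borel" "gen_fourier Y g \<in> borel_measurable borel"
  shows "has_bochner_integral (trace_measure \<sigma>) (\<lambda>l. cinner (gen_fourier Y f l) (\<Phi> l *v gen_fourier Y g l)) (LINT x|lborel. cinner (f x) (g x))"
proof -
  have inc: "increasing_matrix \<sigma>" using sp by (simp add: spectral_function_def)
  have diag: "has_bochner_integral (trace_measure \<sigma>) (\<lambda>l. cinner (gen_fourier Y p l) (\<Phi> l *v gen_fourier Y p l)) (of_real (sqnorm p))"
    if p: "L2on a p" and m: "gen_fourier Y p \<in> borel_measurable borel" for p
  proof -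
    have e: "indicator {0..} x *\<^sub>R p x = p x" "indicator {0..} x *\<^sub>R (norm (p x))\<^sup>2 = (norm (p x))\<^sup>2" for x
      using L2on_outside[OF p, of x] by (auto simp: indicator_def)
    have "\<forall>x>a. p x = 0" using L2on_outside[OF p] by auto
    then have "L2_comp p" unfolding L2_comp_def set_borel_measurable_def set_integrable_def e
      using L2on_measurable[OF p] L2on_square_integrable[OF p] by auto
    then have "has_form_integral \<sigma> (gen_fourier Y p) (gen_fourier Y p) (of_real (LINT x:{0..}|lborel. (norm (p x))\<^sup>2))"
      using sp by (simp add: spectral_function_def)
    then show ?thesis
      unfolding has_form_integral_density[OF inc \<Phi> m m] set_lebesgue_integral_def e sqnorm_def .
  qed
  let ?f = "gen_fourier Y f" and ?g = "gen_fourier Y g"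
  have ig: "L2on a (\<lambda>x. \<i> *s g x)" by (rule L2on_scale[OF g])
  have lin: "gen_fourier Y (\<lambda>x. f x + g x) = (\<lambda>l. ?f l + ?g l)" "gen_fourier Y (\<lambda>x. f x - g x) = (\<lambda>l. ?f l - ?g l)"
    "gen_fourier Y (\<lambda>x. f x + \<i> *s g x) = (\<lambda>l. ?f l + \<i> *s ?g l)" "gen_fourier Y (\<lambda>x. f x - \<i> *s g x) = (\<lambda>l. ?f l - \<i> *s ?g l)"
    by (simp_all add: fun_eq_iff gen_fourier_linear[OF f g] gen_fourier_linear[OF f ig] gen_fourier_linear(3)[OF g g])
  note [measurable] = meas
  have m: "(\<lambda>l. ?f l + ?g l) \<in> borel_measurable borel" "(\<lambda>l. ?f l - ?g l) \<in> borel_measurable borel"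
    "(\<lambda>l. ?f l + \<i> *s ?g l) \<in> borel_measurable borel" "(\<lambda>l. ?f l - \<i> *s ?g l) \<in> borel_measurable borel"
    by measurable
  note d = diag[OF L2on_add[OF f g], unfolded lin, OF m(1)] diag[OF L2on_diff[OF f g], unfolded lin, OF m(2)]
    diag[OF L2on_add[OF f ig], unfolded lin, OF m(3)] diag[OF L2on_diff[OF f ig], unfolded lin, OF m(4)]
  show ?thesis unfolding cinner_integral_polarized[OF f g] by (rule has_bochner_integral_polarization[OF d])
qed

end

section \<open>Transfer of the isometry property to the free transforms\<close>

context boundary_data
begin

text \<open>For each vector \<open>v\<close>, the function \<open>E x l *v v\<close> is continuous,
  hence locally square integrable; \<open>I + K\<close> maps it to \<open>Y x l *v v\<close>, and
  the resolvent kernel maps it back.\<close>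

lemma inverse_transformation:
  assumes sol: "solution B1 B2 H Q Y" and K: "transformation_kernel E Y K" and rk: "resolvent_kernel K R" and x: "0 \<le> x"
  shows "E x l = Y x l + (LINT t:{0..x}|lborel. R x t ** Y t l)"
  unfolding matrix_eq
proof
  fix v :: "complex^'n"
  let ?f = "\<lambda>x. E x l *v v"
  let ?g = "\<lambda>x. ?f x + volterra K ?f x"
  have Kc: "continuous_on {0..y} (\<lambda>t. K y t)" for y
    using K by (intro triangle_section_continuous) (simp add: transformation_kernel_def)
  have Rc: "continuous_on {0..y} (\<lambda>t. R y t)" for y
    using rk by (intro triangle_section_continuous) (simp add: resolvent_kernel_def)
  have fc: "continuous_on S ?f" for S by (intro mv.continuous_on continuous_intros)
  have "L2_loc ?f"
    unfolding L2_loc_def set_borel_measurable_def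
  proof (intro conjI allI)
    show "(\<lambda>x. indicator {0..} x *\<^sub>R ?f x) \<in> borel_measurable lborel"
      using borel_measurable_continuous_on_indicator[OF _ fc, of "{0..}"] by simp
    show "set_integrable lborel {0..a} (\<lambda>x. (norm (?f x))\<^sup>2)" for a
      by (intro borel_integrable_atLeastAtMost' continuous_intros fc)
  qed
  then have "\<forall>x\<ge>0. (let g = (\<lambda>x. ?f x + volterra K ?f x) in g x + volterra R g x = ?f x) \<and>
        (let g = (\<lambda>x. ?f x + volterra R ?f x) in g x + volterra K g x = ?f x)"
    using rk unfolding resolvent_kernel_def by blast
  then have res: "?g x + volterra R ?g x = ?f x" using x by (simp only: Let_def)
  have g: "?g y = Y y l *v v" if y: "0 \<le> y" for y
  proof -
    have "set_integrable lborel {0..y} (\<lambda>t. K y t ** E t l)"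
      by (intro borel_integrable_atLeastAtMost' mm.continuous_on Kc continuous_intros)
    from set_integral_bounded_linear[OF mv.bounded_linear_left this, of v]
    have "volterra K ?f y = (LINT t:{0..y}|lborel. K y t ** E t l) *v v"
      unfolding volterra_def matrix_vector_mul_assoc .
    moreover have "Y y l = E y l + (LINT t:{0..y}|lborel. K y t ** E t l)"
      using K y by (simp add: transformation_kernel_def)
    ultimately show ?thesis by (simp add: mv.add_left)
  qed
  have "volterra R ?g x = (LINT t:{0..x}|lborel. (R x t ** Y t l) *v v)"
    unfolding volterra_def[of R]
  proof (rule set_lebesgue_integral_cong, simp, intro allI impI)
    fix t assume "t \<in> {0..x}"
    then have "0 \<le> t" by simp
    show "R x t *v ?g t = (R x t ** Y t l) *v v"
      unfolding g[OF \<open>0 \<le> t\<close>] by (rule matrix_vector_mul_assoc)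
  qed
  also have "\<dots> = (LINT t:{0..x}|lborel. R x t ** Y t l) *v v"
  proof (rule set_integral_bounded_linear[OF mv.bounded_linear_left])
    show "set_integrable lborel {0..x} (\<lambda>t. R x t ** Y t l)"
      by (intro borel_integrable_atLeastAtMost' mm.continuous_on Rc continuous_on_subset[OF solution_continuous[OF sol]]) auto
  qed
  finally show "E x l *v v = (Y x l + (LINT t:{0..x}|lborel. R x t ** Y t l)) *v v"
    using res g[OF x] by (simp add: mv.add_left)
qed

text \<open>Insert the inverse transformation into the integral of the adjoint of \<open>E\<close>
  and exchange the two integrations: the operator acting on \<open>Y\<close> reappears as its
  adjoint acting on the step function.\<close>

lemma Et_gen_fourier:
  assumes sol: "solution B1 B2 H Q Y" and K: "transformation_kernel E Y K" and rk: "resolvent_kernel K R" and x: "0 \<le> x"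
  shows "mat_adj (Et x (of_real l)) *v u = gen_fourier Y (triangular_kernel.h R x u) l"
proof -
  interpret triangular_kernel R by unfold_locales (use rk in \<open>simp add: resolvent_kernel_def\<close>)
  interpret continuous_solution Y by unfold_locales (rule solution_continuous[OF sol])
  let ?Y = "Y0 (of_real l)" and ?i = "\<lambda>s. indicator {0..x} s :: real"
  \<comment> \<open>The integrand of the double integral: the adjoint of
    \<open>P s t ** Y t l\<close>, applied to \<open>u\<close>, with \<open>Y\<close> set to 0 for
    negative \<open>t\<close>.\<close>
  define w where "w s t = mat_adj (?Y t) *v (mat_adj (P s t) *v u)" for s t
  obtain c where c: "0 \<le> c" "\<And>t. t \<le> x \<Longrightarrow> norm (?Y t) \<le> c" using Y0_bound by blast
  obtain b where b: "0 \<le> b" "\<And>y s. y \<le> x \<Longrightarrow> norm (P y s) \<le> b * indicator {0..x} s" using P_bound by blast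
  obtain k1 where k1: "0 \<le> k1" "\<And>(C :: complex^'n^('n + 'n)) v. norm (mat_adj C *v v) \<le> norm C * norm v * k1"
    using bounded_bilinear.nonneg_bounded[OF bounded_bilinear_adj_mult_vec] by blast
  obtain k2 where k2: "0 \<le> k2" "\<And>(C :: complex^('n + 'n)^('n + 'n)) v. norm (mat_adj C *v v) \<le> norm C * norm v * k2"
    using bounded_bilinear.nonneg_bounded[OF bounded_bilinear_adj_mult_vec] by blast
  obtain k3 where k3: "0 \<le> k3" "\<And>(C :: complex^('n + 'n)^('n + 'n)) (D :: complex^'n^('n + 'n)). norm (C ** D) \<le> norm C * norm D * k3"
    using mm.nonneg_bounded by blast
  have bP: "norm (P s t) \<le> b" if "s \<le> x" for s t by (rule le_mult_indicatorD[OF b(2)[OF that] b(1)])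
  have P0: "P s t = 0" if "s \<le> x" "t \<notin> {0..x}" for s t using that by (auto simp: W.\<kappa>_def)
  have bw: "norm (?i s *\<^sub>R w s t) \<le> (c * (b * norm u * k2) * k1) * (?i s * ?i t)" for s t
  proof (cases "s \<in> {0..x} \<and> t \<in> {0..x}")
    case True
    have "norm (w s t) \<le> norm (?Y t) * norm (mat_adj (P s t) *v u) * k1" unfolding w_def by (rule k1)
    also have "\<dots> \<le> c * (b * norm u * k2) * k1"
    proof (intro mult_right_mono mult_mono c)
      have "norm (mat_adj (P s t) *v u) \<le> norm (P s t) * norm u * k2" by (rule k2)
      also have "\<dots> \<le> b * norm u * k2" using True bP k2 by (intro mult_right_mono) auto
      finally show "norm (mat_adj (P s t) *v u) \<le> b * norm u * k2" .
    qed (use True c k1 in auto)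
    finally show ?thesis using True by simp
  next
    case False
    then have "?i s *\<^sub>R w s t = 0" using P0[of s t] by (auto simp: w_def indicator_def mv.zero_left mv.zero_right)
    then show ?thesis using False by auto
  qed
  have bw': "norm (?i s *\<^sub>R w s t) \<le> (c * (b * norm u * k2) * k1) * (?i t * ?i s)" for s t
    using bw[of s t] by (simp add: mult.commute)
  have pm: "fst \<in> borel_measurable (borel :: (real \<times> real) measure)" "snd \<in> borel_measurable (borel :: (real \<times> real) measure)"
    by (auto simp: borel_prod[symmetric])
  have im: "(\<lambda>z::real \<times> real. ?i (fst z)) \<in> borel_measurable borel" "(\<lambda>z::real \<times> real. ?i (snd z)) \<in> borel_measurable borel"
    by (auto simp: borel_prod[symmetric])
  note ym = measurable_compose[OF pm(1) Y0_measurable[of "of_real l"]] measurable_compose[OF pm(2) Y0_measurable[of "of_real l"]]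
  note [measurable] = pm im ym
  have mw: "(\<lambda>z. ?i (fst z) *\<^sub>R w (fst z) (snd z)) \<in> borel_measurable borel" unfolding w_def by measurable
  have mw': "(\<lambda>z. ?i (snd z) *\<^sub>R w (snd z) (fst z)) \<in> borel_measurable borel" unfolding w_def by measurable
  note F = box_integrable2[OF mw bw] and F' = box_integrable2[OF mw' bw']
  have Es: "mat_adj (E s (of_real l)) *v u = mat_adj (?Y s) *v u + (LINT t|lborel. w s t)" if s: "s \<in> {0..x}" for s
  proof -
    have int: "integrable lborel (\<lambda>t. P s t ** ?Y t)"
    proof (rule box_integrable1[where D = "b * c * k3" and a = x])
      show "norm (P s t ** ?Y t) \<le> b * c * k3 * ?i t" for t
      proof (cases "t \<in> {0..x}")
        case True
        have "norm (P s t ** ?Y t) \<le> norm (P s t) * norm (?Y t) * k3" by (rule k3)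
        also have "\<dots> \<le> b * c * k3" using s True bP b c k3 by (intro mult_right_mono mult_mono) auto
        finally show ?thesis using True by simp
      qed (use P0[of s t] s in \<open>auto simp: mm.zero_left\<close>)
    qed measurable
    have "E s (of_real l) = Y s (of_real l) + (LINT t:{0..s}|lborel. R s t ** Y t (of_real l))"
      by (rule inverse_transformation[OF sol K rk]) (use s in auto)
    also have "(LINT t:{0..s}|lborel. R s t ** Y t (of_real l)) = (LINT t|lborel. P s t ** ?Y t)"
      unfolding set_lebesgue_integral_def
      by (rule integral_discrete_difference[of "{s}"]) (auto simp: indicator_def W.\<kappa>_def Y0_def mm.zero_left)
    finally have "mat_adj (E s (of_real l)) *v u = mat_adj (Y s (of_real l)) *v u + mat_adj (LINT t|lborel. P s t ** ?Y t) *v u"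
      by (simp add: mat_adj_add mv.add_left)
    also have "mat_adj (LINT t|lborel. P s t ** ?Y t) *v u = (LINT t|lborel. mat_adj (P s t ** ?Y t) *v u)"
      by (rule integral_bounded_linear[OF bounded_linear_adj_mult_vec int, symmetric])
    also have "\<dots> = (LINT t|lborel. w s t)" by (simp add: w_def mat_adj_mult matrix_vector_mul_assoc)
    also have "mat_adj (Y s (of_real l)) *v u = mat_adj (?Y s) *v u" using s by (simp add: Y0_def)
    finally show ?thesis .
  qed
  have L1: "L2on x (\<lambda>s. ?i s *\<^sub>R u)" by (intro stepf_L2on stepf.gen) (use x in auto)
  have int1: "integrable lborel (\<lambda>s. mat_adj (?Y s) *v (?i s *\<^sub>R u))" by (rule Y0_integrable[OF L1])
  have N_w: "mat_adj (?Y t) *v (mat_adj (N x t) *v u) = (LINT s|lborel. ?i s *\<^sub>R w s t)" for t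
  proof -
    have "mat_adj (?Y t) *v (mat_adj (N x t) *v u) = (LINT s|lborel. mat_adj (?Y t) *v (mat_adj (?i s *\<^sub>R P s t) *v u))"
      unfolding N_def
      by (rule integral_bounded_linear[OF bounded_linear_compose[OF mv.bounded_linear_right bounded_linear_adj_mult_vec] N_integrable, symmetric])
    also have "\<dots> = (LINT s|lborel. ?i s *\<^sub>R w s t)"
      by (simp only: w_def mat_adj_scaleR mv.scaleR_left mv.scaleR_right)
    finally show ?thesis .
  qed
  have "mat_adj (Et x (of_real l)) *v u = (LINT s|lborel. mat_adj (?Y s) *v (?i s *\<^sub>R u) + (LINT t|lborel. ?i s *\<^sub>R w s t))"
    unfolding Et_adj set_lebesgue_integral_def
  proof (intro Bochner_Integration.integral_cong refl)
    fix s show "indicator {0..x} s *\<^sub>R (mat_adj (E s (of_real l)) *v u) = mat_adj (?Y s) *v (?i s *\<^sub>R u) + (LINT t|lborel. ?i s *\<^sub>R w s t)"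
      by (cases "s \<in> {0..x}") (auto simp: Es mv.zero_right)
  qed
  also have "\<dots> = (LINT s|lborel. mat_adj (?Y s) *v (?i s *\<^sub>R u)) + (LINT s|lborel. LINT t|lborel. ?i s *\<^sub>R w s t)"
    by (rule Bochner_Integration.integral_add[OF int1 F(1)])
  also have "(LINT s|lborel. LINT t|lborel. ?i s *\<^sub>R w s t) = (LINT t|lborel. LINT s|lborel. ?i s *\<^sub>R w s t)" by (rule F(2))
  also have "(LINT s|lborel. mat_adj (?Y s) *v (?i s *\<^sub>R u)) + (LINT t|lborel. LINT s|lborel. ?i s *\<^sub>R w s t)
      = (LINT t|lborel. mat_adj (?Y t) *v (?i t *\<^sub>R u) + (LINT s|lborel. ?i s *\<^sub>R w s t))"
    by (rule Bochner_Integration.integral_add[OF int1 F'(1), symmetric])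
  also have "\<dots> = (LINT t|lborel. mat_adj (?Y t) *v h x u t)" by (simp only: h_def mv.add_right N_w)
  also have "\<dots> = gen_fourier Y (h x u) l" by (rule gen_fourier_Y0[OF h_L2on[OF x], symmetric])
  finally show ?thesis .
qed

lemma spectral_form:
  assumes sol: "solution B1 B2 H Q Y" and K: "transformation_kernel E Y K" and rk: "resolvent_kernel K R"
    and sp: "spectral_function Y \<sigma>" and \<Phi>: "matrix_density \<sigma> \<Phi>" and x: "0 \<le> x" and t: "0 \<le> t"
  shows "has_bochner_integral (trace_measure \<sigma>)
      (\<lambda>l. cinner (mat_adj (Et x (of_real l)) *v u) (\<Phi> l *v (mat_adj (Et t (of_real l)) *v v)))
      (of_real (min x t) * cinner u v + cinner u (wedge.\<kappa>2 (\<lambda>x t. R x t + triangular_kernel.Z R x t) (\<lambda>x t. mat_adj (R t x) + triangular_kernel.Z R x t) x t *v v))"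
proof -
  interpret triangular_kernel R by unfold_locales (use rk in \<open>simp add: resolvent_kernel_def\<close>)
  interpret continuous_solution Y by unfold_locales (rule solution_continuous[OF sol])
  have g: "gen_fourier Y (h y z) = (\<lambda>l. mat_adj (Et y (of_real l)) *v z)" if "0 \<le> y" for y z
    using Et_gen_fourier[OF sol K rk that] by (simp add: fun_eq_iff)
  \<comment> \<open>Measurability in \<lambda> is inherited from \<open>Et\<close> through
    \<open>Et_gen_fourier\<close>.\<close>
  have m: "gen_fourier Y (h y z) \<in> borel_measurable borel" if "0 \<le> y" for y z
    unfolding g[OF that] by measurable
  have "L2on (max x t) (h x u)" "L2on (max x t) (h t v)"
    using L2on_mono[OF h_L2on[OF x]] L2on_mono[OF h_L2on[OF t]] by auto
  from spectral_polarized[OF sp \<Phi> this m[OF x] m[OF t]]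
  show ?thesis using h_form[OF x t, of u v] by (simp add: g x t has_bochner_integral_iff)
qed

lemma spectral_function_density: assumes "spectral_function Y \<sigma>" obtains \<Phi> where "matrix_density \<sigma> \<Phi>"
proof -
  \<comment> \<open>The form integral of any admissible function carries a density; the zero
    function is one.\<close>
  have "L2_comp (\<lambda>x. 0)" by (simp add: L2_comp_def set_borel_measurable_def set_integrable_def)
  then show ?thesis using assms that unfolding spectral_function_def has_form_integral_def by blast
qed

theorem transformation_identity:
  assumes sol: "solution B1 B2 H Q Y" and K: "transformation_kernel E Y K" and rk: "resolvent_kernel K R"
    and sp: "spectral_function Y \<sigma>"
  shows "kernel_identity E \<sigma> (sigma0 B1) (F_kernel R)"
    and "\<exists>Ft. kernel_integral Et \<sigma> (sigma0 B1) Ft \<and> continuous_mixed_derivative Ft (F_kernel R)"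
proof -
  interpret triangular_kernel R by unfold_locales (use rk in \<open>simp add: resolvent_kernel_def\<close>)
  obtain \<Phi> where \<Phi>: "matrix_density \<sigma> \<Phi>" using spectral_function_density[OF sp] .
  have inc: "increasing_matrix \<sigma>" using sp by (simp add: spectral_function_def)
  note form = spectral_form[OF sol K rk sp \<Phi>]
  show "kernel_identity E \<sigma> (sigma0 B1) (F_kernel R)"
    by (rule kernel_identityI[OF inc \<Phi> FF.wedge_axioms F_kernel_lower F_kernel_upper form])
  have "has_matrix_integral_diff \<sigma> (sigma0 B1) (\<lambda>l. Et x (of_real l)) (\<lambda>l. Et t (of_real l)) (FF.\<kappa>2 x t)"
    if "0 \<le> x" "0 \<le> t" for x t
    unfolding has_matrix_integral_diff_def
  proof (intro exI conjI)
    show "has_matrix_integral \<sigma> (\<lambda>l. Et x (of_real l)) (\<lambda>l. Et t (of_real l)) (mat_scale (of_real (min x t)) (mat 1) + FF.\<kappa>2 x t)"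
      unfolding has_matrix_integral_density[OF inc \<Phi> Et_meas Et_meas] has_bochner_integral_matrix_iff cinner_sandwich
      using form[OF that] by (simp add: mv.add_left cin.add_right mat_scale_mult_vec cinner_scale_right)
    show "has_matrix_integral (sigma0 B1) (\<lambda>l. Et x (of_real l)) (\<lambda>l. Et t (of_real l)) (mat_scale (of_real (min x t)) (mat 1))"
      by (rule has_matrix_integral_sigma0[OF that])
  qed simp
  then have "kernel_integral Et \<sigma> (sigma0 B1) FF.\<kappa>2" by (simp add: kernel_integral_def)
  moreover have "continuous_mixed_derivative FF.\<kappa>2 (F_kernel R)"
    by (rule FF.\<kappa>2_mixed_derivative[OF refl F_kernel_lower F_kernel_upper])
  ultimately show "\<exists>Ft. kernel_integral Et \<sigma> (sigma0 B1) Ft \<and> continuous_mixed_derivative Ft (F_kernel R)" by blast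
qed

end

theorem proposition4p6:
  fixes B1 B2 H :: "complex^'n^'n"
    and Q :: "real \<Rightarrow> complex^('n + 'n)^('n + 'n)"
    and Y :: "real \<Rightarrow> complex \<Rightarrow> complex^'n^('n + 'n)"
  assumes "pos_def B1" and "pos_def B2"
    and "B1 = mat_adj H ** B2 ** H"
    and "continuous_on {0..} Q" and "\<forall>x\<ge>0. mat_adj (Q x) = Q x"
    and "solution B1 B2 H Q Y"
  shows
    "(\<forall>\<sigma> K R. spectral_function Y \<sigma> \<longrightarrow>
        transformation_kernel (e0 B1 B2 H) Y K \<longrightarrow> resolvent_kernel K R \<longrightarrow>
          (\<forall>x\<ge>0. \<forall>l. e0 B1 B2 H x l = Y x l + (LINT t:{0..x}|lborel. R x t ** Y t l)) \<and>
          kernel_identity (e0 B1 B2 H) \<sigma> (sigma0 B1) (F_kernel R))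
     \<and> (\<forall>\<sigma> K R. spectral_function Y \<sigma> \<longrightarrow>
        transformation_kernel (e0 B1 B2 H) Y K \<longrightarrow> resolvent_kernel K R \<longrightarrow>
          (\<exists>Ft. kernel_integral (e0_tilde B1 B2 H) \<sigma> (sigma0 B1) Ft \<and>
             continuous_mixed_derivative Ft (F_kernel R)))
     \<and> (\<forall>\<sigma> Ft F1. increasing_matrix \<sigma> \<longrightarrow>
        kernel_integral (e0_tilde B1 B2 H) \<sigma> (sigma0 B1) Ft \<longrightarrow>
        continuous_mixed_derivative Ft F1 \<longrightarrow>
          kernel_identity (e0 B1 B2 H) \<sigma> (sigma0 B1) F1)"
proof -
  interpret boundary_data B1 B2 H using assms(1-3) by unfold_locales
  note sol = assms(6)
  show ?thesis
  proof (intro conjI allI impI)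
    fix \<sigma> K R x l assume "transformation_kernel E Y K" "resolvent_kernel K R" "0 \<le> (x::real)"
    then show "E x l = Y x l + (LINT t:{0..x}|lborel. R x t ** Y t l)" by (rule inverse_transformation[OF sol])
  next
    fix \<sigma> K R assume "spectral_function Y \<sigma>" "transformation_kernel E Y K" "resolvent_kernel K R"
    then show "kernel_identity E \<sigma> (sigma0 B1) (F_kernel R)"
      "\<exists>Ft. kernel_integral Et \<sigma> (sigma0 B1) Ft \<and> continuous_mixed_derivative Ft (F_kernel R)"
      using transformation_identity[OF sol] by blast+
  next
    fix \<sigma> Ft F1 assume "increasing_matrix \<sigma>" "kernel_integral Et \<sigma> (sigma0 B1) Ft" "continuous_mixed_derivative Ft F1"
    then show "kernel_identity E \<sigma> (sigma0 B1) F1" by (rule converse_identity)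
  qed
qed

end
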